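(* The restriction of the relation $\prec_{\Pi^1_1}$ to the $\Pi^1_1$-sound (recursively enumerable) extensions of $\mathsf{ACA}_0$ is well-founded.
   Context: A theory $T$ in the language of second-order arithmetic is a recursively enumerable theory, given intensionally by a $\Sigma_1$ formula $\mathsf{Ax}_T(x)$ that defines, in the standard model, the set of Gödel numbers of the axioms of $T$. $\mathsf{Pr}_T(y)$ is the $\Sigma_1$ provability predicate $\exists x\,\mathsf{Prf}_T(x,y)$, where the $\Delta_0$ formula $\mathsf{Prf}_T(x,y)$ says that $x$ consists of a Hilbert-style proof of $y$ from axioms of $T$ together with a uniform bound for witnesses to the facts that the axioms used are axioms of $T$. $T$ is $\Pi^1_1$-sound if every $\Pi^1_1$ theorem of $T$ is true. $\mathsf{RFN}_{\Pi^1_1}(T)$ is the sentence of second-order arithmetic expressing the $\Pi^1_1$-soundness of $T$, i.e. $\forall\varphi\in\Pi^1_1\,(\mathsf{Pr}_T(\varphi)\to\mathsf{Tr}_{\Pi^1_1}(\varphi))$, where $\mathsf{Tr}_{\Pi^1_1}$ is a partial truth definition for $\Pi^1_1$ formulas over $\mathsf{ACA}_0$. For theories $T,U$ in the language of second-order arithmetic, $T\prec_{\Pi^1_1}U$ means $U\vdash\mathsf{RFN}_{\Pi^1_1}(T)$. *)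

theory Defs
  imports Main
begin

section \<open>The language of second-order arithmetic\<close>

text \<open>Named variables; number variables and set variables are indexed separately.
  The signature is \<open>0, 1, +, \<cdot>, =, <, \<in>\<close>, with equality for numbers only.\<close>

datatype tm =
    Var nat
  | Zero
  | One
  | Add tm tm  (infixl \<open>\<^bold>+\<close> 65)
  | Mul tm tm  (infixl \<open>\<^bold>*\<close> 70)

datatype fm =
    Eq tm tm  (infix \<open>\<^bold>=\<close> 50)
  | Lt tm tm  (infix \<open>\<^bold><\<close> 50)
  | Mem tm nat  (infix \<open>\<^bold>\<in>\<close> 50)
  | Fls
  | Imp fm fm  (infixr \<open>\<^bold>\<longrightarrow>\<close> 25)
  | Forall nat fm
  | ForallS nat fm

abbreviation Neg :: "fm \<Rightarrow> fm"  (\<open>\<^bold>\<not> _\<close> [40] 40) where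
  "\<^bold>\<not> p \<equiv> (p \<^bold>\<longrightarrow> Fls)"
abbreviation Conj :: "fm \<Rightarrow> fm \<Rightarrow> fm"  (infixr \<open>\<^bold>\<and>\<close> 35) where
  "p \<^bold>\<and> q \<equiv> \<^bold>\<not> (p \<^bold>\<longrightarrow> \<^bold>\<not> q)"
abbreviation Disj :: "fm \<Rightarrow> fm \<Rightarrow> fm"  (infixr \<open>\<^bold>\<or>\<close> 30) where
  "p \<^bold>\<or> q \<equiv> (\<^bold>\<not> p \<^bold>\<longrightarrow> q)"
abbreviation Iff :: "fm \<Rightarrow> fm \<Rightarrow> fm"  (infix \<open>\<^bold>\<longleftrightarrow>\<close> 24) where
  "p \<^bold>\<longleftrightarrow> q \<equiv> (p \<^bold>\<longrightarrow> q) \<^bold>\<and> (q \<^bold>\<longrightarrow> p)"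
abbreviation Exists :: "nat \<Rightarrow> fm \<Rightarrow> fm" where
  "Exists x p \<equiv> \<^bold>\<not> (Forall x (\<^bold>\<not> p))"
abbreviation ExistsS :: "nat \<Rightarrow> fm \<Rightarrow> fm" where
  "ExistsS X p \<equiv> \<^bold>\<not> (ForallS X (\<^bold>\<not> p))"

fun Conjs :: "fm list \<Rightarrow> fm" where
  "Conjs [] = (\<^bold>\<not> Fls)"
| "Conjs (p # ps) = (p \<^bold>\<and> Conjs ps)"

fun Disjs :: "fm list \<Rightarrow> fm" where
  "Disjs [] = Fls"
| "Disjs (p # ps) = (p \<^bold>\<or> Disjs ps)"

abbreviation ForallLess :: "nat \<Rightarrow> tm \<Rightarrow> fm \<Rightarrow> fm" where
  "ForallLess x t p \<equiv> Forall x (Var x \<^bold>< t \<^bold>\<longrightarrow> p)"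
abbreviation ExistsLess :: "nat \<Rightarrow> tm \<Rightarrow> fm \<Rightarrow> fm" where
  "ExistsLess x t p \<equiv> \<^bold>\<not> (ForallLess x t (\<^bold>\<not> p))"
abbreviation ForallLe :: "nat \<Rightarrow> tm \<Rightarrow> fm \<Rightarrow> fm" where
  "ForallLe x t p \<equiv> ForallLess x (t \<^bold>+ One) p"
abbreviation ExistsLe :: "nat \<Rightarrow> tm \<Rightarrow> fm \<Rightarrow> fm" where
  "ExistsLe x t p \<equiv> ExistsLess x (t \<^bold>+ One) p"

text \<open>\<open>ExistsLes x n t p\<close> is \<open>\<exists>x \<le> t. \<dots> \<exists>x+n-1 \<le> t. p\<close>.\<close>

fun ExistsLes :: "nat \<Rightarrow> nat \<Rightarrow> tm \<Rightarrow> fm \<Rightarrow> fm" where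
  "ExistsLes x 0 t p = p"
| "ExistsLes x (Suc n) t p = ExistsLe x t (ExistsLes (Suc x) n t p)"

primrec fv_tm :: "tm \<Rightarrow> nat set" where
  "fv_tm (Var x) = {x}"
| "fv_tm Zero = {}"
| "fv_tm One = {}"
| "fv_tm (s \<^bold>+ t) = fv_tm s \<union> fv_tm t"
| "fv_tm (s \<^bold>* t) = fv_tm s \<union> fv_tm t"

primrec fv :: "fm \<Rightarrow> nat set" where
  "fv (s \<^bold>= t) = fv_tm s \<union> fv_tm t"
| "fv (s \<^bold>< t) = fv_tm s \<union> fv_tm t"
| "fv (t \<^bold>\<in> X) = fv_tm t"
| "fv Fls = {}"
| "fv (p \<^bold>\<longrightarrow> q) = fv p \<union> fv q"
| "fv (Forall x p) = fv p - {x}"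
| "fv (ForallS X p) = fv p"

primrec fvS :: "fm \<Rightarrow> nat set" where
  "fvS (s \<^bold>= t) = {}"
| "fvS (s \<^bold>< t) = {}"
| "fvS (t \<^bold>\<in> X) = {X}"
| "fvS Fls = {}"
| "fvS (p \<^bold>\<longrightarrow> q) = fvS p \<union> fvS q"
| "fvS (Forall x p) = fvS p"
| "fvS (ForallS X p) = fvS p - {X}"

definition sentence :: "fm \<Rightarrow> bool" where
  "sentence p \<longleftrightarrow> fv p = {} \<and> fvS p = {}"

text \<open>A strict upper bound for all number variables, free or bound, of a formula.\<close>

primrec fresh_tm :: "tm \<Rightarrow> nat" where
  "fresh_tm (Var x) = Suc x"
| "fresh_tm Zero = 0"
| "fresh_tm One = 0"
| "fresh_tm (s \<^bold>+ t) = max (fresh_tm s) (fresh_tm t)"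
| "fresh_tm (s \<^bold>* t) = max (fresh_tm s) (fresh_tm t)"

primrec fresh :: "fm \<Rightarrow> nat" where
  "fresh (s \<^bold>= t) = max (fresh_tm s) (fresh_tm t)"
| "fresh (s \<^bold>< t) = max (fresh_tm s) (fresh_tm t)"
| "fresh (t \<^bold>\<in> X) = fresh_tm t"
| "fresh Fls = 0"
| "fresh (p \<^bold>\<longrightarrow> q) = max (fresh p) (fresh q)"
| "fresh (Forall x p) = max (Suc x) (fresh p)"
| "fresh (ForallS X p) = fresh p"

primrec subst_tm :: "nat \<Rightarrow> tm \<Rightarrow> tm \<Rightarrow> tm" where
  "subst_tm x t (Var y) = (if y = x then t else Var y)"
| "subst_tm x t Zero = Zero"
| "subst_tm x t One = One"
| "subst_tm x t (u \<^bold>+ v) = subst_tm x t u \<^bold>+ subst_tm x t v"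
| "subst_tm x t (u \<^bold>* v) = subst_tm x t u \<^bold>* subst_tm x t v"

text \<open>Substitution for the free occurrences of a variable, without renaming of bound variables;
  \<open>free_for x t p\<close> says that no variable of \<open>t\<close> is captured.\<close>

primrec subst :: "nat \<Rightarrow> tm \<Rightarrow> fm \<Rightarrow> fm" where
  "subst x t (u \<^bold>= v) = (subst_tm x t u \<^bold>= subst_tm x t v)"
| "subst x t (u \<^bold>< v) = (subst_tm x t u \<^bold>< subst_tm x t v)"
| "subst x t (u \<^bold>\<in> X) = (subst_tm x t u \<^bold>\<in> X)"
| "subst x t Fls = Fls"
| "subst x t (p \<^bold>\<longrightarrow> q) = (subst x t p \<^bold>\<longrightarrow> subst x t q)"
| "subst x t (Forall y p) = (if y = x then Forall y p else Forall y (subst x t p))"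
| "subst x t (ForallS Y p) = ForallS Y (subst x t p)"

primrec free_for :: "nat \<Rightarrow> tm \<Rightarrow> fm \<Rightarrow> bool" where
  "free_for x t (u \<^bold>= v) = True"
| "free_for x t (u \<^bold>< v) = True"
| "free_for x t (u \<^bold>\<in> X) = True"
| "free_for x t Fls = True"
| "free_for x t (p \<^bold>\<longrightarrow> q) = (free_for x t p \<and> free_for x t q)"
| "free_for x t (Forall y p) = (x \<notin> fv (Forall y p) \<or> y \<notin> fv_tm t \<and> free_for x t p)"
| "free_for x t (ForallS Y p) = free_for x t p"

primrec substS :: "nat \<Rightarrow> nat \<Rightarrow> fm \<Rightarrow> fm" where
  "substS X Y (u \<^bold>= v) = (u \<^bold>= v)"
| "substS X Y (u \<^bold>< v) = (u \<^bold>< v)"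
| "substS X Y (u \<^bold>\<in> Z) = (u \<^bold>\<in> (if Z = X then Y else Z))"
| "substS X Y Fls = Fls"
| "substS X Y (p \<^bold>\<longrightarrow> q) = (substS X Y p \<^bold>\<longrightarrow> substS X Y q)"
| "substS X Y (Forall z p) = Forall z (substS X Y p)"
| "substS X Y (ForallS Z p) = (if Z = X then ForallS Z p else ForallS Z (substS X Y p))"

primrec free_forS :: "nat \<Rightarrow> nat \<Rightarrow> fm \<Rightarrow> bool" where
  "free_forS X Y (u \<^bold>= v) = True"
| "free_forS X Y (u \<^bold>< v) = True"
| "free_forS X Y (u \<^bold>\<in> Z) = True"
| "free_forS X Y Fls = True"
| "free_forS X Y (p \<^bold>\<longrightarrow> q) = (free_forS X Y p \<and> free_forS X Y q)"
| "free_forS X Y (Forall z p) = free_forS X Y p"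
| "free_forS X Y (ForallS Z p) = (X \<notin> fvS (ForallS Z p) \<or> Z \<noteq> Y \<and> free_forS X Y p)"


section \<open>Formula classes\<close>

inductive delta0 :: "fm \<Rightarrow> bool" where
  "delta0 (s \<^bold>= t)"
| "delta0 (s \<^bold>< t)"
| "delta0 Fls"
| "delta0 p \<Longrightarrow> delta0 q \<Longrightarrow> delta0 (p \<^bold>\<longrightarrow> q)"
| "delta0 p \<Longrightarrow> x \<notin> fv_tm t \<Longrightarrow> delta0 (ForallLess x t p)"

inductive sigma1 :: "fm \<Rightarrow> bool" where
  "delta0 p \<Longrightarrow> sigma1 p"
| "sigma1 p \<Longrightarrow> sigma1 (Exists x p)"

primrec arithmetical :: "fm \<Rightarrow> bool" where
  "arithmetical (s \<^bold>= t) = True"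
| "arithmetical (s \<^bold>< t) = True"
| "arithmetical (t \<^bold>\<in> X) = True"
| "arithmetical Fls = True"
| "arithmetical (p \<^bold>\<longrightarrow> q) = (arithmetical p \<and> arithmetical q)"
| "arithmetical (Forall x p) = arithmetical p"
| "arithmetical (ForallS X p) = False"

definition pi11_sentence :: "fm \<Rightarrow> bool" where
  "pi11_sentence p \<longleftrightarrow> sentence p \<and> (\<exists>X q. p = ForallS X q \<and> arithmetical q)"


section \<open>Truth in the standard model\<close>

primrec eval :: "(nat \<Rightarrow> nat) \<Rightarrow> tm \<Rightarrow> nat" where
  "eval e (Var x) = e x"
| "eval e Zero = 0"
| "eval e One = 1"
| "eval e (s \<^bold>+ t) = eval e s + eval e t"
| "eval e (s \<^bold>* t) = eval e s * eval e t"

primrec sat :: "(nat \<Rightarrow> nat) \<Rightarrow> (nat \<Rightarrow> nat set) \<Rightarrow> fm \<Rightarrow> bool" where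
  "sat e E (s \<^bold>= t) \<longleftrightarrow> eval e s = eval e t"
| "sat e E (s \<^bold>< t) \<longleftrightarrow> eval e s < eval e t"
| "sat e E (t \<^bold>\<in> X) \<longleftrightarrow> eval e t \<in> E X"
| "sat e E Fls \<longleftrightarrow> False"
| "sat e E (p \<^bold>\<longrightarrow> q) \<longleftrightarrow> (sat e E p \<longrightarrow> sat e E q)"
| "sat e E (Forall x p) \<longleftrightarrow> (\<forall>n. sat (e(x := n)) E p)"
| "sat e E (ForallS X p) \<longleftrightarrow> (\<forall>A. sat e (E(X := A)) p)"

definition true_sentence :: "fm \<Rightarrow> bool" where
  "true_sentence p \<longleftrightarrow> (\<forall>e E. sat e E p)"


section \<open>Provability\<close>

inductive logical_axiom :: "fm \<Rightarrow> bool" where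
  "logical_axiom (p \<^bold>\<longrightarrow> (q \<^bold>\<longrightarrow> p))"
| "logical_axiom ((p \<^bold>\<longrightarrow> (q \<^bold>\<longrightarrow> r)) \<^bold>\<longrightarrow> ((p \<^bold>\<longrightarrow> q) \<^bold>\<longrightarrow> (p \<^bold>\<longrightarrow> r)))"
| "logical_axiom (\<^bold>\<not> (\<^bold>\<not> p) \<^bold>\<longrightarrow> p)"
| "free_for x t p \<Longrightarrow> logical_axiom (Forall x p \<^bold>\<longrightarrow> subst x t p)"
| "x \<notin> fv p \<Longrightarrow> logical_axiom (Forall x (p \<^bold>\<longrightarrow> q) \<^bold>\<longrightarrow> (p \<^bold>\<longrightarrow> Forall x q))"
| "free_forS X Y p \<Longrightarrow> logical_axiom (ForallS X p \<^bold>\<longrightarrow> substS X Y p)"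
| "X \<notin> fvS p \<Longrightarrow> logical_axiom (ForallS X (p \<^bold>\<longrightarrow> q) \<^bold>\<longrightarrow> (p \<^bold>\<longrightarrow> ForallS X q))"
| "logical_axiom (t \<^bold>= t)"
| "free_for x s p \<Longrightarrow> free_for x t p \<Longrightarrow>
     logical_axiom (s \<^bold>= t \<^bold>\<longrightarrow> (subst x s p \<^bold>\<longrightarrow> subst x t p))"

inductive provable :: "fm set \<Rightarrow> fm \<Rightarrow> bool" for \<Gamma> :: "fm set" where
  logical: "logical_axiom p \<Longrightarrow> provable \<Gamma> p"
| nonlogical: "p \<in> \<Gamma> \<Longrightarrow> provable \<Gamma> p"
| modus_ponens: "provable \<Gamma> p \<Longrightarrow> provable \<Gamma> (p \<^bold>\<longrightarrow> q) \<Longrightarrow> provable \<Gamma> q"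
| generalization: "provable \<Gamma> p \<Longrightarrow> provable \<Gamma> (Forall x p)"
| generalizationS: "provable \<Gamma> p \<Longrightarrow> provable \<Gamma> (ForallS X p)"

text \<open>The axioms of \<open>ACA\<^sub>0\<close>, in the form of open formulas (by generalization, these are
  interchangeable with their universal closures).\<close>

inductive_set ACA0 :: "fm set" where
  "(\<^bold>\<not> (Var 0 \<^bold>+ One \<^bold>= Zero)) \<in> ACA0"
| "(Var 0 \<^bold>+ One \<^bold>= Var 1 \<^bold>+ One \<^bold>\<longrightarrow> Var 0 \<^bold>= Var 1) \<in> ACA0"
| "(Var 0 \<^bold>+ Zero \<^bold>= Var 0) \<in> ACA0"
| "(Var 0 \<^bold>+ (Var 1 \<^bold>+ One) \<^bold>= (Var 0 \<^bold>+ Var 1) \<^bold>+ One) \<in> ACA0"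
| "(Var 0 \<^bold>* Zero \<^bold>= Zero) \<in> ACA0"
| "(Var 0 \<^bold>* (Var 1 \<^bold>+ One) \<^bold>= (Var 0 \<^bold>* Var 1) \<^bold>+ Var 0) \<in> ACA0"
| "(\<^bold>\<not> (Var 0 \<^bold>< Zero)) \<in> ACA0"
| "(Var 0 \<^bold>< Var 1 \<^bold>+ One \<^bold>\<longleftrightarrow> (Var 0 \<^bold>< Var 1 \<^bold>\<or> Var 0 \<^bold>= Var 1)) \<in> ACA0"
| "(Zero \<^bold>\<in> 0 \<^bold>\<and> Forall 0 (Var 0 \<^bold>\<in> 0 \<^bold>\<longrightarrow> Var 0 \<^bold>+ One \<^bold>\<in> 0)
     \<^bold>\<longrightarrow> Forall 0 (Var 0 \<^bold>\<in> 0)) \<in> ACA0"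
| "arithmetical p \<Longrightarrow> X \<notin> fvS p \<Longrightarrow>
     ExistsS X (Forall x (Var x \<^bold>\<in> X \<^bold>\<longleftrightarrow> p)) \<in> ACA0"


section \<open>Goedel numbers\<close>

definition pair :: "nat \<Rightarrow> nat \<Rightarrow> nat" where
  "pair m n = (m + n) * (m + n) + m"

primrec gn_tm :: "tm \<Rightarrow> nat" where
  "gn_tm (Var x) = pair 0 x"
| "gn_tm Zero = pair 1 0"
| "gn_tm One = pair 2 0"
| "gn_tm (s \<^bold>+ t) = pair 3 (pair (gn_tm s) (gn_tm t))"
| "gn_tm (s \<^bold>* t) = pair 4 (pair (gn_tm s) (gn_tm t))"

primrec gn :: "fm \<Rightarrow> nat" where
  "gn (s \<^bold>= t) = pair 5 (pair (gn_tm s) (gn_tm t))"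
| "gn (s \<^bold>< t) = pair 6 (pair (gn_tm s) (gn_tm t))"
| "gn (t \<^bold>\<in> X) = pair 7 (pair (gn_tm t) X)"
| "gn Fls = pair 8 0"
| "gn (p \<^bold>\<longrightarrow> q) = pair 9 (pair (gn p) (gn q))"
| "gn (Forall x p) = pair 10 (pair x (gn p))"
| "gn (ForallS X p) = pair 11 (pair X (gn p))"


section \<open>Recursively enumerable theories\<close>

text \<open>A theory is given intensionally, by a \<open>\<Sigma>\<^sub>1\<close> formula in the single free variable \<open>0\<close> that
  defines, in the standard model, the set of Goedel numbers of its axioms.\<close>

definition re_theory :: "fm \<Rightarrow> bool" where
  "re_theory T \<longleftrightarrow> sigma1 T \<and> fv T \<subseteq> {0} \<and>
     (\<forall>e E. sat e E T \<longrightarrow> (\<exists>p. sentence p \<and> e 0 = gn p))"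

definition axioms_of :: "fm \<Rightarrow> fm set" where
  "axioms_of T = {p. \<forall>e E. sat (e(0 := gn p)) E T}"

definition proves :: "fm \<Rightarrow> fm \<Rightarrow> bool"  (infix \<open>\<turnstile>\<close> 55) where
  "T \<turnstile> p \<longleftrightarrow> provable (axioms_of T) p"

definition pi11_sound :: "fm \<Rightarrow> bool" where
  "pi11_sound T \<longleftrightarrow> (\<forall>p. pi11_sentence p \<longrightarrow> T \<turnstile> p \<longrightarrow> true_sentence p)"

definition extends_ACA0 :: "fm \<Rightarrow> bool" where
  "extends_ACA0 T \<longleftrightarrow> (\<forall>p\<in>ACA0. T \<turnstile> p)"


section \<open>Arithmetization of syntax\<close>

text \<open>
  The functions below build formulas of the object language. Their first argument \<open>k\<close> is the least
  number variable that they may bind: the terms passed to them only contain variables below \<open>k\<close>.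
  An argument \<open>b\<close> bounds all existential quantifiers in a formula, so that all
  formulas with such an argument are \<open>\<Delta>\<^sub>0\<close>.
\<close>

primrec num :: "nat \<Rightarrow> tm" where
  "num 0 = Zero"
| "num (Suc n) = num n \<^bold>+ One"

definition cPair :: "tm \<Rightarrow> tm \<Rightarrow> tm" where
  "cPair s t = (s \<^bold>+ t) \<^bold>* (s \<^bold>+ t) \<^bold>+ s"

definition "cVar x = cPair (num 0) x"
definition "cZero = cPair (num 1) (num 0)"
definition "cOne = cPair (num 2) (num 0)"
definition "cAdd s t = cPair (num 3) (cPair s t)"
definition "cMul s t = cPair (num 4) (cPair s t)"
definition "cEq s t = cPair (num 5) (cPair s t)"
definition "cLt s t = cPair (num 6) (cPair s t)"
definition "cMem t X = cPair (num 7) (cPair t X)"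
definition "cFls = cPair (num 8) (num 0)"
definition "cImp p q = cPair (num 9) (cPair p q)"
definition "cForall x p = cPair (num 10) (cPair x p)"
definition "cForallS X p = cPair (num 11) (cPair X p)"

text \<open>Goedel's \<open>\<beta>\<close> function: \<open>z = a mod (1 + (i + 1) m)\<close>.\<close>

definition beta_fm :: "nat \<Rightarrow> tm \<Rightarrow> tm \<Rightarrow> tm \<Rightarrow> tm \<Rightarrow> fm" where
  "beta_fm k a m i z =
     (let d = One \<^bold>+ (i \<^bold>+ One) \<^bold>* m
      in z \<^bold>< d \<^bold>\<and> ExistsLe k a (a \<^bold>= Var k \<^bold>* d \<^bold>+ z))"

text \<open>\<open>derivation k a m l c R\<close> says that the sequence of length \<open>l + 1\<close> coded by \<open>a, m\<close> ends with
  \<open>c\<close> and that each of its entries \<open>z\<close> satisfies \<open>R k E z\<close>, where \<open>E k u\<close> says that \<open>u\<close> is an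
  earlier entry. \<open>derivable k b c R\<close> says that there is such a sequence with code bounded
  by \<open>b\<close>; thus \<open>c\<close> belongs to the least set closed under \<open>R\<close>.\<close>

definition derivation ::
  "nat \<Rightarrow> tm \<Rightarrow> tm \<Rightarrow> tm \<Rightarrow> tm \<Rightarrow> (nat \<Rightarrow> (nat \<Rightarrow> tm \<Rightarrow> fm) \<Rightarrow> tm \<Rightarrow> fm) \<Rightarrow> fm" where
  "derivation k a m l c R =
     (beta_fm k a m l c \<^bold>\<and>
      ForallLe k l (ForallLe (k+1) a (beta_fm (k+2) a m (Var k) (Var (k+1)) \<^bold>\<longrightarrow>
        R (k+2)
          (\<lambda>j u. ExistsLess j (Var k) (beta_fm (j+1) a m (Var j) u))
          (Var (k+1)))))"

definition derivable ::
  "nat \<Rightarrow> tm \<Rightarrow> tm \<Rightarrow> (nat \<Rightarrow> (nat \<Rightarrow> tm \<Rightarrow> fm) \<Rightarrow> tm \<Rightarrow> fm) \<Rightarrow> fm" where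
  "derivable k b c R =
     ExistsLes k 3 b (derivation (k+3) (Var k) (Var (k+1)) (Var (k+2)) c R)"

text \<open>Codes of terms all of whose variables satisfy \<open>V\<close>.\<close>

definition tm_over :: "(tm \<Rightarrow> fm) \<Rightarrow> nat \<Rightarrow> tm \<Rightarrow> tm \<Rightarrow> fm" where
  "tm_over V k b t = derivable k b t (\<lambda>k E z.
     let x = Var k; y = Var (k+1) in ExistsLes k 2 b (Disjs [
       Conjs [V x, z \<^bold>= cVar x],
       z \<^bold>= cZero,
       z \<^bold>= cOne,
       Conjs [z \<^bold>= cAdd x y \<^bold>\<or> z \<^bold>= cMul x y, E (k+2) x, E (k+2) y]]))"

definition is_tm :: "nat \<Rightarrow> tm \<Rightarrow> tm \<Rightarrow> fm" where
  "is_tm = tm_over (\<lambda>x. \<^bold>\<not> Fls)"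

definition tm_avoids :: "nat \<Rightarrow> tm \<Rightarrow> tm \<Rightarrow> tm \<Rightarrow> fm" where
  "tm_avoids k b v t = tm_over (\<lambda>x. \<^bold>\<not> (x \<^bold>= v)) k b t"

text \<open>Codes of formulas built from terms satisfying \<open>TM\<close> and set variables satisfying \<open>SV\<close>, with
  quantification over number variables restricted by \<open>Q\<close> and over set variables by \<open>QS\<close>.\<close>

definition fm_over ::
  "(nat \<Rightarrow> tm \<Rightarrow> tm \<Rightarrow> fm) \<Rightarrow> (tm \<Rightarrow> fm) \<Rightarrow>
   (nat \<Rightarrow> (nat \<Rightarrow> tm \<Rightarrow> fm) \<Rightarrow> tm \<Rightarrow> tm \<Rightarrow> fm) \<Rightarrow>
   (nat \<Rightarrow> (nat \<Rightarrow> tm \<Rightarrow> fm) \<Rightarrow> tm \<Rightarrow> tm \<Rightarrow> fm) \<Rightarrow> nat \<Rightarrow> tm \<Rightarrow> tm \<Rightarrow> fm" where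
  "fm_over TM SV Q QS k b p = derivable k b p (\<lambda>k E z.
     let x = Var k; y = Var (k+1); n = k+2 in ExistsLes k 2 b (Disjs [
       Conjs [z \<^bold>= cEq x y \<^bold>\<or> z \<^bold>= cLt x y, TM n b x, TM n b y],
       Conjs [z \<^bold>= cMem x y, TM n b x, SV y],
       z \<^bold>= cFls,
       Conjs [z \<^bold>= cImp x y, E n x, E n y],
       Conjs [z \<^bold>= cForall x y, Q n E x y],
       Conjs [z \<^bold>= cForallS x y, QS n E x y]]))"

definition is_fm :: "nat \<Rightarrow> tm \<Rightarrow> tm \<Rightarrow> fm" where
  "is_fm = fm_over is_tm (\<lambda>Y. \<^bold>\<not> Fls) (\<lambda>k E x p. E k p) (\<lambda>k E X p. E k p)"

definition is_arithmetical :: "nat \<Rightarrow> tm \<Rightarrow> tm \<Rightarrow> fm" where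
  "is_arithmetical = fm_over is_tm (\<lambda>Y. \<^bold>\<not> Fls) (\<lambda>k E x p. E k p) (\<lambda>k E X p. Fls)"

text \<open>Codes of formulas in which the number variable \<open>v\<close>, or the set variable \<open>V\<close>, is not free.\<close>

definition not_free :: "nat \<Rightarrow> tm \<Rightarrow> tm \<Rightarrow> tm \<Rightarrow> fm" where
  "not_free k b v p =
     fm_over (\<lambda>k b t. tm_avoids k b v t) (\<lambda>Y. \<^bold>\<not> Fls)
       (\<lambda>k E x q. (x \<^bold>= v \<^bold>\<and> is_fm k b q) \<^bold>\<or> E k q) (\<lambda>k E X q. E k q) k b p"

definition not_freeS :: "nat \<Rightarrow> tm \<Rightarrow> tm \<Rightarrow> tm \<Rightarrow> fm" where
  "not_freeS k b V p =
     fm_over is_tm (\<lambda>Y. \<^bold>\<not> (Y \<^bold>= V))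
       (\<lambda>k E x q. E k q) (\<lambda>k E X q. (X \<^bold>= V \<^bold>\<and> is_fm k b q) \<^bold>\<or> E k q) k b p"

text \<open>The graphs of substitution, restricted (for formulas) to substitutable terms: sets
  of pairs consisting of an expression and the result of substituting \<open>t\<close> for \<open>v\<close>, or \<open>W\<close> for \<open>V\<close>.\<close>

definition is_subst_tm :: "nat \<Rightarrow> tm \<Rightarrow> tm \<Rightarrow> tm \<Rightarrow> tm \<Rightarrow> tm \<Rightarrow> fm" where
  "is_subst_tm k b v t u u' = derivable k b (cPair u u') (\<lambda>k E z.
     let x = Var k; y = Var (k+1); x' = Var (k+2); y' = Var (k+3); n = k+4
     in ExistsLes k 4 b (Disjs [
       z \<^bold>= cPair (cVar v) t,
       Conjs [\<^bold>\<not> (x \<^bold>= v), z \<^bold>= cPair (cVar x) (cVar x)],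
       z \<^bold>= cPair cZero cZero,
       z \<^bold>= cPair cOne cOne,
       Conjs [z \<^bold>= cPair (cAdd x y) (cAdd x' y') \<^bold>\<or> z \<^bold>= cPair (cMul x y) (cMul x' y'),
              E n (cPair x x'), E n (cPair y y')]]))"

definition is_subst :: "nat \<Rightarrow> tm \<Rightarrow> tm \<Rightarrow> tm \<Rightarrow> tm \<Rightarrow> tm \<Rightarrow> fm" where
  "is_subst k b v t p p' = derivable k b (cPair p p') (\<lambda>k E z.
     let x = Var k; y = Var (k+1); x' = Var (k+2); y' = Var (k+3); n = k+4
     in ExistsLes k 4 b (Disjs [
       Conjs [z \<^bold>= cPair (cEq x y) (cEq x' y') \<^bold>\<or> z \<^bold>= cPair (cLt x y) (cLt x' y'),
              is_subst_tm n b v t x x', is_subst_tm n b v t y y'],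
       Conjs [z \<^bold>= cPair (cMem x y) (cMem x' y), is_subst_tm n b v t x x'],
       z \<^bold>= cPair cFls cFls,
       Conjs [z \<^bold>= cPair (cImp x y) (cImp x' y'), E n (cPair x x'), E n (cPair y y')],
       Conjs [z \<^bold>= cPair (cForall x y) (cForall x y),
              not_free n b v (cForall x y)],
       Conjs [z \<^bold>= cPair (cForall x y) (cForall x y'),
              \<^bold>\<not> (x \<^bold>= v), tm_avoids n b x t, E n (cPair y y')],
       Conjs [z \<^bold>= cPair (cForallS x y) (cForallS x y'), E n (cPair y y')]]))"

definition is_substS :: "nat \<Rightarrow> tm \<Rightarrow> tm \<Rightarrow> tm \<Rightarrow> tm \<Rightarrow> tm \<Rightarrow> fm" where
  "is_substS k b V W p p' = derivable k b (cPair p p') (\<lambda>k E z.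
     let x = Var k; y = Var (k+1); x' = Var (k+2); y' = Var (k+3); n = k+4
     in ExistsLes k 4 b (Disjs [
       Conjs [z \<^bold>= cPair (cEq x y) (cEq x y) \<^bold>\<or> z \<^bold>= cPair (cLt x y) (cLt x y),
              is_tm n b x, is_tm n b y],
       Conjs [z \<^bold>= cPair (cMem x V) (cMem x W), is_tm n b x],
       Conjs [\<^bold>\<not> (y \<^bold>= V), z \<^bold>= cPair (cMem x y) (cMem x y), is_tm n b x],
       z \<^bold>= cPair cFls cFls,
       Conjs [z \<^bold>= cPair (cImp x y) (cImp x' y'), E n (cPair x x'), E n (cPair y y')],
       Conjs [z \<^bold>= cPair (cForall x y) (cForall x y'), E n (cPair y y')],
       Conjs [z \<^bold>= cPair (cForallS x y) (cForallS x y),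
              not_freeS n b V (cForallS x y)],
       Conjs [z \<^bold>= cPair (cForallS x y) (cForallS x y'),
              \<^bold>\<not> (x \<^bold>= V), \<^bold>\<not> (x \<^bold>= W), E n (cPair y y')]]))"

definition is_logical_axiom :: "nat \<Rightarrow> tm \<Rightarrow> tm \<Rightarrow> fm" where
  "is_logical_axiom k b z =
     (let p = Var k; q = Var (k+1); r = Var (k+2); x = Var (k+3); s = Var (k+4); t = Var (k+5);
          n = k+6
      in ExistsLes k 6 b (Disjs [
       Conjs [is_fm n b p, is_fm n b q,
              z \<^bold>= cImp p (cImp q p)],
       Conjs [is_fm n b p, is_fm n b q, is_fm n b r,
              z \<^bold>= cImp (cImp p (cImp q r)) (cImp (cImp p q) (cImp p r))],
       Conjs [is_fm n b p,
              z \<^bold>= cImp (cImp (cImp p cFls) cFls) p],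
       Conjs [is_fm n b p, is_tm n b t, is_subst n b x t p q,
              z \<^bold>= cImp (cForall x p) q],
       Conjs [not_free n b x p, is_fm n b q,
              z \<^bold>= cImp (cForall x (cImp p q)) (cImp p (cForall x q))],
       Conjs [is_fm n b p, is_substS n b x s p q,
              z \<^bold>= cImp (cForallS x p) q],
       Conjs [not_freeS n b x p, is_fm n b q,
              z \<^bold>= cImp (cForallS x (cImp p q)) (cImp p (cForallS x q))],
       Conjs [is_tm n b t,
              z \<^bold>= cEq t t],
       Conjs [is_fm n b p, is_tm n b s, is_tm n b t, is_subst n b x s p q, is_subst n b x t p r,
              z \<^bold>= cImp (cEq s t) (cImp q r)]]))"

text \<open>Bounding by \<open>b\<close> the leading unbounded existential quantifiers of a \<open>\<Sigma>\<^sub>1\<close> formula.\<close>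

fun bound_witnesses :: "tm \<Rightarrow> fm \<Rightarrow> fm" where
  "bound_witnesses b (Exists x p) =
     (if delta0 (Exists x p) then Exists x p else ExistsLe x b (bound_witnesses b p))"
| "bound_witnesses b p = p"

text \<open>\<open>Prf_fm T k x y\<close> says that \<open>x\<close> codes a Hilbert-style proof of \<open>y\<close> from the axioms of \<open>T\<close>,
  together with a uniform bound \<open>b\<close> for the witnesses to the facts that the axioms used in it
  are axioms (of logic or of \<open>T\<close>). It requires \<open>fresh T \<le> k\<close>, and that the variables
  of \<open>x\<close> and \<open>y\<close> be less than \<open>k\<close>.\<close>

definition Prf_fm :: "fm \<Rightarrow> nat \<Rightarrow> tm \<Rightarrow> tm \<Rightarrow> fm" where
  "Prf_fm T k x y =
     (let b = Var k; a = Var (k+1); m = Var (k+2); l = Var (k+3) in ExistsLes k 4 x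
       (x \<^bold>= cPair b (cPair a (cPair m l)) \<^bold>\<and>
        derivation (k+4) a m l y (\<lambda>k E z. let p = Var k; v = Var (k+1); n = k+2
          in ExistsLes k 2 b (Disjs [
            is_logical_axiom n b z,
            subst 0 z (bound_witnesses b T),
            Conjs [E n p, E n (cImp p z)],
            Conjs [E n p, z \<^bold>= cForall v p \<^bold>\<or> z \<^bold>= cForallS v p]]))))"

definition Pr_fm :: "fm \<Rightarrow> nat \<Rightarrow> tm \<Rightarrow> fm" where
  "Pr_fm T k y = Exists k (Prf_fm T (k+1) (Var k) y)"


section \<open>The truth definition for \<open>\<Pi>\<^sup>1\<^sub>1\<close> sentences\<close>

definition is_pi11_sentence :: "nat \<Rightarrow> tm \<Rightarrow> fm" where
  "is_pi11_sentence k y = (let b = Var k; X = Var (k+1); p = Var (k+2); v = Var (k+1) in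
     Exists k (
       ExistsLe (k+1) y (ExistsLe (k+2) y
         (y \<^bold>= cForallS X p \<^bold>\<and> is_arithmetical (k+3) b p)) \<^bold>\<and>
       ForallLe (k+1) y (not_free (k+2) b v y \<^bold>\<and> not_freeS (k+2) b v y)))"

text \<open>\<open>n\<close> is the value of the term \<open>t\<close> under the assignment coded by \<open>a, m\<close>, which maps each number
  variable \<open>v\<close> to \<open>\<beta>(a, m, v)\<close>.\<close>

definition is_value :: "nat \<Rightarrow> tm \<Rightarrow> tm \<Rightarrow> tm \<Rightarrow> tm \<Rightarrow> fm" where
  "is_value k a m t n = Exists k (let b = Var k in
     derivable (k+1) b (cPair t n) (\<lambda>k E z.
       let x = Var k; y = Var (k+1); i = Var (k+2); j = Var (k+3); n = k+4
       in ExistsLes k 4 b (Disjs [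
         Conjs [z \<^bold>= cPair (cVar x) i, beta_fm n a m x i],
         z \<^bold>= cPair cZero Zero,
         z \<^bold>= cPair cOne One,
         Conjs [z \<^bold>= cPair (cAdd x y) (i \<^bold>+ j) \<^bold>\<or> z \<^bold>= cPair (cMul x y) (i \<^bold>* j),
                E n (cPair x i), E n (cPair y j)]])))"

text \<open>The assignments coded by \<open>a, m\<close> and \<open>a', m'\<close> agree on the variables \<open>w \<le> t\<close> other than \<open>v\<close>.\<close>

definition is_variant :: "nat \<Rightarrow> tm \<Rightarrow> tm \<Rightarrow> tm \<Rightarrow> tm \<Rightarrow> tm \<Rightarrow> tm \<Rightarrow> fm" where
  "is_variant k t v a m a' m' =
     ForallLe k t (\<^bold>\<not> (Var k \<^bold>= v) \<^bold>\<longrightarrow>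
       ExistsLe (k+1) a (beta_fm (k+2) a m (Var k) (Var (k+1)) \<^bold>\<and>
                         beta_fm (k+2) a' m' (Var k) (Var (k+1))))"

text \<open>In \<open>is_sat_class\<close> and \<open>Tr_fm\<close> the set variables are \<open>X = 0\<close>, \<open>C = 1\<close> and \<open>D = 2\<close>. The formula
  \<open>is_sat_class k t\<close> says that \<open>D\<close> contains \<open>t\<close> and is closed under immediate subformulas, and
  that \<open>C\<close>, as a set of pairs of formulas and assignments, satisfies Tarski's clauses for the
  arithmetical formulas in \<open>D\<close>, every set variable being interpreted by \<open>X\<close>.

  All number variables of \<open>t\<close> are less than its code, so \<open>is_variant\<close> need not look further.\<close>

definition is_sat_class :: "nat \<Rightarrow> tm \<Rightarrow> fm" where
  "is_sat_class k t =
     (let p = Var k; a = Var (k+1); m = Var (k+2); x = Var (k+3); y = Var (k+4);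
          i = Var (k+5); j = Var (k+6); a' = Var (k+5); m' = Var (k+6); n = k+7;
          holds = (\<lambda>q a m. cPair q (cPair a m) \<^bold>\<in> 1)
      in t \<^bold>\<in> 2 \<^bold>\<and>
         Forall k (p \<^bold>\<in> 2 \<^bold>\<longrightarrow>
         Forall (k+1) (Forall (k+2) (Forall (k+3) (Forall (k+4) (Conjs [
           p \<^bold>= cEq x y \<^bold>\<longrightarrow>
             (holds p a m \<^bold>\<longleftrightarrow> Exists (k+5) (is_value n a m x i \<^bold>\<and> is_value n a m y i)),
           p \<^bold>= cLt x y \<^bold>\<longrightarrow>
             (holds p a m \<^bold>\<longleftrightarrow> Exists (k+5) (Exists (k+6)
               (Conjs [is_value n a m x i, is_value n a m y j, i \<^bold>< j]))),
           p \<^bold>= cMem x y \<^bold>\<longrightarrow>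
             (holds p a m \<^bold>\<longleftrightarrow> Exists (k+5) (is_value n a m x i \<^bold>\<and> i \<^bold>\<in> 0)),
           p \<^bold>= cFls \<^bold>\<longrightarrow>
             \<^bold>\<not> holds p a m,
           p \<^bold>= cImp x y \<^bold>\<longrightarrow>
             Conjs [x \<^bold>\<in> 2, y \<^bold>\<in> 2, holds p a m \<^bold>\<longleftrightarrow> (holds x a m \<^bold>\<longrightarrow> holds y a m)],
           p \<^bold>= cForall x y \<^bold>\<longrightarrow>
             Conjs [y \<^bold>\<in> 2, holds p a m \<^bold>\<longleftrightarrow> Forall (k+5) (Forall (k+6)
               (is_variant n t x a m a' m' \<^bold>\<longrightarrow> holds y a' m'))]]))))))"

text \<open>The sentence \<open>\<forall>X \<theta>(X)\<close> is true if, for every \<open>X\<close>, the formula \<open>\<theta>\<close> belongs to every satisfaction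
  class with respect to \<open>X\<close> that is defined on the subformulas of \<open>\<theta>\<close>. (As \<open>\<forall>X \<theta>(X)\<close> is closed, its
  bound variable is the only set variable in \<open>\<theta>\<close>, and the choice of the assignment is immaterial.)
  For each concrete \<open>\<theta>\<close>, \<open>ACA\<^sub>0\<close> proves that there is such a class and that the membership of \<open>\<theta>\<close>
  in it is determined by \<open>X\<close>.\<close>

definition Tr_fm :: "nat \<Rightarrow> tm \<Rightarrow> fm" where
  "Tr_fm k y = (let X = Var k; t = Var (k+1); a = Var (k+2); m = Var (k+3) in
     Forall k (Forall (k+1) (y \<^bold>= cForallS X t \<^bold>\<longrightarrow>
       ForallS 0 (ForallS 1 (ForallS 2 (is_sat_class (k+2) t \<^bold>\<longrightarrow>
         Forall (k+2) (Forall (k+3) (cPair t (cPair a m) \<^bold>\<in> 1))))))))"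


section \<open>Reflection and the reflection order\<close>

definition RFN :: "fm \<Rightarrow> fm" where
  "RFN T = (let k = fresh T; y = Var k in
     Forall k (is_pi11_sentence (k+1) y \<^bold>\<and> Pr_fm T (k+1) y \<^bold>\<longrightarrow> Tr_fm (k+1) y))"

definition prec_pi11 :: "fm \<Rightarrow> fm \<Rightarrow> bool"  (infix \<open>\<prec>\<^sub>\<Pi>\<^sub>1\<^sub>1\<close> 50) where
  "T \<prec>\<^sub>\<Pi>\<^sub>1\<^sub>1 U \<longleftrightarrow> U \<turnstile> RFN T"

end

theory Submission
  imports Defs "HOL-Number_Theory.Cong"
begin

text \<open>
  Suppose that \<open>T\<^sub>0, T\<^sub>1, \<dots>\<close> is a descending sequence. By pure logic and one instance of comprehension,
  \<open>T\<^sub>i\<close> proves the \<open>\<Pi>\<^sup>1\<^sub>1\<close> sentence \<open>\<forall>Z. \<phi>\<^sub>i\<^sub>+\<^sub>1(Z)\<close> to the effect that no set \<open>Z\<close> codes a refutation of the reflection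
  principle for \<open>T\<^sub>i\<^sub>+\<^sub>1\<close>, that is to say, a set \<open>X\<close> together with a satisfaction class with respect to \<open>X\<close>
  that rejects the matrix of some \<open>\<Pi>\<^sup>1\<^sub>1\<close> theorem of \<open>T\<^sub>i\<^sub>+\<^sub>1\<close>.

  In the real world there are sets \<open>Z\<^sub>i\<close> such that every \<open>Z\<^sub>i\<close> is a refutation of this kind, given by the
  theorem \<open>\<forall>Z. \<phi>\<^sub>i\<^sub>+\<^sub>1(Z)\<close> of \<open>T\<^sub>i\<close>, the set \<open>X = Z\<^sub>i\<^sub>+\<^sub>1\<close> and a satisfaction class that rejects \<open>\<phi>\<^sub>i\<^sub>+\<^sub>1(Z\<^sub>i\<^sub>+\<^sub>1)\<close>. This is
  consistent because \<open>Z\<^sub>i\<^sub>+\<^sub>1\<close> itself is a refutation. As \<open>\<phi>\<^sub>i\<close> is phrased in such a way that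
  the truth value of each of its subformulas is either known in advance or depends on finitely many bits of
  \<open>Z\<^sub>i\<close> at positions below the code of the assignment, all \<open>Z\<^sub>i\<close> can be defined simultaneously by
  recursion on the positions of their bits. So \<open>\<forall>Z. \<phi>\<^sub>1(Z)\<close> is false, although it is a theorem of the
  \<open>\<Pi>\<^sup>1\<^sub>1\<close>-sound theory \<open>T\<^sub>0\<close>.
\<close>


section \<open>Coding\<close>

text \<open>A naive recursion for the sets has no bottom: a bit of \<open>Z i\<close> that records
  the truth of a quantified formula would depend on infinitely many bits of
  \<open>Z (Suc i)\<close>, and these on further sets. So quantified subformulas are simply assigned
  the values that they are hoped to have, and the burden shifts to checking that the assigned values
  obey Tarski's clauses. The one subformula that admits no such constant value is the right-hand
  side of the clause for \<forall> inside the matrix, which speaks about all variants of an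
  assignment. It is evaluated like the atomic formula on the left of that clause. Justifying this
  takes the same clause for the next set at a smaller position, hence an induction on positions for
  all sets at once.

  No property of provability is derived inside the theories. The arithmetized predicates are only
  evaluated in the standard model, and the provability predicate only at actual theorems, so that
  neither the second incompleteness theorem nor a fixed point enters.\<close>

lemma pair_inject [simp]: "pair a b = pair c d \<longleftrightarrow> a = c \<and> b = d"
proof -
  \<comment> \<open>The codes with coordinate sum \<open>n\<close> lie between the square of
    \<open>n\<close> and the next square, so the sum can be read off first.\<close>
  have lt: "pair u v < pair w x" if "u + v < w + x" for u v w x
  proof -
    have "Suc (u + v) \<le> w + x"
      using that by simp
    then have "Suc (u + v) * Suc (u + v) \<le> (w + x) * (w + x)"
      by (rule mult_le_mono) (use that in simp)
    then show ?thesis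
      by (simp add: pair_def)
  qed
  have "a + b = c + d" if "pair a b = pair c d"
    using lt[of a b c d] lt[of c d a b] that by (cases "a + b" "c + d" rule: linorder_cases) auto
  then show ?thesis
    by (auto simp: pair_def)
qed

lemma le_square: "n \<le> n * n" for n :: nat
  by (cases n) auto

lemma le_pair1 [simp]: "a \<le> pair a b"
  by (simp add: pair_def)

lemma le_pair2 [simp]: "b \<le> pair a b"
  unfolding pair_def by (rule order.trans[OF _ le_add1]) (rule order.trans[OF _ le_square], simp)

lemma less_pair2: "0 < a \<Longrightarrow> b < pair a b"
  using le_square[of "a + b"] unfolding pair_def by linarith

lemma pair_num_ge: "k * k \<le> pair k n"
proof -
  have "k * k \<le> (k + n) * (k + n)"
    by (rule mult_le_mono) auto
  then show ?thesis
    by (simp add: pair_def)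
qed

lemma gn_tm_inject [simp]: "gn_tm s = gn_tm t \<longleftrightarrow> s = t"
proof (induction s arbitrary: t)
  case (Var x) show ?case by (cases t) auto
next
  case Zero show ?case by (cases t) auto
next
  case One show ?case by (cases t) auto
next
  case (Add s1 s2) then show ?case by (cases t) auto
next
  case (Mul s1 s2) then show ?case by (cases t) auto
qed

lemma gn_inject [simp]: "gn p = gn q \<longleftrightarrow> p = q"
proof (induction p arbitrary: q)
  case (Eq s t) show ?case by (cases q) auto
next
  case (Lt s t) show ?case by (cases q) auto
next
  case (Mem t X) show ?case by (cases q) auto
next
  case Fls show ?case by (cases q) auto
next
  case (Imp p1 p2) then show ?case by (cases q) auto
next
  case (Forall x p) then show ?case by (cases q) auto
next
  case (ForallS x p) then show ?case by (cases q) auto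
qed

text \<open>The head of every formula code is at least 5, and 25 is the square of 5. As these heads
  are at most 11, a pair whose head is itself a formula code is never a formula code; nor is it a
  pair with head 1 or 2. This keeps the different kinds of elements of a refutation apart.\<close>

lemma gn_ge: "25 \<le> gn p"
proof -
  obtain k r where "gn p = pair k r" "5 \<le> k"
    by (cases p) auto
  then show ?thesis
    using pair_num_ge[of k r] mult_le_mono[of 5 k 5 k] by simp
qed

text \<open>The summand 1 is unavoidable: \<open>Var 0\<close> has code 0 but
  \<open>fresh_tm\<close> value 1. It is absorbed by the strict growth of the outer pair in
  \<open>fresh_le_gn\<close>.\<close>

lemma fresh_tm_le_gn: "fresh_tm t \<le> gn_tm t + 1"
proof (induction t)
  case (Add s t)
  have "gn_tm s \<le> gn_tm (s \<^bold>+ t)" "gn_tm t \<le> gn_tm (s \<^bold>+ t)"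
    using le_pair1 le_pair2 le_trans by (simp, blast)+
  with Add show ?case by simp
next
  case (Mul s t)
  have "gn_tm s \<le> gn_tm (s \<^bold>* t)" "gn_tm t \<le> gn_tm (s \<^bold>* t)"
    using le_pair1 le_pair2 le_trans by (simp, blast)+
  with Mul show ?case by simp
qed auto

text \<open>The reason why \<open>is_variant\<close> may stop at the code of the formula: every
  variable of the formula lies below it.\<close>

lemma fresh_le_gn: "fresh p \<le> gn p"
proof (induction p)
  case (Eq s t)
  have "max (gn_tm s) (gn_tm t) + 1 \<le> gn (s \<^bold>= t)"
    using less_pair2[of 5 "pair (gn_tm s) (gn_tm t)"] le_pair1[of "gn_tm s" "gn_tm t"]
      le_pair2[of "gn_tm t" "gn_tm s"] unfolding gn.simps by linarith
  with fresh_tm_le_gn[of s] fresh_tm_le_gn[of t] show ?case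
    unfolding fresh.simps by linarith
next
  case (Lt s t)
  have "max (gn_tm s) (gn_tm t) + 1 \<le> gn (s \<^bold>< t)"
    using less_pair2[of 6 "pair (gn_tm s) (gn_tm t)"] le_pair1[of "gn_tm s" "gn_tm t"]
      le_pair2[of "gn_tm t" "gn_tm s"] unfolding gn.simps by linarith
  with fresh_tm_le_gn[of s] fresh_tm_le_gn[of t] show ?case
    unfolding fresh.simps by linarith
next
  case (Mem t X)
  have "gn_tm t + 1 \<le> gn (t \<^bold>\<in> X)"
    using less_pair2[of 7 "pair (gn_tm t) X"] le_pair1[of "gn_tm t" X] unfolding gn.simps by linarith
  with fresh_tm_le_gn[of t] show ?case
    unfolding fresh.simps by linarith
next
  case (Imp p q)
  have "max (gn p) (gn q) \<le> gn (p \<^bold>\<longrightarrow> q)"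
    using less_pair2[of 9 "pair (gn p) (gn q)"] le_pair1[of "gn p" "gn q"] le_pair2[of "gn q" "gn p"]
    unfolding gn.simps by linarith
  with Imp show ?case by simp
next
  case (Forall x p)
  have "max (Suc x) (gn p) \<le> gn (Forall x p)"
    using less_pair2[of 10 "pair x (gn p)"] le_pair1[of x "gn p"] le_pair2[of "gn p" x]
    unfolding gn.simps by linarith
  with Forall show ?case by simp
next
  case (ForallS x p)
  have "gn p \<le> gn (ForallS x p)"
    using less_pair2[of 11 "pair x (gn p)"] le_pair2[of "gn p" x]
    unfolding gn.simps by linarith
  with ForallS show ?case by simp
qed auto

section \<open>Goedel's \<beta> function\<close>

definition beta :: "nat \<Rightarrow> nat \<Rightarrow> nat \<Rightarrow> nat" where
  "beta a m i = a mod (1 + (i + 1) * m)"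

lemma beta_le [simp]: "beta a m i \<le> a"
  by (simp add: beta_def)

text \<open>Chinese remaindering. The factorial in \<open>m\<close> makes the moduli coprime,
  because a common prime of two of them divides the difference of their indices, hence
  \<open>m\<close>, hence 1. The other factor makes each modulus exceed the value to be
  coded.\<close>

lemma beta_exists: "\<exists>a m. \<forall>i<n. beta a m i = f i"
proof -
  define m where "m = fact n * Suc (\<Sum>i<n. f i)"
  let ?d = "\<lambda>i. 1 + (i + 1) * m"
  have "coprime (?d i) (?d j)" if "i < j" "j < n" for i j
  proof (rule ccontr)
    assume "\<not> coprime (?d i) (?d j)"
    then obtain p where p: "prime p" "p dvd ?d i" "p dvd ?d j"
      using prime_factor_nat[of "gcd (?d i) (?d j)"] by (auto simp: coprime_iff_gcd_eq_1 simp del: gcd_add_mult)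
    have "p dvd (j + 1) * ?d i - (i + 1) * ?d j"
      by (intro dvd_diff_nat dvd_mult p)
    also have "(j + 1) * ?d i - (i + 1) * ?d j = j - i"
      by (simp add: algebra_simps)
    finally have "p dvd j - i" .
    then have "p \<le> n" "0 < p"
      using that dvd_imp_le[of p "j - i"] p(1) prime_gt_0_nat by auto
    then have "p dvd fact n"
      by (intro dvd_fact) auto
    then have "p dvd (i + 1) * m"
      by (simp add: m_def)
    with p(2) have "p dvd 1"
      using dvd_add_left_iff by blast
    with p(1) show False
      by simp
  qed
  then have "\<forall>i\<in>{..<n}. \<forall>j\<in>{..<n}. i \<noteq> j \<longrightarrow> coprime (?d i) (?d j)"
    by (metis coprime_commute lessThan_iff nat_neq_iff)
  from chinese_remainder_nat[OF finite_lessThan this, of f]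
  obtain a where a: "\<forall>i\<in>{..<n}. [a = f i] (mod ?d i)" by auto
  have "beta a m i = f i" if "i < n" for i
  proof -
    have "f i \<le> (\<Sum>i<n. f i)"
      using that by (intro member_le_sum) auto
    also have "\<dots> \<le> m"
      using mult_le_mono1[OF fact_ge_1, of "Suc (\<Sum>i<n. f i)" n] by (simp add: m_def)
    also have "m \<le> (i + 1) * m" by simp
    finally have "f i < ?d i" by simp
    moreover have "a mod ?d i = f i mod ?d i"
      using a that by (auto simp: cong_def)
    ultimately show ?thesis
      by (simp add: beta_def)
  qed
  then show ?thesis by blast
qed

section \<open>Semantics of the arithmetized syntax\<close>

text \<open>The formula builders only know that their argument terms use variables below
  \<open>k\<close>. Agreement below \<open>k\<close> is what survives when they bind further
  variables.\<close>

definition agree :: "nat \<Rightarrow> (nat \<Rightarrow> nat) \<Rightarrow> (nat \<Rightarrow> nat) \<Rightarrow> bool" where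
  "agree k e e' \<longleftrightarrow> (\<forall>x<k. e' x = e x)"

lemma agree_refl [simp]: "agree k e e"
  by (simp add: agree_def)

lemma agree_upd [simp]: "k \<le> x \<Longrightarrow> agree k e (e'(x := n)) \<longleftrightarrow> agree k e e'"
  by (auto simp: agree_def)

lemma agree_mono: "agree k e e' \<Longrightarrow> j \<le> k \<Longrightarrow> agree j e e'"
  by (auto simp: agree_def)

lemma agree_trans: "agree k e e' \<Longrightarrow> agree k e' e'' \<Longrightarrow> agree k e e''"
  by (auto simp: agree_def)

lemma eval_agree: "agree k e e' \<Longrightarrow> fresh_tm t \<le> k \<Longrightarrow> eval e' t = eval e t"
  by (induction t) (auto simp: agree_def)

lemma eval_upd [simp]: "fresh_tm t \<le> x \<Longrightarrow> eval (e(x := n)) t = eval e t"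
  by (rule eval_agree[of x]) auto

lemma eval_cong: "(\<And>x. x \<in> fv_tm t \<Longrightarrow> e x = e' x) \<Longrightarrow> eval e t = eval e' t"
  by (induction t) auto

lemma sat_cong:
  "(\<And>x. x \<in> fv p \<Longrightarrow> e x = e' x) \<Longrightarrow> (\<And>X. X \<in> fvS p \<Longrightarrow> E X = E' X) \<Longrightarrow> sat e E p = sat e' E' p"
proof (induction p arbitrary: e e' E E')
  case (Eq s t) then show ?case using eval_cong[of s e e'] eval_cong[of t e e'] by simp
next
  case (Lt s t) then show ?case using eval_cong[of s e e'] eval_cong[of t e e'] by simp
next
  case (Mem t X) then show ?case using eval_cong[of t e e'] by simp
next
  case Fls show ?case by simp
next
  case (Imp p q) 
  have "sat e E p = sat e' E' p" "sat e E q = sat e' E' q"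
    by (rule Imp; use Imp.prems in simp)+
  then show ?case by simp
next
  case (Forall x p)
  have "sat (e(x := n)) E p = sat (e'(x := n)) E' p" for n
    by (rule Forall) (use Forall.prems in auto)
  then show ?case by simp
next
  case (ForallS X p)
  have "sat e (E(X := A)) p = sat e' (E'(X := A)) p" for A
    by (rule ForallS) (use ForallS.prems in auto)
  then show ?case by simp
qed

lemma fv_tm_fresh: "x \<in> fv_tm t \<Longrightarrow> x < fresh_tm t"
  by (induction t) auto

lemma fv_fresh: "x \<in> fv p \<Longrightarrow> x < fresh p"
  by (induction p) (auto dest: fv_tm_fresh)

lemma sat_agree: "agree k e e' \<Longrightarrow> fresh p \<le> k \<Longrightarrow> sat e' E p = sat e E p"
  by (rule sat_cong) (auto simp: agree_def dest: fv_fresh)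

lemma sat_ExistsLe [simp]: "fresh_tm t \<le> x \<Longrightarrow>
    sat e E (ExistsLe x t p) \<longleftrightarrow> (\<exists>n\<le>eval e t. sat (e(x := n)) E p)"
  by (auto simp: less_Suc_eq_le)

lemma sat_ExistsLess [simp]: "fresh_tm t \<le> x \<Longrightarrow>
    sat e E (ExistsLess x t p) \<longleftrightarrow> (\<exists>n<eval e t. sat (e(x := n)) E p)"
  by auto

lemma sat_ForallLe [simp]: "fresh_tm t \<le> x \<Longrightarrow>
    sat e E (ForallLe x t p) \<longleftrightarrow> (\<forall>n\<le>eval e t. sat (e(x := n)) E p)"
  by (auto simp: less_Suc_eq_le)

lemma sat_ExistsLes [simp]:
  assumes "fresh_tm t \<le> x"
  shows
  "sat e E (ExistsLes x 2 t p) \<longleftrightarrow>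
     (\<exists>n1\<le>eval e t. \<exists>n2\<le>eval e t. sat (e(x := n1, x + 1 := n2)) E p)"
  "sat e E (ExistsLes x 3 t p) \<longleftrightarrow>
     (\<exists>n1\<le>eval e t. \<exists>n2\<le>eval e t. \<exists>n3\<le>eval e t. sat (e(x := n1, x + 1 := n2, x + 2 := n3)) E p)"
  "sat e E (ExistsLes x 4 t p) \<longleftrightarrow>
     (\<exists>n1\<le>eval e t. \<exists>n2\<le>eval e t. \<exists>n3\<le>eval e t. \<exists>n4\<le>eval e t.
       sat (e(x := n1, x + 1 := n2, x + 2 := n3, x + 3 := n4)) E p)"
  "sat e E (ExistsLes x 6 t p) \<longleftrightarrow>
     (\<exists>n1\<le>eval e t. \<exists>n2\<le>eval e t. \<exists>n3\<le>eval e t. \<exists>n4\<le>eval e t. \<exists>n5\<le>eval e t. \<exists>n6\<le>eval e t.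
       sat (e(x := n1, x + 1 := n2, x + 2 := n3, x + 3 := n4, x + 4 := n5, x + 5 := n6)) E p)"
  using assms by (simp_all add: eval_nat_numeral less_Suc_eq_le)

lemma sat_Disjs [simp]: "sat e E (Disjs ps) \<longleftrightarrow> (\<exists>p\<in>set ps. sat e E p)"
  by (induction ps) auto

lemma sat_Conjs [simp]: "sat e E (Conjs ps) \<longleftrightarrow> (\<forall>p\<in>set ps. sat e E p)"
  by (induction ps) auto

lemma eval_num [simp]: "eval e (num n) = n"
  by (induction n) auto

lemma eval_cPair [simp]: "eval e (cPair s t) = pair (eval e s) (eval e t)"
  by (simp add: cPair_def pair_def)

lemma fresh_tm_num [simp]: "fresh_tm (num n) = 0"
  by (induction n) auto

lemma fresh_tm_cPair [simp]: "fresh_tm (cPair s t) = max (fresh_tm s) (fresh_tm t)"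
  by (simp add: cPair_def)

lemmas code_defs = cVar_def cZero_def cOne_def cAdd_def cMul_def cEq_def cLt_def cMem_def
  cFls_def cImp_def cForall_def cForallS_def

lemma eval_codes [simp]:
  "eval e (cVar x) = pair 0 (eval e x)"
  "eval e cZero = pair 1 0"
  "eval e cOne = pair 2 0"
  "eval e (cAdd s t) = pair 3 (pair (eval e s) (eval e t))"
  "eval e (cMul s t) = pair 4 (pair (eval e s) (eval e t))"
  "eval e (cEq s t) = pair 5 (pair (eval e s) (eval e t))"
  "eval e (cLt s t) = pair 6 (pair (eval e s) (eval e t))"
  "eval e (cMem s t) = pair 7 (pair (eval e s) (eval e t))"
  "eval e cFls = pair 8 0"
  "eval e (cImp s t) = pair 9 (pair (eval e s) (eval e t))"
  "eval e (cForall s t) = pair 10 (pair (eval e s) (eval e t))"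
  "eval e (cForallS s t) = pair 11 (pair (eval e s) (eval e t))"
  by (simp_all add: code_defs del: num.simps)

lemma fresh_tm_codes [simp]:
  "fresh_tm (cVar x) = fresh_tm x"
  "fresh_tm cZero = 0"
  "fresh_tm cOne = 0"
  "fresh_tm (cAdd s t) = max (fresh_tm s) (fresh_tm t)"
  "fresh_tm (cMul s t) = max (fresh_tm s) (fresh_tm t)"
  "fresh_tm (cEq s t) = max (fresh_tm s) (fresh_tm t)"
  "fresh_tm (cLt s t) = max (fresh_tm s) (fresh_tm t)"
  "fresh_tm (cMem s t) = max (fresh_tm s) (fresh_tm t)"
  "fresh_tm cFls = 0"
  "fresh_tm (cImp s t) = max (fresh_tm s) (fresh_tm t)"
  "fresh_tm (cForall s t) = max (fresh_tm s) (fresh_tm t)"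
  "fresh_tm (cForallS s t) = max (fresh_tm s) (fresh_tm t)"
  by (simp_all add: code_defs del: num.simps)

lemma sat_beta_fm [simp]:
  assumes "fresh_tm a \<le> k" "fresh_tm m \<le> k" "fresh_tm i \<le> k" "fresh_tm z \<le> k"
  shows "sat e E (beta_fm k a m i z) \<longleftrightarrow> eval e z = beta (eval e a) (eval e m) (eval e i)"
proof -
  let ?a = "eval e a" and ?z = "eval e z" and ?d = "1 + (eval e i + 1) * eval e m"
  have "sat e E (beta_fm k a m i z) \<longleftrightarrow> ?z < ?d \<and> (\<exists>q\<le>?a. ?a = q * ?d + ?z)"
    using assms by (simp add: beta_fm_def Let_def del: sat.simps(7)) (simp add: less_Suc_eq_le)
  also have "\<dots> \<longleftrightarrow> ?z = ?a mod ?d"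
  proof
    assume "?z < ?d \<and> (\<exists>q\<le>?a. ?a = q * ?d + ?z)"
    then obtain q where "?z < ?d" "?a = q * ?d + ?z" by blast
    then show "?z = ?a mod ?d"
      by (metis mod_less mod_mult_self3)
  next
    assume *: "?z = ?a mod ?d"
    have "?a div ?d \<le> ?a" by simp
    moreover have "?a = ?a div ?d * ?d + ?z"
      unfolding * by (rule div_mult_mod_eq[symmetric])
    moreover have "?z < ?d"
      unfolding * by (rule mod_less_divisor) simp
    ultimately show "?z < ?d \<and> (\<exists>q\<le>?a. ?a = q * ?d + ?z)"
      by blast
  qed
  finally show ?thesis
    by (simp add: beta_def)
qed

text \<open>The relation \<open>RR\<close> interprets the step \<open>R\<close> of a derivation; its first argument is the set of
  earlier entries.\<close>

definition interprets ::
  "nat \<Rightarrow> (nat \<Rightarrow> nat) \<Rightarrow> (nat \<Rightarrow> nat set) \<Rightarrow> (nat \<Rightarrow> (nat \<Rightarrow> tm \<Rightarrow> fm) \<Rightarrow> tm \<Rightarrow> fm)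
    \<Rightarrow> (nat set \<Rightarrow> nat \<Rightarrow> bool) \<Rightarrow> bool" where
  "interprets k e E R RR \<longleftrightarrow> (\<forall>e' n F W z. k \<le> n \<longrightarrow> agree k e e' \<longrightarrow> fresh_tm z \<le> n \<longrightarrow>
     (\<forall>j u e''. n \<le> j \<longrightarrow> fresh_tm u \<le> j \<longrightarrow> agree n e' e'' \<longrightarrow>
        (sat e'' E (F j u) \<longleftrightarrow> eval e'' u \<in> W)) \<longrightarrow>
     (\<exists>j\<ge>k. z = Var j) \<longrightarrow>
     (sat e' E (R n F z) \<longleftrightarrow> RR W (eval e' z)))"

text \<open>Bounding the entries by \<open>a\<close> loses nothing, since a value of \<beta> never
  exceeds its first argument.\<close>

lemma sat_derivation:
  assumes fresh: "fresh_tm a \<le> k" "fresh_tm m \<le> k" "fresh_tm l \<le> k" "fresh_tm c \<le> k"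
    and R: "interprets k e E R RR"
  shows "sat e E (derivation k a m l c R) \<longleftrightarrow>
    eval e c = beta (eval e a) (eval e m) (eval e l) \<and>
    (\<forall>i\<le>eval e l. RR (beta (eval e a) (eval e m) ` {..<i}) (beta (eval e a) (eval e m) i))"
proof -
  let ?b = "beta (eval e a) (eval e m)"
  let ?F = "\<lambda>j u. ExistsLess j (Var k) (beta_fm (j+1) a m (Var j) u)"
  have R': "sat (e(k := i, k+1 := z)) E (R (k+2) ?F (Var (k+1))) \<longleftrightarrow> RR (?b ` {..<i}) z" for i z
  proof -
    let ?e = "e(k := i, k+1 := z)"
    have "sat e'' E (?F j u) \<longleftrightarrow> eval e'' u \<in> ?b ` {..<i}"
      if "k + 2 \<le> j" "fresh_tm u \<le> j" "agree (k + 2) ?e e''" for j u e''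
    proof -
      have "agree k e e''"
        using agree_trans[OF _ agree_mono[OF that(3)], of k e] by simp
      then have "eval e'' a = eval e a" "eval e'' m = eval e m"
        using fresh eval_agree by blast+
      moreover have "e'' k = i"
        using that(3) by (simp add: agree_def)
      ultimately show ?thesis
        using that fresh by (auto simp del: sat.simps simp: image_iff)
    qed
    then have "sat ?e E (R (k+2) ?F (Var (k+1))) \<longleftrightarrow> RR (?b ` {..<i}) (eval ?e (Var (k+1)))"
      by (intro R[unfolded interprets_def, rule_format]) auto
    then show ?thesis by simp
  qed
  show ?thesis
    unfolding derivation_def using fresh R'
    by (simp del: sat.simps(1,2,3,6,7))
qed

definition derives :: "(nat set \<Rightarrow> nat \<Rightarrow> bool) \<Rightarrow> nat \<Rightarrow> nat \<Rightarrow> bool" where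
  "derives RR b c \<longleftrightarrow> (\<exists>a\<le>b. \<exists>m\<le>b. \<exists>l\<le>b. c = beta a m l \<and> (\<forall>i\<le>l. RR (beta a m ` {..<i}) (beta a m i)))"

lemma interprets_mono:
  assumes "interprets k e E R RR" "k \<le> n" "agree k e e'"
  shows "interprets n e' E R RR"
  unfolding interprets_def
proof (intro allI impI, goal_cases)
  case (1 e'' n' F W z)
  have "agree k e e''"
    using 1(2) assms(2,3) agree_mono agree_trans by blast
  then show ?case
    using assms(1)[unfolded interprets_def, rule_format, of n' e'' z F W] 1 assms(2) by auto
qed

lemma sat_derivable:
  assumes fresh: "fresh_tm b \<le> k" "fresh_tm c \<le> k"
    and R: "interprets k e E R RR"
  shows "sat e E (derivable k b c R) \<longleftrightarrow> derives RR (eval e b) (eval e c)"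
proof -
  have "interprets (k + 3) (e(k := a, k + 1 := m, k + 2 := l)) E R RR" for a m l
    by (rule interprets_mono[OF R]) auto
  then show ?thesis
    unfolding derivable_def using fresh
    by (simp add: sat_derivation[where RR = RR] derives_def del: sat.simps)
qed

section \<open>Codes of terms, formulas and substitution instances\<close>

definition tm_step :: "(nat \<Rightarrow> bool) \<Rightarrow> nat \<Rightarrow> nat set \<Rightarrow> nat \<Rightarrow> bool" where
  "tm_step V b W z \<longleftrightarrow> (\<exists>x\<le>b. \<exists>y\<le>b.
     V x \<and> z = pair 0 x \<or> z = pair 1 0 \<or> z = pair 2 0 \<or>
     (z = pair 3 (pair x y) \<or> z = pair 4 (pair x y)) \<and> x \<in> W \<and> y \<in> W)"

definition tm_code :: "(nat \<Rightarrow> bool) \<Rightarrow> nat \<Rightarrow> nat \<Rightarrow> bool" where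
  "tm_code V b = derives (tm_step V b) b"

lemma sat_tm_over:
  assumes fresh: "fresh_tm b \<le> k" "fresh_tm t \<le> k"
    and V: "\<And>e' n. k \<le> n \<Longrightarrow> agree k e e' \<Longrightarrow> sat e' E (V (Var n)) \<longleftrightarrow> VV (e' n)"
  shows "sat e E (tm_over V k b t) \<longleftrightarrow> tm_code VV (eval e b) (eval e t)"
  unfolding tm_over_def tm_code_def
proof (rule sat_derivable[OF fresh], unfold interprets_def, intro allI impI, goal_cases)
  case (1 e' n F W z)
  have [simp]: "fresh_tm b \<le> n" "fresh_tm b \<le> n + i" "agree n e' e'' \<Longrightarrow> eval e'' b = eval e b"
    for i e'' using 1 fresh by (auto intro: trans_le_add1 eval_agree agree_trans[OF 1(2) agree_mono])
  show ?case
    using 1 by (simp add: Let_def V tm_step_def del: sat.simps(7)) (intro ex_cong1 conj_cong refl; blast)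
qed

lemma sat_is_tm [simp]:
  assumes "fresh_tm b \<le> k" "fresh_tm t \<le> k"
  shows "sat e E (is_tm k b t) \<longleftrightarrow> tm_code (\<lambda>_. True) (eval e b) (eval e t)"
  unfolding is_tm_def by (rule sat_tm_over[OF assms]) simp

lemma sat_tm_avoids [simp]:
  assumes "fresh_tm b \<le> k" "fresh_tm v \<le> k" "fresh_tm t \<le> k"
  shows "sat e E (tm_avoids k b v t) \<longleftrightarrow> tm_code (\<lambda>x. x \<noteq> eval e v) (eval e b) (eval e t)"
  unfolding tm_avoids_def using assms by (intro sat_tm_over) (auto simp: eval_agree)

definition fm_step ::
  "(nat \<Rightarrow> bool) \<Rightarrow> (nat \<Rightarrow> bool) \<Rightarrow> (nat set \<Rightarrow> nat \<Rightarrow> nat \<Rightarrow> bool) \<Rightarrow> (nat set \<Rightarrow> nat \<Rightarrow> nat \<Rightarrow> bool)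
    \<Rightarrow> nat \<Rightarrow> nat set \<Rightarrow> nat \<Rightarrow> bool" where
  "fm_step T S Q QS b W z \<longleftrightarrow> (\<exists>x\<le>b. \<exists>y\<le>b.
     (z = pair 5 (pair x y) \<or> z = pair 6 (pair x y)) \<and> T x \<and> T y \<or>
     z = pair 7 (pair x y) \<and> T x \<and> S y \<or>
     z = pair 8 0 \<or>
     z = pair 9 (pair x y) \<and> x \<in> W \<and> y \<in> W \<or>
     z = pair 10 (pair x y) \<and> Q W x y \<or>
     z = pair 11 (pair x y) \<and> QS W x y)"

lemma sat_fm_over:
  assumes fresh: "fresh_tm b \<le> k" "fresh_tm p \<le> k"
    and TM: "\<And>e' n x. k \<le> n \<Longrightarrow> agree k e e' \<Longrightarrow> fresh_tm x \<le> n \<Longrightarrow>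
      sat e' E (TM n b x) \<longleftrightarrow> T (eval e' x)"
    and SV: "\<And>e' n. k \<le> n \<Longrightarrow> agree k e e' \<Longrightarrow> sat e' E (SV (Var n)) \<longleftrightarrow> S (e' n)"
    and Q: "\<And>e' n F W x q. k \<le> n \<Longrightarrow> agree k e e' \<Longrightarrow> fresh_tm x \<le> n \<Longrightarrow> fresh_tm q \<le> n \<Longrightarrow>
      (\<And>j u e''. n \<le> j \<Longrightarrow> fresh_tm u \<le> j \<Longrightarrow> agree n e' e'' \<Longrightarrow>
        (sat e'' E (F j u) \<longleftrightarrow> eval e'' u \<in> W)) \<Longrightarrow>
      sat e' E (Q n F x q) \<longleftrightarrow> QQ W (eval e' x) (eval e' q)"
    and QS: "\<And>e' n F W x q. k \<le> n \<Longrightarrow> agree k e e' \<Longrightarrow> fresh_tm x \<le> n \<Longrightarrow> fresh_tm q \<le> n \<Longrightarrow>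
      (\<And>j u e''. n \<le> j \<Longrightarrow> fresh_tm u \<le> j \<Longrightarrow> agree n e' e'' \<Longrightarrow>
        (sat e'' E (F j u) \<longleftrightarrow> eval e'' u \<in> W)) \<Longrightarrow>
      sat e' E (QS n F x q) \<longleftrightarrow> QQS W (eval e' x) (eval e' q)"
  shows "sat e E (fm_over TM SV Q QS k b p) \<longleftrightarrow>
    derives (fm_step T S QQ QQS (eval e b)) (eval e b) (eval e p)"
  unfolding fm_over_def
proof (rule sat_derivable[OF fresh], unfold interprets_def, intro allI impI, goal_cases)
  case (1 e' n F W z)
  have [simp]: "fresh_tm b \<le> n" "fresh_tm b \<le> n + i" "agree n e' e'' \<Longrightarrow> eval e'' b = eval e b"
    for i e'' using 1 fresh by (auto intro: trans_le_add1 eval_agree agree_trans[OF 1(2) agree_mono])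
  have F: "sat e'' E (F j u) \<longleftrightarrow> eval e'' u \<in> W"
    if "n + 2 \<le> j" "fresh_tm u \<le> j" "agree (n + 2) (e'(n := x, Suc n := y)) e''" for j u e'' x y
    using that 1(4) agree_trans[OF _ agree_mono[OF that(3)], of n e'] by simp
  have Q': "sat (e'(n := x, Suc n := y)) E (Q (n+2) F (Var n) (Var (Suc n))) \<longleftrightarrow> QQ W x y" for x y
    using 1 F by (subst Q[where W = W]) auto
  have QS': "sat (e'(n := x, Suc n := y)) E (QS (n+2) F (Var n) (Var (Suc n))) \<longleftrightarrow> QQS W x y" for x y
    using 1 F by (subst QS[where W = W]) auto
  show ?case
    using 1 by (simp add: Let_def TM SV Q'[simplified] QS'[simplified] fm_step_def del: sat.simps(7)) (intro ex_cong1 conj_cong refl; blast)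
qed

definition fm_code :: "nat \<Rightarrow> nat \<Rightarrow> bool" where
  "fm_code b = derives (fm_step (tm_code (\<lambda>_. True) b) (\<lambda>_. True) (\<lambda>W x q. q \<in> W) (\<lambda>W x q. q \<in> W) b) b"

definition arith_code :: "nat \<Rightarrow> nat \<Rightarrow> bool" where
  "arith_code b = derives (fm_step (tm_code (\<lambda>_. True) b) (\<lambda>_. True) (\<lambda>W x q. q \<in> W) (\<lambda>W x q. False) b) b"

definition not_free_code :: "nat \<Rightarrow> nat \<Rightarrow> nat \<Rightarrow> bool" where
  "not_free_code b v = derives (fm_step (tm_code (\<lambda>x. x \<noteq> v) b) (\<lambda>_. True)
     (\<lambda>W x q. x = v \<and> fm_code b q \<or> q \<in> W) (\<lambda>W x q. q \<in> W) b) b"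

definition not_freeS_code :: "nat \<Rightarrow> nat \<Rightarrow> nat \<Rightarrow> bool" where
  "not_freeS_code b V = derives (fm_step (tm_code (\<lambda>_. True) b) (\<lambda>Y. Y \<noteq> V)
     (\<lambda>W x q. q \<in> W) (\<lambda>W X q. X = V \<and> fm_code b q \<or> q \<in> W) b) b"

lemma sat_is_fm [simp]:
  assumes "fresh_tm b \<le> k" "fresh_tm p \<le> k"
  shows "sat e E (is_fm k b p) \<longleftrightarrow> fm_code (eval e b) (eval e p)"
  unfolding is_fm_def fm_code_def using assms by (intro sat_fm_over) (auto simp: eval_agree)

lemma sat_is_arithmetical [simp]:
  assumes "fresh_tm b \<le> k" "fresh_tm p \<le> k"
  shows "sat e E (is_arithmetical k b p) \<longleftrightarrow> arith_code (eval e b) (eval e p)"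
  unfolding is_arithmetical_def arith_code_def using assms
  by (intro sat_fm_over) (auto simp: eval_agree)

lemma sat_not_free [simp]:
  assumes "fresh_tm b \<le> k" "fresh_tm v \<le> k" "fresh_tm p \<le> k"
  shows "sat e E (not_free k b v p) \<longleftrightarrow> not_free_code (eval e b) (eval e v) (eval e p)"
  unfolding not_free_def not_free_code_def using assms
  by (intro sat_fm_over) (auto simp: eval_agree)

lemma sat_not_freeS [simp]:
  assumes "fresh_tm b \<le> k" "fresh_tm V \<le> k" "fresh_tm p \<le> k"
  shows "sat e E (not_freeS k b V p) \<longleftrightarrow> not_freeS_code (eval e b) (eval e V) (eval e p)"
  unfolding not_freeS_def not_freeS_code_def using assms
  by (intro sat_fm_over) (auto simp: eval_agree)

definition subst_tm_step :: "nat \<Rightarrow> nat \<Rightarrow> nat \<Rightarrow> nat set \<Rightarrow> nat \<Rightarrow> bool" where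
  "subst_tm_step b v t W z \<longleftrightarrow> (\<exists>x\<le>b. \<exists>y\<le>b. \<exists>x'\<le>b. \<exists>y'\<le>b.
     z = pair (pair 0 v) t \<or>
     x \<noteq> v \<and> z = pair (pair 0 x) (pair 0 x) \<or>
     z = pair (pair 1 0) (pair 1 0) \<or>
     z = pair (pair 2 0) (pair 2 0) \<or>
     (z = pair (pair 3 (pair x y)) (pair 3 (pair x' y')) \<or>
      z = pair (pair 4 (pair x y)) (pair 4 (pair x' y'))) \<and> pair x x' \<in> W \<and> pair y y' \<in> W)"

definition subst_tm_code :: "nat \<Rightarrow> nat \<Rightarrow> nat \<Rightarrow> nat \<Rightarrow> bool" where
  "subst_tm_code b v t = derives (subst_tm_step b v t) b"

lemma sat_is_subst_tm [simp]:
  assumes "fresh_tm b \<le> k" "fresh_tm v \<le> k" "fresh_tm t \<le> k" "fresh_tm u \<le> k" "fresh_tm u' \<le> k"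
  shows "sat e E (is_subst_tm k b v t u u') \<longleftrightarrow>
    subst_tm_code (eval e b) (eval e v) (eval e t) (pair (eval e u) (eval e u'))"
proof -
  have "sat e E (is_subst_tm k b v t u u') \<longleftrightarrow>
     derives (subst_tm_step (eval e b) (eval e v) (eval e t)) (eval e b) (eval e (cPair u u'))"
    unfolding is_subst_tm_def
  proof (rule sat_derivable, goal_cases)
    case 3
    show ?case
    proof (unfold interprets_def, intro allI impI, goal_cases)
      case (1 e' n F W z)
      have [simp]: "fresh_tm b \<le> n" "fresh_tm b \<le> n + i" "agree n e' e'' \<Longrightarrow> eval e'' b = eval e b" "fresh_tm v \<le> n" "fresh_tm v \<le> n + i" "agree n e' e'' \<Longrightarrow> eval e'' v = eval e v"
         "fresh_tm t \<le> n" "fresh_tm t \<le> n + i" "agree n e' e'' \<Longrightarrow> eval e'' t = eval e t"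
        for i e'' using 1 assms by (auto intro: trans_le_add1 eval_agree agree_trans[OF 1(2) agree_mono])
      show ?case
        using 1 by (simp add: Let_def subst_tm_step_def del: sat.simps(7)) (intro ex_cong1 conj_cong refl; blast)
    qed
  qed (use assms in auto)
  then show ?thesis
    by (simp add: subst_tm_code_def)
qed

definition subst_step :: "nat \<Rightarrow> nat \<Rightarrow> nat \<Rightarrow> nat set \<Rightarrow> nat \<Rightarrow> bool" where
  "subst_step b v t W z \<longleftrightarrow> (\<exists>x\<le>b. \<exists>y\<le>b. \<exists>x'\<le>b. \<exists>y'\<le>b.
     (z = pair (pair 5 (pair x y)) (pair 5 (pair x' y')) \<or>
      z = pair (pair 6 (pair x y)) (pair 6 (pair x' y'))) \<and>
        subst_tm_code b v t (pair x x') \<and> subst_tm_code b v t (pair y y') \<or>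
     z = pair (pair 7 (pair x y)) (pair 7 (pair x' y)) \<and> subst_tm_code b v t (pair x x') \<or>
     z = pair (pair 8 0) (pair 8 0) \<or>
     z = pair (pair 9 (pair x y)) (pair 9 (pair x' y')) \<and> pair x x' \<in> W \<and> pair y y' \<in> W \<or>
     z = pair (pair 10 (pair x y)) (pair 10 (pair x y)) \<and> not_free_code b v (pair 10 (pair x y)) \<or>
     z = pair (pair 10 (pair x y)) (pair 10 (pair x y')) \<and>
       x \<noteq> v \<and> tm_code (\<lambda>u. u \<noteq> x) b t \<and> pair y y' \<in> W \<or>
     z = pair (pair 11 (pair x y)) (pair 11 (pair x y')) \<and> pair y y' \<in> W)"

definition subst_code :: "nat \<Rightarrow> nat \<Rightarrow> nat \<Rightarrow> nat \<Rightarrow> bool" where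
  "subst_code b v t = derives (subst_step b v t) b"

lemma sat_is_subst [simp]:
  assumes "fresh_tm b \<le> k" "fresh_tm v \<le> k" "fresh_tm t \<le> k" "fresh_tm p \<le> k" "fresh_tm p' \<le> k"
  shows "sat e E (is_subst k b v t p p') \<longleftrightarrow>
    subst_code (eval e b) (eval e v) (eval e t) (pair (eval e p) (eval e p'))"
proof -
  have "sat e E (is_subst k b v t p p') \<longleftrightarrow>
     derives (subst_step (eval e b) (eval e v) (eval e t)) (eval e b) (eval e (cPair p p'))"
    unfolding is_subst_def
  proof (rule sat_derivable, goal_cases)
    case 3
    show ?case
    proof (unfold interprets_def, intro allI impI, goal_cases)
      case (1 e' n F W z)
      have [simp]: "fresh_tm b \<le> n" "fresh_tm b \<le> n + i" "agree n e' e'' \<Longrightarrow> eval e'' b = eval e b" "fresh_tm v \<le> n" "fresh_tm v \<le> n + i" "agree n e' e'' \<Longrightarrow> eval e'' v = eval e v"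
         "fresh_tm t \<le> n" "fresh_tm t \<le> n + i" "agree n e' e'' \<Longrightarrow> eval e'' t = eval e t"
        for i e'' using 1 assms by (auto intro: trans_le_add1 eval_agree agree_trans[OF 1(2) agree_mono])
      show ?case
        using 1 by (simp add: Let_def subst_step_def del: sat.simps(7)) (intro ex_cong1 conj_cong refl; blast)
    qed
  qed (use assms in auto)
  then show ?thesis
    by (simp add: subst_code_def)
qed

definition substS_step :: "nat \<Rightarrow> nat \<Rightarrow> nat \<Rightarrow> nat set \<Rightarrow> nat \<Rightarrow> bool" where
  "substS_step b V V' W z \<longleftrightarrow> (\<exists>x\<le>b. \<exists>y\<le>b. \<exists>x'\<le>b. \<exists>y'\<le>b.
     (z = pair (pair 5 (pair x y)) (pair 5 (pair x y)) \<or>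
      z = pair (pair 6 (pair x y)) (pair 6 (pair x y))) \<and>
        tm_code (\<lambda>_. True) b x \<and> tm_code (\<lambda>_. True) b y \<or>
     z = pair (pair 7 (pair x V)) (pair 7 (pair x V')) \<and> tm_code (\<lambda>_. True) b x \<or>
     y \<noteq> V \<and> z = pair (pair 7 (pair x y)) (pair 7 (pair x y)) \<and> tm_code (\<lambda>_. True) b x \<or>
     z = pair (pair 8 0) (pair 8 0) \<or>
     z = pair (pair 9 (pair x y)) (pair 9 (pair x' y')) \<and> pair x x' \<in> W \<and> pair y y' \<in> W \<or>
     z = pair (pair 10 (pair x y)) (pair 10 (pair x y')) \<and> pair y y' \<in> W \<or>
     z = pair (pair 11 (pair x y)) (pair 11 (pair x y)) \<and> not_freeS_code b V (pair 11 (pair x y)) \<or>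
     z = pair (pair 11 (pair x y)) (pair 11 (pair x y')) \<and> x \<noteq> V \<and> x \<noteq> V' \<and> pair y y' \<in> W)"

definition substS_code :: "nat \<Rightarrow> nat \<Rightarrow> nat \<Rightarrow> nat \<Rightarrow> bool" where
  "substS_code b V V' = derives (substS_step b V V') b"

lemma sat_is_substS [simp]:
  assumes "fresh_tm b \<le> k" "fresh_tm V \<le> k" "fresh_tm V' \<le> k" "fresh_tm p \<le> k" "fresh_tm p' \<le> k"
  shows "sat e E (is_substS k b V V' p p') \<longleftrightarrow>
    substS_code (eval e b) (eval e V) (eval e V') (pair (eval e p) (eval e p'))"
proof -
  have "sat e E (is_substS k b V V' p p') \<longleftrightarrow>
     derives (substS_step (eval e b) (eval e V) (eval e V')) (eval e b) (eval e (cPair p p'))"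
    unfolding is_substS_def
  proof (rule sat_derivable, goal_cases)
    case 3
    show ?case
    proof (unfold interprets_def, intro allI impI, goal_cases)
      case (1 e' n F W z)
      have [simp]: "fresh_tm b \<le> n" "fresh_tm b \<le> n + i" "agree n e' e'' \<Longrightarrow> eval e'' b = eval e b" "fresh_tm V \<le> n" "fresh_tm V \<le> n + i" "agree n e' e'' \<Longrightarrow> eval e'' V = eval e V"
         "fresh_tm V' \<le> n" "fresh_tm V' \<le> n + i" "agree n e' e'' \<Longrightarrow> eval e'' V' = eval e V'"
        for i e'' using 1 assms by (auto intro: trans_le_add1 eval_agree agree_trans[OF 1(2) agree_mono])
      show ?case
        using 1 by (simp add: Let_def substS_step_def del: sat.simps(7)) (intro ex_cong1 conj_cong refl; blast)
    qed
  qed (use assms in auto)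
  then show ?thesis
    by (simp add: substS_code_def)
qed

section \<open>Truth of the syntactic predicates at actual codes\<close>

text \<open>Derivability within every sufficiently large bound. Working up to such bounds makes it
  unnecessary to know that the formulas of the arithmetization are monotone in their bounds.\<close>

definition ev_derives :: "(nat \<Rightarrow> nat set \<Rightarrow> nat \<Rightarrow> bool) \<Rightarrow> nat \<Rightarrow> bool" where
  "ev_derives RR c \<longleftrightarrow> (\<exists>xs. c \<in> set xs \<and>
     (\<forall>i<length xs. \<forall>\<^sub>F b in sequentially. RR b (set (take i xs)) (xs ! i)))"

text \<open>Only finitely many steps have to be valid, so one bound works for all of them; it also
  has to exceed the \<beta> code of the list and the index of \<open>c\<close> in it.\<close>

lemma ev_derives:
  assumes "ev_derives RR c"
  shows "\<forall>\<^sub>F b in sequentially. derives (RR b) b c"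
proof -
  from assms obtain xs l where l: "l < length xs" "c = xs ! l"
    and xs: "\<And>i. i < length xs \<Longrightarrow> \<forall>\<^sub>F b in sequentially. RR b (set (take i xs)) (xs ! i)"
    unfolding ev_derives_def by (metis in_set_conv_nth)
  obtain a m where am: "\<And>i. i < length xs \<Longrightarrow> beta a m i = xs ! i"
    using beta_exists[of "length xs" "\<lambda>i. xs ! i"] by blast
  have im: "beta a m ` {..<i} = set (take i xs)" if "i < length xs" for i
  proof -
    have "set (take i xs) = (!) xs ` {..<i}"
      using that nth_image[of i xs] by (simp add: atLeast0LessThan)
    then show ?thesis
      using am that by (auto intro!: image_cong)
  qed
  have "\<forall>\<^sub>F b in sequentially. \<forall>i\<in>{..<length xs}. RR b (set (take i xs)) (xs ! i)"
    using xs by (intro eventually_ball_finite) auto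
  moreover have "\<forall>\<^sub>F b in sequentially. max a (max m l) \<le> b"
    by (rule eventually_ge_at_top)
  ultimately show ?thesis
  proof eventually_elim
    case (elim b)
    show ?case
      unfolding derives_def
      by (rule exI[of _ a], rule conjI, use elim in simp, rule exI[of _ m], rule conjI, use elim in simp,
        rule exI[of _ l]) (use elim am im l in auto)
  qed
qed

text \<open>Monotonicity is demanded in the set of earlier entries, with the bound fixed. This
  suffices for putting one derivation after another.\<close>

definition monotone_step :: "(nat \<Rightarrow> nat set \<Rightarrow> nat \<Rightarrow> bool) \<Rightarrow> bool" where
  "monotone_step RR \<longleftrightarrow> (\<forall>b W W' z. W \<subseteq> W' \<longrightarrow> RR b W z \<longrightarrow> RR b W' z)"

text \<open>Derivations of the individual elements are concatenated: the steps of a later one remain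
  valid when more entries precede them.\<close>

lemma ev_derives_list:
  assumes "monotone_step RR" "finite C" "\<And>c. c \<in> C \<Longrightarrow> ev_derives RR c"
  shows "\<exists>xs. C \<subseteq> set xs \<and>
     (\<forall>i<length xs. \<forall>\<^sub>F b in sequentially. RR b (set (take i xs)) (xs ! i))"
  using assms(2,3)
proof (induction C)
  case empty
  show ?case by (rule exI[of _ "[]"]) simp
next
  case (insert c C)
  from insert.IH insert.prems obtain xs where xs: "C \<subseteq> set xs"
      "\<And>i. i < length xs \<Longrightarrow> \<forall>\<^sub>F b in sequentially. RR b (set (take i xs)) (xs ! i)"
    by blast
  from insert.prems[of c] obtain ys where ys: "c \<in> set ys"
      "\<And>i. i < length ys \<Longrightarrow> \<forall>\<^sub>F b in sequentially. RR b (set (take i ys)) (ys ! i)"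
    unfolding ev_derives_def by blast
  have "\<forall>\<^sub>F b in sequentially. RR b (set (take i (xs @ ys))) ((xs @ ys) ! i)"
    if "i < length (xs @ ys)" for i
  proof (cases "i < length xs")
    case True
    with xs(2)[OF this] show ?thesis by (simp add: nth_append)
  next
    case False
    with that ys(2)[of "i - length xs"]
    have "\<forall>\<^sub>F b in sequentially. RR b (set (take (i - length xs) ys)) ((xs @ ys) ! i)"
      by (simp add: nth_append)
    then show ?thesis
      by (rule eventually_mono)
        (rule assms(1)[unfolded monotone_step_def, rule_format, rotated], assumption, use False in auto)
  qed
  with xs(1) ys(1) show ?case
    by (intro exI[of _ "xs @ ys"]) auto
qed

lemma ev_derives_step:
  assumes "monotone_step RR" "finite C" "\<And>c. c \<in> C \<Longrightarrow> ev_derives RR c"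
    and "\<forall>\<^sub>F b in sequentially. RR b C z"
  shows "ev_derives RR z"
proof -
  obtain xs where C: "C \<subseteq> set xs"
    and xs: "\<And>i. i < length xs \<Longrightarrow> \<forall>\<^sub>F b in sequentially. RR b (set (take i xs)) (xs ! i)"
    using ev_derives_list[OF assms(1-3)] by blast
  have "\<forall>\<^sub>F b in sequentially. RR b (set (take i (xs @ [z]))) ((xs @ [z]) ! i)"
    if "i < length (xs @ [z])" for i
  proof (cases "i < length xs")
    case True
    with xs[OF this] show ?thesis by (simp add: nth_append)
  next
    case False
    then have "i = length xs" using that by simp
    with assms(4) show ?thesis
      by (auto elim!: eventually_mono simp: assms(1)[unfolded monotone_step_def, rule_format, OF C])
  qed
  then show ?thesis
    unfolding ev_derives_def by (intro exI[of _ "xs @ [z]"]) auto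
qed

lemma ev_derives_axiom:
  "monotone_step RR \<Longrightarrow> \<forall>\<^sub>F b in sequentially. RR b {} z \<Longrightarrow> ev_derives RR z"
  by (rule ev_derives_step[of _ "{}"]) auto

lemmas eventually_ge = eventually_ge_at_top[where 'a = nat]

lemma monotone_tm_step [simp]: "monotone_step (tm_step V)"
  unfolding monotone_step_def tm_step_def
  by (intro allI impI) (elim ex_forward conj_forward disj_forward; blast)

lemma ev_tm_code:
  assumes "\<forall>x\<in>fv_tm t. V x"
  shows "ev_derives (tm_step V) (gn_tm t)"
  using assms
proof (induction t)
  case (Var x)
  have "\<forall>\<^sub>F b in sequentially. tm_step V b {} (gn_tm (Var x))"
    using eventually_ge[of x] by eventually_elim (use Var in \<open>auto simp: tm_step_def\<close>)
  then show ?case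
    by (simp add: ev_derives_axiom)
next
  case Zero
  have "\<forall>\<^sub>F b in sequentially. tm_step V b {} (gn_tm Zero)"
    by (intro always_eventually) (auto simp: tm_step_def)
  then show ?case
    by (simp add: ev_derives_axiom)
next
  case One
  have "\<forall>\<^sub>F b in sequentially. tm_step V b {} (gn_tm One)"
    by (intro always_eventually) (auto simp: tm_step_def)
  then show ?case
    by (simp add: ev_derives_axiom)
next
  case (Add s t)
  have "\<forall>\<^sub>F b in sequentially. tm_step V b {gn_tm s, gn_tm t} (gn_tm (s \<^bold>+ t))"
    using eventually_ge[of "gn_tm s"] eventually_ge[of "gn_tm t"]
    by eventually_elim (auto simp: tm_step_def)
  then show ?case
    by (rule ev_derives_step[rotated -1]) (use Add in auto)
next
  case (Mul s t)
  have "\<forall>\<^sub>F b in sequentially. tm_step V b {gn_tm s, gn_tm t} (gn_tm (s \<^bold>* t))"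
    using eventually_ge[of "gn_tm s"] eventually_ge[of "gn_tm t"]
    by eventually_elim (auto simp: tm_step_def)
  then show ?case
    by (rule ev_derives_step[rotated -1]) (use Mul in auto)
qed

lemma eventually_tm_code:
  "\<forall>x\<in>fv_tm t. V x \<Longrightarrow> \<forall>\<^sub>F b in sequentially. tm_code V b (gn_tm t)"
  unfolding tm_code_def by (intro ev_derives ev_tm_code)

lemma eventually_is_tm: "\<forall>\<^sub>F b in sequentially. tm_code (\<lambda>_. True) b (gn_tm t)"
  by (rule eventually_tm_code) simp

lemma fm_stepI:
  assumes "x \<le> b" "y \<le> b"
  shows "T x \<Longrightarrow> T y \<Longrightarrow> fm_step T S Q QS b W (pair 5 (pair x y))"
    and "T x \<Longrightarrow> T y \<Longrightarrow> fm_step T S Q QS b W (pair 6 (pair x y))"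
    and "T x \<Longrightarrow> S y \<Longrightarrow> fm_step T S Q QS b W (pair 7 (pair x y))"
    and "fm_step T S Q QS b W (pair 8 0)"
    and "x \<in> W \<Longrightarrow> y \<in> W \<Longrightarrow> fm_step T S Q QS b W (pair 9 (pair x y))"
    and "Q W x y \<Longrightarrow> fm_step T S Q QS b W (pair 10 (pair x y))"
    and "QS W x y \<Longrightarrow> fm_step T S Q QS b W (pair 11 (pair x y))"
  using assms by (auto simp: fm_step_def)

lemma monotone_fm_step:
  assumes "\<And>b W W' x q. W \<subseteq> W' \<Longrightarrow> Q b W x q \<Longrightarrow> Q b W' x q"
    and "\<And>b W W' x q. W \<subseteq> W' \<Longrightarrow> QS b W x q \<Longrightarrow> QS b W' x q"
  shows "monotone_step (\<lambda>b. fm_step (T b) S (Q b) (QS b) b)"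
  unfolding monotone_step_def fm_step_def
  by (intro allI impI) (elim ex_forward conj_forward disj_forward; blast intro: assms)

text \<open>In the quantifier cases the set \<open>C\<close> of premises is left open, because
  \<open>not_free\<close> and \<open>not_freeS\<close> accept a quantifier over the excluded
  variable without having derived its scope; then \<open>C\<close> is empty.\<close>

lemma ev_fm_step:
  fixes T S Q QS
  assumes Q: "\<And>b W W' x q. W \<subseteq> W' \<Longrightarrow> Q b W x q \<Longrightarrow> Q b W' x q"
    and QS: "\<And>b W W' x q. W \<subseteq> W' \<Longrightarrow> QS b W x q \<Longrightarrow> QS b W' x q"
  defines "RR \<equiv> \<lambda>b. fm_step (T b) S (Q b) (QS b) b"
  shows "\<forall>\<^sub>F b in sequentially. T b (gn_tm s) \<Longrightarrow> \<forall>\<^sub>F b in sequentially. T b (gn_tm t) \<Longrightarrow>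
           ev_derives RR (gn (s \<^bold>= t))"
    and "\<forall>\<^sub>F b in sequentially. T b (gn_tm s) \<Longrightarrow> \<forall>\<^sub>F b in sequentially. T b (gn_tm t) \<Longrightarrow>
           ev_derives RR (gn (s \<^bold>< t))"
    and "\<forall>\<^sub>F b in sequentially. T b (gn_tm t) \<Longrightarrow> S X \<Longrightarrow> ev_derives RR (gn (t \<^bold>\<in> X))"
    and "ev_derives RR (gn Fls)"
    and "ev_derives RR (gn p) \<Longrightarrow> ev_derives RR (gn q) \<Longrightarrow> ev_derives RR (gn (p \<^bold>\<longrightarrow> q))"
    and "finite C \<Longrightarrow> (\<And>c. c \<in> C \<Longrightarrow> ev_derives RR c) \<Longrightarrow> \<forall>\<^sub>F b in sequentially. Q b C x (gn p) \<Longrightarrow>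
           ev_derives RR (gn (Forall x p))"
    and "finite C \<Longrightarrow> (\<And>c. c \<in> C \<Longrightarrow> ev_derives RR c) \<Longrightarrow> \<forall>\<^sub>F b in sequentially. QS b C x (gn p) \<Longrightarrow>
           ev_derives RR (gn (ForallS x p))"
proof goal_cases
  have "monotone_step RR"
    unfolding RR_def using Q QS by (rule monotone_fm_step)
  note step = ev_derives_step[OF this]
  {
    case 1
    then have "\<forall>\<^sub>F b in sequentially. RR b {} (gn (s \<^bold>= t))"
      using eventually_ge[of "gn_tm s"] eventually_ge[of "gn_tm t"]
      by eventually_elim (simp add: RR_def fm_stepI)
    then show ?case by (rule step[rotated -1]) auto
  }
  {
    case 2
    then have "\<forall>\<^sub>F b in sequentially. RR b {} (gn (s \<^bold>< t))"
      using eventually_ge[of "gn_tm s"] eventually_ge[of "gn_tm t"]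
      by eventually_elim (simp add: RR_def fm_stepI)
    then show ?case by (rule step[rotated -1]) auto
  }
  {
    case 3
    from 3(1) have "\<forall>\<^sub>F b in sequentially. RR b {} (gn (t \<^bold>\<in> X))"
      using eventually_ge[of "gn_tm t"] eventually_ge[of X]
      by eventually_elim (simp add: RR_def fm_stepI 3(2))
    then show ?case by (rule step[rotated -1]) auto
  }
  {
    case 4
    show ?case
      by (rule step[of "{}"]) (auto simp: RR_def fm_stepI(4)[of 0 _ 0] intro!: always_eventually)
  }
  {
    case 5
    have "\<forall>\<^sub>F b in sequentially. RR b {gn p, gn q} (gn (p \<^bold>\<longrightarrow> q))"
      using eventually_ge[of "gn p"] eventually_ge[of "gn q"]
      by eventually_elim (simp add: RR_def fm_stepI)
    then show ?case by (rule step[rotated -1]) (use 5 in auto)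
  }
  {
    case 6
    from 6(3) have "\<forall>\<^sub>F b in sequentially. RR b C (gn (Forall x p))"
      using eventually_ge[of "gn p"] eventually_ge[of x]
      by eventually_elim (simp add: RR_def fm_stepI)
    then show ?case by (rule step[rotated -1]) (use 6(1,2) in auto)
  }
  {
    case 7
    from 7(3) have "\<forall>\<^sub>F b in sequentially. RR b C (gn (ForallS x p))"
      using eventually_ge[of "gn p"] eventually_ge[of x]
      by eventually_elim (simp add: RR_def fm_stepI)
    then show ?case by (rule step[rotated -1]) (use 7(1,2) in auto)
  }
qed

lemma eventually_fm_code: "\<forall>\<^sub>F b in sequentially. fm_code b (gn p)"
  unfolding fm_code_def
proof (rule ev_derives, induction p)
  case (Forall x p)
  then show ?case by (intro ev_fm_step(6)[of _ _ "{gn p}"]) auto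
next
  case (ForallS x p)
  then show ?case by (intro ev_fm_step(7)[of _ _ "{gn p}"]) auto
qed (intro ev_fm_step; auto intro: eventually_is_tm)+

lemma eventually_arith_code:
  "arithmetical p \<Longrightarrow> \<forall>\<^sub>F b in sequentially. arith_code b (gn p)"
  unfolding arith_code_def
proof (rule ev_derives, induction p)
  case (Forall x p)
  then show ?case by (intro ev_fm_step(6)[of _ _ "{gn p}"]) auto
next
  case (ForallS X p)
  then show ?case by simp
qed (intro ev_fm_step; auto intro: eventually_is_tm)+

lemma eventually_not_free_code:
  "v \<notin> fv p \<Longrightarrow> \<forall>\<^sub>F b in sequentially. not_free_code b v (gn p)"
  unfolding not_free_code_def
proof (rule ev_derives, induction p)
  case (Forall x p)
  show ?case
  proof (cases "x = v")
    case True
    with eventually_fm_code[of p] show ?thesis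
      by (intro ev_fm_step(6)[of _ _ "{}"]) auto
  next
    case False
    with Forall show ?thesis by (intro ev_fm_step(6)[of _ _ "{gn p}"]) auto
  qed
next
  case (ForallS x p)
  then show ?case by (intro ev_fm_step(7)[of _ _ "{gn p}"]) auto
qed (intro ev_fm_step; auto intro: eventually_tm_code)+

lemma eventually_not_freeS_code:
  "V \<notin> fvS p \<Longrightarrow> \<forall>\<^sub>F b in sequentially. not_freeS_code b V (gn p)"
  unfolding not_freeS_code_def
proof (rule ev_derives, induction p)
  case (Forall x p)
  then show ?case by (intro ev_fm_step(6)[of _ _ "{gn p}"]) auto
next
  case (ForallS X p)
  show ?case
  proof (cases "X = V")
    case True
    with eventually_fm_code[of p] show ?thesis
      by (intro ev_fm_step(7)[of _ _ "{}"]) auto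
  next
    case False
    with ForallS show ?thesis by (intro ev_fm_step(7)[of _ _ "{gn p}"]) auto
  qed
qed (intro ev_fm_step; auto intro: eventually_is_tm)+

lemma monotone_subst_tm_step [simp]: "monotone_step (\<lambda>b. subst_tm_step b v t)"
  unfolding monotone_step_def subst_tm_step_def
  by (intro allI impI) (elim ex_forward conj_forward disj_forward; blast)

lemma subst_tm_stepI:
  assumes "x \<le> b" "y \<le> b" "x' \<le> b" "y' \<le> b"
  shows "subst_tm_step b v t W (pair (pair 0 v) t)"
    and "x \<noteq> v \<Longrightarrow> subst_tm_step b v t W (pair (pair 0 x) (pair 0 x))"
    and "subst_tm_step b v t W (pair (pair 1 0) (pair 1 0))"
    and "subst_tm_step b v t W (pair (pair 2 0) (pair 2 0))"
    and "pair x x' \<in> W \<Longrightarrow> pair y y' \<in> W \<Longrightarrow>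
      subst_tm_step b v t W (pair (pair 3 (pair x y)) (pair 3 (pair x' y')))"
    and "pair x x' \<in> W \<Longrightarrow> pair y y' \<in> W \<Longrightarrow>
      subst_tm_step b v t W (pair (pair 4 (pair x y)) (pair 4 (pair x' y')))"
  using assms by (auto simp: subst_tm_step_def)

lemma eventually_subst_tm_code:
  "\<forall>\<^sub>F b in sequentially. subst_tm_code b v (gn_tm t) (pair (gn_tm u) (gn_tm (subst_tm v t u)))"
  unfolding subst_tm_code_def
proof (rule ev_derives, induction u)
  case (Var x)
  show ?case
  proof (rule ev_derives_step[of _ "{}"])
    show "\<forall>\<^sub>F b in sequentially. subst_tm_step b v (gn_tm t) {}
        (pair (gn_tm (Var x)) (gn_tm (subst_tm v t (Var x))))"
      using eventually_ge[of x] by eventually_elim (simp add: subst_tm_stepI)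
  qed auto
next
  case Zero
  show ?case
    by (rule ev_derives_axiom)
      (auto intro!: always_eventually simp: subst_tm_stepI(3)[of 0 _ 0 0 0, simplified])
next
  case One
  show ?case
    by (rule ev_derives_axiom)
      (auto intro!: always_eventually simp: subst_tm_stepI(4)[of 0 _ 0 0 0, simplified])
next
  case (Add s u)
  let ?C = "{pair (gn_tm s) (gn_tm (subst_tm v t s)), pair (gn_tm u) (gn_tm (subst_tm v t u))}"
  show ?case
  proof (rule ev_derives_step[of _ ?C])
    show "\<forall>\<^sub>F b in sequentially. subst_tm_step b v (gn_tm t) ?C
        (pair (gn_tm (s \<^bold>+ u)) (gn_tm (subst_tm v t (s \<^bold>+ u))))"
      using eventually_ge[of "gn_tm s"] eventually_ge[of "gn_tm u"]
        eventually_ge[of "gn_tm (subst_tm v t s)"] eventually_ge[of "gn_tm (subst_tm v t u)"]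
      by eventually_elim (simp add: subst_tm_stepI)
  qed (use Add in auto)
next
  case (Mul s u)
  let ?C = "{pair (gn_tm s) (gn_tm (subst_tm v t s)), pair (gn_tm u) (gn_tm (subst_tm v t u))}"
  show ?case
  proof (rule ev_derives_step[of _ ?C])
    show "\<forall>\<^sub>F b in sequentially. subst_tm_step b v (gn_tm t) ?C
        (pair (gn_tm (s \<^bold>* u)) (gn_tm (subst_tm v t (s \<^bold>* u))))"
      using eventually_ge[of "gn_tm s"] eventually_ge[of "gn_tm u"]
        eventually_ge[of "gn_tm (subst_tm v t s)"] eventually_ge[of "gn_tm (subst_tm v t u)"]
      by eventually_elim (simp add: subst_tm_stepI)
  qed (use Mul in auto)
qed

lemma monotone_subst_step [simp]: "monotone_step (\<lambda>b. subst_step b v t)"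
  unfolding monotone_step_def subst_step_def
  by (intro allI impI) (elim ex_forward conj_forward disj_forward; blast)

lemma subst_stepI:
  assumes "x \<le> b" "y \<le> b" "x' \<le> b" "y' \<le> b"
  shows "subst_tm_code b v t (pair x x') \<Longrightarrow> subst_tm_code b v t (pair y y') \<Longrightarrow>
      subst_step b v t W (pair (pair 5 (pair x y)) (pair 5 (pair x' y')))"
    and "subst_tm_code b v t (pair x x') \<Longrightarrow> subst_tm_code b v t (pair y y') \<Longrightarrow>
      subst_step b v t W (pair (pair 6 (pair x y)) (pair 6 (pair x' y')))"
    and "subst_tm_code b v t (pair x x') \<Longrightarrow>
      subst_step b v t W (pair (pair 7 (pair x y)) (pair 7 (pair x' y)))"
    and "subst_step b v t W (pair (pair 8 0) (pair 8 0))"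
    and "pair x x' \<in> W \<Longrightarrow> pair y y' \<in> W \<Longrightarrow>
      subst_step b v t W (pair (pair 9 (pair x y)) (pair 9 (pair x' y')))"
    and "not_free_code b v (pair 10 (pair x y)) \<Longrightarrow>
      subst_step b v t W (pair (pair 10 (pair x y)) (pair 10 (pair x y)))"
    and "x \<noteq> v \<Longrightarrow> tm_code (\<lambda>u. u \<noteq> x) b t \<Longrightarrow> pair y y' \<in> W \<Longrightarrow>
      subst_step b v t W (pair (pair 10 (pair x y)) (pair 10 (pair x y')))"
    and "pair y y' \<in> W \<Longrightarrow>
      subst_step b v t W (pair (pair 11 (pair x y)) (pair 11 (pair x y')))"
  using assms by (auto simp: subst_step_def)

lemma subst_tm_idle: "x \<notin> fv_tm u \<Longrightarrow> subst_tm x t u = u"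
  by (induction u) auto

lemma subst_idle: "x \<notin> fv p \<Longrightarrow> subst x t p = p"
  by (induction p) (auto simp: subst_tm_idle)

lemma substS_idle: "X \<notin> fvS p \<Longrightarrow> substS X Y p = p"
  by (induction p) auto

text \<open>The two alternatives in \<open>free_for\<close> for a quantifier correspond to two rules
  of the arithmetized graph: the formula stays unchanged if the variable is not free in it, and
  otherwise the substituted term must avoid the bound variable.\<close>

lemma eventually_subst_code:
  "free_for v t p \<Longrightarrow> \<forall>\<^sub>F b in sequentially. subst_code b v (gn_tm t) (pair (gn p) (gn (subst v t p)))"
  unfolding subst_code_def
proof (rule ev_derives, induction p)
  case (Eq s u)
  show ?case
    by (rule ev_derives_axiom, simp)
      (use eventually_ge[of "gn_tm s"] eventually_ge[of "gn_tm u"]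
        eventually_ge[of "gn_tm (subst_tm v t s)"] eventually_ge[of "gn_tm (subst_tm v t u)"]
        eventually_subst_tm_code[of v t s] eventually_subst_tm_code[of v t u] in
        \<open>eventually_elim, simp add: subst_stepI\<close>)
next
  case (Lt s u)
  show ?case
    by (rule ev_derives_axiom, simp)
      (use eventually_ge[of "gn_tm s"] eventually_ge[of "gn_tm u"]
        eventually_ge[of "gn_tm (subst_tm v t s)"] eventually_ge[of "gn_tm (subst_tm v t u)"]
        eventually_subst_tm_code[of v t s] eventually_subst_tm_code[of v t u] in
        \<open>eventually_elim, simp add: subst_stepI\<close>)
next
  case (Mem s X)
  show ?case
    by (rule ev_derives_axiom, simp)
      (use eventually_ge[of "gn_tm s"] eventually_ge[of X]
        eventually_ge[of "gn_tm (subst_tm v t s)"] eventually_subst_tm_code[of v t s] in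
        \<open>eventually_elim, simp add: subst_stepI\<close>)
next
  case Fls
  show ?case
    by (rule ev_derives_axiom)
      (auto intro!: always_eventually simp: subst_stepI(4)[of 0 _ 0 0 0, simplified])
next
  case (Imp p q)
  let ?C = "{pair (gn p) (gn (subst v t p)), pair (gn q) (gn (subst v t q))}"
  show ?case
  proof (rule ev_derives_step[of _ ?C])
    show "\<forall>\<^sub>F b in sequentially. subst_step b v (gn_tm t) ?C
        (pair (gn (p \<^bold>\<longrightarrow> q)) (gn (subst v t (p \<^bold>\<longrightarrow> q))))"
      using eventually_ge[of "gn p"] eventually_ge[of "gn q"]
        eventually_ge[of "gn (subst v t p)"] eventually_ge[of "gn (subst v t q)"]
      by eventually_elim (simp add: subst_stepI)
  qed (use Imp in auto)
next
  case (Forall x p)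
  show ?case
  proof (cases "v \<in> fv (Forall x p)")
    case False
    then have *: "subst v t (Forall x p) = Forall x p"
      by (rule subst_idle)
    show ?thesis
    unfolding *
      by (rule ev_derives_axiom, simp)
        (use eventually_ge[of x] eventually_ge[of "gn p"] eventually_not_free_code[OF False] in
          \<open>eventually_elim, simp add: subst_stepI\<close>)
  next
    case True
    with Forall.prems have *: "x \<noteq> v" "x \<notin> fv_tm t" "free_for v t p"
      by auto
    let ?C = "{pair (gn p) (gn (subst v t p))}"
    have "\<forall>\<^sub>F b in sequentially. tm_code (\<lambda>u. u \<noteq> x) b (gn_tm t)"
      using * by (intro eventually_tm_code) auto
    then have "\<forall>\<^sub>F b in sequentially. subst_step b v (gn_tm t) ?C
        (pair (gn (Forall x p)) (gn (subst v t (Forall x p))))"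
      using eventually_ge[of x] eventually_ge[of "gn p"] eventually_ge[of "gn (subst v t p)"]
      by eventually_elim (use * in \<open>simp add: subst_stepI\<close>)
    then show ?thesis
      by (rule ev_derives_step[rotated -1]) (use Forall.IH * in auto)
  qed
next
  case (ForallS X p)
  let ?C = "{pair (gn p) (gn (subst v t p))}"
  have "\<forall>\<^sub>F b in sequentially. subst_step b v (gn_tm t) ?C
      (pair (gn (ForallS X p)) (gn (subst v t (ForallS X p))))"
    using eventually_ge[of X] eventually_ge[of "gn p"] eventually_ge[of "gn (subst v t p)"]
    by eventually_elim (simp add: subst_stepI)
  then show ?case
    by (rule ev_derives_step[rotated -1]) (use ForallS in auto)
qed

lemma monotone_substS_step [simp]: "monotone_step (\<lambda>b. substS_step b V V')"
  unfolding monotone_step_def substS_step_def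
  by (intro allI impI) (elim ex_forward conj_forward disj_forward; blast)

lemma substS_stepI:
  assumes "x \<le> b" "y \<le> b" "x' \<le> b" "y' \<le> b"
  shows "tm_code (\<lambda>_. True) b x \<Longrightarrow> tm_code (\<lambda>_. True) b y \<Longrightarrow>
      substS_step b V V' W (pair (pair 5 (pair x y)) (pair 5 (pair x y)))"
    and "tm_code (\<lambda>_. True) b x \<Longrightarrow> tm_code (\<lambda>_. True) b y \<Longrightarrow>
      substS_step b V V' W (pair (pair 6 (pair x y)) (pair 6 (pair x y)))"
    and "tm_code (\<lambda>_. True) b x \<Longrightarrow>
      substS_step b V V' W (pair (pair 7 (pair x V)) (pair 7 (pair x V')))"
    and "tm_code (\<lambda>_. True) b x \<Longrightarrow> y \<noteq> V \<Longrightarrow>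
      substS_step b V V' W (pair (pair 7 (pair x y)) (pair 7 (pair x y)))"
    and "substS_step b V V' W (pair (pair 8 0) (pair 8 0))"
    and "pair x x' \<in> W \<Longrightarrow> pair y y' \<in> W \<Longrightarrow>
      substS_step b V V' W (pair (pair 9 (pair x y)) (pair 9 (pair x' y')))"
    and "pair y y' \<in> W \<Longrightarrow>
      substS_step b V V' W (pair (pair 10 (pair x y)) (pair 10 (pair x y')))"
    and "not_freeS_code b V (pair 11 (pair x y)) \<Longrightarrow>
      substS_step b V V' W (pair (pair 11 (pair x y)) (pair 11 (pair x y)))"
    and "x \<noteq> V \<Longrightarrow> x \<noteq> V' \<Longrightarrow> pair y y' \<in> W \<Longrightarrow>
      substS_step b V V' W (pair (pair 11 (pair x y)) (pair 11 (pair x y')))"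
  using assms by (auto simp: substS_step_def)

lemma eventually_substS_code:
  "free_forS V V' p \<Longrightarrow> \<forall>\<^sub>F b in sequentially. substS_code b V V' (pair (gn p) (gn (substS V V' p)))"
  unfolding substS_code_def
proof (rule ev_derives, induction p)
  case (Eq s u)
  show ?case
    by (rule ev_derives_axiom, simp)
      (use eventually_ge[of "gn_tm s"] eventually_ge[of "gn_tm u"] eventually_is_tm[of s]
        eventually_is_tm[of u] in
        \<open>eventually_elim, simp add: substS_stepI\<close>)
next
  case (Lt s u)
  show ?case
    by (rule ev_derives_axiom, simp)
      (use eventually_ge[of "gn_tm s"] eventually_ge[of "gn_tm u"] eventually_is_tm[of s]
        eventually_is_tm[of u] in
        \<open>eventually_elim, simp add: substS_stepI\<close>)
next
  case (Mem s X)
  show ?case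
    by (rule ev_derives_axiom, simp)
      (use eventually_ge[of "gn_tm s"] eventually_ge[of X] eventually_is_tm[of s] in
        \<open>eventually_elim, simp add: substS_stepI\<close>)
next
  case Fls
  show ?case
    by (rule ev_derives_axiom)
      (auto intro!: always_eventually simp: substS_stepI(5)[of 0 _ 0 0 0, simplified])
next
  case (Imp p q)
  let ?C = "{pair (gn p) (gn (substS V V' p)), pair (gn q) (gn (substS V V' q))}"
  show ?case
  proof (rule ev_derives_step[of _ ?C])
    show "\<forall>\<^sub>F b in sequentially. substS_step b V V' ?C
        (pair (gn (p \<^bold>\<longrightarrow> q)) (gn (substS V V' (p \<^bold>\<longrightarrow> q))))"
      using eventually_ge[of "gn p"] eventually_ge[of "gn q"]
        eventually_ge[of "gn (substS V V' p)"] eventually_ge[of "gn (substS V V' q)"]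
      by eventually_elim (simp add: substS_stepI)
  qed (use Imp in auto)
next
  case (Forall x p)
  let ?C = "{pair (gn p) (gn (substS V V' p))}"
  have "\<forall>\<^sub>F b in sequentially. substS_step b V V' ?C
      (pair (gn (Forall x p)) (gn (substS V V' (Forall x p))))"
    using eventually_ge[of x] eventually_ge[of "gn p"] eventually_ge[of "gn (substS V V' p)"]
    by eventually_elim (simp add: substS_stepI)
  then show ?case
    by (rule ev_derives_step[rotated -1]) (use Forall in auto)
next
  case (ForallS X p)
  show ?case
  proof (cases "V \<in> fvS (ForallS X p)")
    case False
    then have *: "substS V V' (ForallS X p) = ForallS X p"
      by (rule substS_idle)
    show ?thesis
    unfolding *
      by (rule ev_derives_axiom, simp)
        (use eventually_ge[of X] eventually_ge[of "gn p"] eventually_not_freeS_code[OF False] in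
          \<open>eventually_elim, simp add: substS_stepI\<close>)
  next
    case True
    with ForallS.prems have *: "X \<noteq> V" "X \<noteq> V'" "free_forS V V' p"
      by auto
    let ?C = "{pair (gn p) (gn (substS V V' p))}"
    have "\<forall>\<^sub>F b in sequentially. substS_step b V V' ?C
        (pair (gn (ForallS X p)) (gn (substS V V' (ForallS X p))))"
      using eventually_ge[of X] eventually_ge[of "gn p"] eventually_ge[of "gn (substS V V' p)"]
      by eventually_elim (use * in \<open>simp add: substS_stepI\<close>)
    then show ?thesis
      by (rule ev_derives_step[rotated -1]) (use ForallS.IH * in auto)
  qed
qed

definition logical_axiom_code :: "nat \<Rightarrow> nat \<Rightarrow> bool" where
  "logical_axiom_code b z \<longleftrightarrow>
    (\<exists>p\<le>b. \<exists>q\<le>b. \<exists>r\<le>b. \<exists>x\<le>b. \<exists>s\<le>b. \<exists>t\<le>b.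
       fm_code b p \<and> fm_code b q \<and> z = pair 9 (pair p (pair 9 (pair q p))) \<or>
       fm_code b p \<and> fm_code b q \<and> fm_code b r \<and>
         z = pair 9 (pair (pair 9 (pair p (pair 9 (pair q r))))
               (pair 9 (pair (pair 9 (pair p q)) (pair 9 (pair p r))))) \<or>
       fm_code b p \<and>
         z = pair 9 (pair (pair 9 (pair (pair 9 (pair p (pair 8 0))) (pair 8 0))) p) \<or>
       fm_code b p \<and> tm_code (\<lambda>_. True) b t \<and> subst_code b x t (pair p q) \<and>
         z = pair 9 (pair (pair 10 (pair x p)) q) \<or>
       not_free_code b x p \<and> fm_code b q \<and>
         z = pair 9 (pair (pair 10 (pair x (pair 9 (pair p q)))) (pair 9 (pair p (pair 10 (pair x q))))) \<or>
       fm_code b p \<and> substS_code b x s (pair p q) \<and>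
         z = pair 9 (pair (pair 11 (pair x p)) q) \<or>
       not_freeS_code b x p \<and> fm_code b q \<and>
         z = pair 9 (pair (pair 11 (pair x (pair 9 (pair p q)))) (pair 9 (pair p (pair 11 (pair x q))))) \<or>
       tm_code (\<lambda>_. True) b t \<and> z = pair 5 (pair t t) \<or>
       fm_code b p \<and> tm_code (\<lambda>_. True) b s \<and> tm_code (\<lambda>_. True) b t \<and>
         subst_code b x s (pair p q) \<and> subst_code b x t (pair p r) \<and>
         z = pair 9 (pair (pair 5 (pair s t)) (pair 9 (pair q r))))"

lemma sat_is_logical_axiom [simp]:
  assumes "fresh_tm b \<le> k" "fresh_tm z \<le> k"
  shows "sat e E (is_logical_axiom k b z) \<longleftrightarrow> logical_axiom_code (eval e b) (eval e z)"
proof -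
  have [simp]: "fresh_tm b \<le> k + i" "fresh_tm z \<le> k + i" for i
    using assms by (auto intro: trans_le_add1)
  show ?thesis
    unfolding is_logical_axiom_def logical_axiom_code_def Let_def sat_ExistsLes(4)[OF assms(1)]
    using assms by (intro ex_cong1 conj_cong refl) (simp del: Disjs.simps Conjs.simps)
qed

lemma logical_axiom_codeI:
  assumes "p \<le> b" "q \<le> b" "r \<le> b" "x \<le> b" "s \<le> b" "t \<le> b"
  shows "fm_code b p \<Longrightarrow> fm_code b q \<Longrightarrow>
      logical_axiom_code b (pair 9 (pair p (pair 9 (pair q p))))"
    and "fm_code b p \<Longrightarrow> fm_code b q \<Longrightarrow> fm_code b r \<Longrightarrow>
      logical_axiom_code b (pair 9 (pair (pair 9 (pair p (pair 9 (pair q r))))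
               (pair 9 (pair (pair 9 (pair p q)) (pair 9 (pair p r))))))"
    and "fm_code b p \<Longrightarrow>
      logical_axiom_code b (pair 9 (pair (pair 9 (pair (pair 9 (pair p (pair 8 0))) (pair 8 0))) p))"
    and "fm_code b p \<Longrightarrow> tm_code (\<lambda>_. True) b t \<Longrightarrow> subst_code b x t (pair p q) \<Longrightarrow>
      logical_axiom_code b (pair 9 (pair (pair 10 (pair x p)) q))"
    and "not_free_code b x p \<Longrightarrow> fm_code b q \<Longrightarrow>
      logical_axiom_code b (pair 9 (pair (pair 10 (pair x (pair 9 (pair p q))))
        (pair 9 (pair p (pair 10 (pair x q))))))"
    and "fm_code b p \<Longrightarrow> substS_code b x s (pair p q) \<Longrightarrow>
      logical_axiom_code b (pair 9 (pair (pair 11 (pair x p)) q))"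
    and "not_freeS_code b x p \<Longrightarrow> fm_code b q \<Longrightarrow>
      logical_axiom_code b (pair 9 (pair (pair 11 (pair x (pair 9 (pair p q))))
        (pair 9 (pair p (pair 11 (pair x q))))))"
    and "tm_code (\<lambda>_. True) b t \<Longrightarrow> logical_axiom_code b (pair 5 (pair t t))"
    and "fm_code b p \<Longrightarrow> tm_code (\<lambda>_. True) b s \<Longrightarrow> tm_code (\<lambda>_. True) b t \<Longrightarrow>
         subst_code b x s (pair p q) \<Longrightarrow> subst_code b x t (pair p r) \<Longrightarrow>
      logical_axiom_code b (pair 9 (pair (pair 5 (pair s t)) (pair 9 (pair q r))))"
  unfolding logical_axiom_code_def
  by (rule exI[of _ p], rule conjI[OF assms(1)], rule exI[of _ q], rule conjI[OF assms(2)],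
      rule exI[of _ r], rule conjI[OF assms(3)], rule exI[of _ x], rule conjI[OF assms(4)],
      rule exI[of _ s], rule conjI[OF assms(5)], rule exI[of _ t], rule conjI[OF assms(6)]; simp)+

lemma eventually_logical_axiom_code:
  "logical_axiom p \<Longrightarrow> \<forall>\<^sub>F b in sequentially. logical_axiom_code b (gn p)"
proof (induction rule: logical_axiom.induct)
  case (1 p q)
  show ?case
    using eventually_ge[of "gn p"] eventually_ge[of "gn q"] eventually_fm_code[of p] eventually_fm_code[of q]
    \<comment> \<open>Witness slots that do not occur in the schema at hand are filled with 0, here
      and below.\<close>
    by eventually_elim (simp add: logical_axiom_codeI(1)[of _ _ _ 0 0 0 0])
next
  case (2 p q r)
  show ?case
    using eventually_ge[of "gn p"] eventually_ge[of "gn q"] eventually_ge[of "gn r"]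
      eventually_fm_code[of p] eventually_fm_code[of q] eventually_fm_code[of r]
    by eventually_elim (simp add: logical_axiom_codeI(2)[of _ _ _ _ 0 0 0])
next
  case (3 p)
  show ?case
    using eventually_ge[of "gn p"] eventually_fm_code[of p]
    by eventually_elim (simp add: logical_axiom_codeI(3)[of _ _ 0 0 0 0 0])
next
  case (4 x t p)
  show ?case
    using eventually_ge[of "gn p"] eventually_ge[of x] eventually_ge[of "gn_tm t"]
      eventually_ge[of "gn (subst x t p)"] eventually_fm_code[of p] eventually_is_tm[of t]
      eventually_subst_code[OF 4]
    by eventually_elim (simp add: logical_axiom_codeI(4)[of _ _ _ 0 _ 0 "gn_tm t"])
next
  case (5 x p q)
  show ?case
    using eventually_ge[of "gn p"] eventually_ge[of "gn q"] eventually_ge[of x]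
      eventually_fm_code[of q] eventually_not_free_code[OF 5]
    by eventually_elim (simp add: logical_axiom_codeI(5)[of _ _ _ 0 _ 0 0])
next
  case (6 X Y p)
  show ?case
    using eventually_ge[of "gn p"] eventually_ge[of X] eventually_ge[of Y]
      eventually_ge[of "gn (substS X Y p)"] eventually_fm_code[of p] eventually_substS_code[OF 6]
    by eventually_elim (simp add: logical_axiom_codeI(6)[of _ _ _ 0 _ Y 0])
next
  case (7 X p q)
  show ?case
    using eventually_ge[of "gn p"] eventually_ge[of "gn q"] eventually_ge[of X]
      eventually_fm_code[of q] eventually_not_freeS_code[OF 7]
    by eventually_elim (simp add: logical_axiom_codeI(7)[of _ _ _ 0 _ 0 0])
next
  case (8 t)
  show ?case
    using eventually_ge[of "gn_tm t"] eventually_is_tm[of t]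
    by eventually_elim (simp add: logical_axiom_codeI(8)[of 0 _ 0 0 0 0])
next
  case (9 x s p t)
  show ?case
    using eventually_ge[of "gn p"] eventually_ge[of x] eventually_ge[of "gn_tm s"] eventually_ge[of "gn_tm t"]
      eventually_ge[of "gn (subst x s p)"] eventually_ge[of "gn (subst x t p)"]
      eventually_fm_code[of p] eventually_is_tm[of s] eventually_is_tm[of t]
      eventually_subst_code[OF 9(1)] eventually_subst_code[OF 9(2)]
    by eventually_elim (simp add: logical_axiom_codeI(9)[of "gn p" _ _ _ x])
qed

section \<open>Bounded witnesses and the proof predicate\<close>

lemma subst_tm_eval: "eval e (subst_tm x t u) = eval (e(x := eval e t)) u"
  by (induction u) auto

lemma sat_subst: "free_for x t p \<Longrightarrow> sat e E (subst x t p) = sat (e(x := eval e t)) E p"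
proof (induction p arbitrary: e E)
  case (Forall y p)
  show ?case
  proof (cases "x \<in> fv (Forall y p)")
    case True
    with Forall.prems have *: "y \<noteq> x" "y \<notin> fv_tm t" "free_for x t p" by auto
    then have "eval (e(y := n)) t = eval e t" for n
      by (intro eval_cong) auto
    moreover have "e(y := n, x := eval e t) = e(x := eval e t, y := n)" for n
      using *(1) by (rule fun_upd_twist)
    ultimately have "sat (e(y := n)) E (subst x t p) = sat (e(x := eval e t, y := n)) E p" for n
      by (subst Forall.IH[OF *(3)]) simp
    with *(1) show ?thesis
      by (simp only: subst.simps sat.simps if_False)
  next
    case False
    then show ?thesis
      unfolding subst_idle[OF False] by (intro sat_cong) auto
  qed
qed (auto simp: subst_tm_eval)

lemma free_for_fresh: "fresh p \<le> j \<Longrightarrow> free_for x (Var j) p"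
  by (induction p) auto

lemma delta0_fvS: "delta0 p \<Longrightarrow> fvS p = {}"
  by (induction rule: delta0.induct) auto

lemma delta0_bound_witnesses: "delta0 p \<Longrightarrow> bound_witnesses b p = p"
  by (cases "(b, p)" rule: bound_witnesses.cases) auto

lemma fvS_bound_witnesses: "sigma1 p \<Longrightarrow> fvS (bound_witnesses b p) = {}"
  by (induction rule: sigma1.induct) (auto simp: delta0_bound_witnesses delta0_fvS dest: delta0_fvS)

lemma fv_bound_witnesses: "sigma1 p \<Longrightarrow> fv (bound_witnesses b p) \<subseteq> fv p \<union> fv_tm b"
  by (induction rule: sigma1.induct) (auto simp: delta0_bound_witnesses)

lemma fresh_bound_witnesses: "sigma1 p \<Longrightarrow> fresh (bound_witnesses b p) \<le> max (fresh p) (fresh_tm b)"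
  by (induction rule: sigma1.induct) (auto simp: delta0_bound_witnesses)

text \<open>The bound is the maximum of the witnesses met on the way. The statement is uniform in
  the name of the bounding variable and in the assignment outside the free variables, because the
  bounded formula is evaluated deep inside \<open>Prf_fm\<close>.\<close>

lemma sat_bound_witnesses:
  assumes "sigma1 p" "sat e E p"
  shows "\<exists>B. \<forall>b\<ge>B. \<forall>e' E' k. fresh p \<le> k \<longrightarrow> (\<forall>x\<in>fv p. e' x = e x) \<longrightarrow> e' k = b \<longrightarrow>
    sat e' E' (bound_witnesses (Var k) p)"
  using assms
proof (induction arbitrary: e rule: sigma1.induct)
  case (1 p)
  then have "sat e' E' p" if "\<forall>x\<in>fv p. e' x = e x" for e' E'
    using sat_cong[of p e' e E' E] that delta0_fvS[of p] by auto
  with 1 show ?case by (auto simp: delta0_bound_witnesses)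
next
  case (2 p x)
  show ?case
  proof (cases "delta0 (Exists x p)")
    case True
    then have "sat e' E' (Exists x p)" if "\<forall>y\<in>fv (Exists x p). e' y = e y" for e' E'
      using sat_cong[of "Exists x p" e' e E' E] that delta0_fvS[of "Exists x p"] 2(3) by auto
    with True show ?thesis by (simp only: delta0_bound_witnesses) blast
  next
    case False
    from 2(3) obtain n where "sat (e(x := n)) E p" by auto
    from 2(2)[OF this] obtain B where B: "\<And>b e' E' k. B \<le> b \<Longrightarrow> fresh p \<le> k \<Longrightarrow>
        (\<forall>y\<in>fv p. e' y = (e(x := n)) y) \<Longrightarrow> e' k = b \<Longrightarrow> sat e' E' (bound_witnesses (Var k) p)"
      by blast
    have "sat e' E' (bound_witnesses (Var k) (Exists x p))"
      if *: "max B n \<le> b" "fresh (Exists x p) \<le> k" "\<forall>y\<in>fv (Exists x p). e' y = e y" "e' k = b"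
      for b e' E' k
    proof -
      have "sat (e'(x := n)) E' (bound_witnesses (Var k) p)"
        by (rule B[of b]) (use * in auto)
      with * False show ?thesis by (auto simp: less_Suc_eq_le)
    qed
    then show ?thesis by blast
  qed
qed

text \<open>For a \<Sigma>1 formula \<open>T\<close> with no free variable besides 0, the bounded
  formula has only 0 and \<open>k\<close> free, so the default value 0 elsewhere and the empty sets
  are harmless.\<close>

definition axiom_code :: "fm \<Rightarrow> nat \<Rightarrow> nat \<Rightarrow> nat \<Rightarrow> bool" where
  "axiom_code T k b z \<longleftrightarrow>
     sat ((\<lambda>_. 0)(0 := z, k := b)) (\<lambda>_. {}) (bound_witnesses (Var k) T)"

definition proof_step :: "fm \<Rightarrow> nat \<Rightarrow> nat \<Rightarrow> nat set \<Rightarrow> nat \<Rightarrow> bool" where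
  "proof_step T k b W z \<longleftrightarrow> (\<exists>p\<le>b. \<exists>v\<le>b.
     logical_axiom_code b z \<or> axiom_code T k b z \<or>
     p \<in> W \<and> pair 9 (pair p z) \<in> W \<or>
     p \<in> W \<and> (z = pair 10 (pair v p) \<or> z = pair 11 (pair v p)))"

lemma sat_Conj: "sat e E (p \<^bold>\<and> q) \<longleftrightarrow> sat e E p \<and> sat e E q"
  by simp

text \<open>The condition \<open>0 < k\<close> separates the variable 0, for which the candidate
  axiom is substituted, from the variable \<open>k\<close> that holds the bound.\<close>

lemma sat_Prf_fm:
  assumes "sigma1 T" "fv T \<subseteq> {0}" "fresh T \<le> k" "0 < k" "fresh_tm x \<le> k" "fresh_tm y \<le> k"
  shows "sat e E (Prf_fm T k x y) \<longleftrightarrow>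
    (\<exists>b a m l. eval e x = pair b (pair a (pair m l)) \<and> eval e y = beta a m l \<and>
       (\<forall>i\<le>l. proof_step T k b (beta a m ` {..<i}) (beta a m i)))"
proof -
  let ?R = "\<lambda>k' E z. let p = Var k'; v = Var (k'+1); n = k'+2
          in ExistsLes k' 2 (Var k) (Disjs [
            is_logical_axiom n (Var k) z,
            subst 0 z (bound_witnesses (Var k) T),
            Conjs [E n p, E n (cImp p z)],
            Conjs [E n p, z \<^bold>= cForall v p \<^bold>\<or> z \<^bold>= cForallS v p]])"
  let ?e = "\<lambda>b a m l. e(k := b, k + 1 := a, k + 2 := m, k + 3 := l)"
  have R: "interprets (k + 4) (?e b a m l) E ?R (proof_step T k b)" for b a m l
    unfolding interprets_def
  proof (intro allI impI, goal_cases)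
    case (1 e' n F W z)
    \<comment> \<open>The entry to be tested is a variable beyond those of the bounded axiom
      formula, so substituting it for 0 captures nothing.\<close>
    then obtain j where j: "k + 4 \<le> j" "z = Var j" "j < n" by auto
    have k: "e' k = b"
      using 1(2) by (simp add: agree_def)
    have "sat (e'(n := p, n + 1 := v)) E (subst 0 z (bound_witnesses (Var k) T)) \<longleftrightarrow>
        axiom_code T k b (e' j)" for p v
    proof -
      have "fresh (bound_witnesses (Var k) T) \<le> j"
        using fresh_bound_witnesses[OF assms(1), of "Var k"] assms(3) j by simp
      then have "sat (e'(n := p, n + 1 := v)) E (subst 0 z (bound_witnesses (Var k) T)) \<longleftrightarrow>
        sat (e'(n := p, n + 1 := v, 0 := e' j)) E (bound_witnesses (Var k) T)"
        using j by (simp add: sat_subst free_for_fresh)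
      also have "\<dots> \<longleftrightarrow> axiom_code T k b (e' j)"
        unfolding axiom_code_def
        using fv_bound_witnesses[OF assms(1), of "Var k"] fvS_bound_witnesses[OF assms(1), of "Var k"]
          assms(2,4) 1(1) k
        by (intro sat_cong) auto
      finally show ?thesis .
    qed
    with 1 j k show ?case
      by (simp add: Let_def proof_step_def del: Disjs.simps Conjs.simps sat.simps(7))
        (intro ex_cong1 conj_cong refl; blast)
  qed
  have [simp]: "fresh_tm x \<le> k + i" "fresh_tm y \<le> k + i" for i
    using assms by (auto intro: trans_le_add1)
  have D: "sat (?e b a m l) E (derivation (k + 4) (Var (k + 1)) (Var (k + 2)) (Var (k + 3)) y ?R) \<longleftrightarrow>
      eval e y = beta a m l \<and> (\<forall>i\<le>l. proof_step T k b (beta a m ` {..<i}) (beta a m i))" for b a m l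
    by (subst sat_derivation[OF _ _ _ _ R]) (use assms in simp_all)
  have "sat e E (Prf_fm T k x y) \<longleftrightarrow>
    (\<exists>b\<le>eval e x. \<exists>a\<le>eval e x. \<exists>m\<le>eval e x. \<exists>l\<le>eval e x.
       eval e x = pair b (pair a (pair m l)) \<and> eval e y = beta a m l \<and>
       (\<forall>i\<le>l. proof_step T k b (beta a m ` {..<i}) (beta a m i)))"
    unfolding Prf_fm_def Let_def sat_ExistsLes(3)[OF assms(5)]
    by (intro ex_cong1 conj_cong refl, unfold sat_Conj D[unfolded Let_def]) (use assms in simp)
  also have "\<dots> \<longleftrightarrow> (\<exists>b a m l. eval e x = pair b (pair a (pair m l)) \<and> eval e y = beta a m l \<and>
       (\<forall>i\<le>l. proof_step T k b (beta a m ` {..<i}) (beta a m i)))" (is "?L \<longleftrightarrow> ?R")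
  proof
    assume ?R
    then obtain b a m l where *: "eval e x = pair b (pair a (pair m l))" "eval e y = beta a m l"
       "\<forall>i\<le>l. proof_step T k b (beta a m ` {..<i}) (beta a m i)"
      by blast
    have le: "b \<le> eval e x" "a \<le> eval e x" "m \<le> eval e x" "l \<le> eval e x"
      unfolding *(1) by (meson le_pair1 le_pair2 le_trans)+
    show ?L
      by (rule exI[of _ b], rule conjI[OF le(1)], rule exI[of _ a], rule conjI[OF le(2)],
        rule exI[of _ m], rule conjI[OF le(3)], rule exI[of _ l], rule conjI[OF le(4)]) (intro conjI *)
  qed blast
  finally show ?thesis .
qed

lemma monotone_proof_step [simp]: "monotone_step (proof_step T k)"
  unfolding monotone_step_def proof_step_def
  by (intro allI impI) (elim ex_forward conj_forward disj_forward; blast)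

lemma ev_proof_step:
  assumes T: "sigma1 T" "fv T \<subseteq> {0}" "fresh T \<le> k" "0 < k" and p: "provable (axioms_of T) p"
  shows "ev_derives (proof_step T k) (gn p)"
  using p
proof (induction rule: provable.induct)
  case (logical p)
  have "\<forall>\<^sub>F b in sequentially. proof_step T k b {} (gn p)"
    using eventually_logical_axiom_code[OF logical]
    by eventually_elim (auto simp: proof_step_def)
  then show ?case
    by (rule ev_derives_step[rotated -1]) auto
next
  case (nonlogical p)
  then have "sat ((\<lambda>_. 0)(0 := gn p)) (\<lambda>_. {}) T"
    by (simp add: axioms_of_def)
  \<comment> \<open>Membership in \<open>axioms_of T\<close> is truth of a \<Sigma>1 formula; its
    witnesses fit below every large bound.\<close>
  from sat_bound_witnesses[OF T(1) this]
  obtain B where B: "\<forall>b\<ge>B. \<forall>e' E' k. fresh T \<le> k \<longrightarrow>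
      (\<forall>x\<in>fv T. e' x = ((\<lambda>_. 0)(0 := gn p)) x) \<longrightarrow> e' k = b \<longrightarrow> sat e' E' (bound_witnesses (Var k) T)"
    by blast
  have ax: "axiom_code T k b (gn p)" if "B \<le> b" for b
    unfolding axiom_code_def by (rule B[rule_format, OF that T(3)]) (use T(2,4) in auto)
  have "\<forall>\<^sub>F b in sequentially. proof_step T k b {} (gn p)"
    using eventually_ge[of B]
    by (rule eventually_mono)
      (unfold proof_step_def, rule exI[of _ 0], rule conjI[OF le0], rule exI[of _ 0],
       rule conjI[OF le0], simp add: ax)
  then show ?case
    by (rule ev_derives_step[rotated -1]) auto
next
  case (modus_ponens p q)
  have "\<forall>\<^sub>F b in sequentially. proof_step T k b {gn p, gn (p \<^bold>\<longrightarrow> q)} (gn q)"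
    using eventually_ge[of "gn p"] by eventually_elim (auto simp: proof_step_def)
  then show ?case
    by (rule ev_derives_step[rotated -1]) (use modus_ponens in auto)
next
  case (generalization p x)
  have "\<forall>\<^sub>F b in sequentially. proof_step T k b {gn p} (gn (Forall x p))"
    using eventually_ge[of "gn p"] eventually_ge[of x] by eventually_elim (auto simp: proof_step_def)
  then show ?case
    by (rule ev_derives_step[rotated -1]) (use generalization in auto)
next
  case (generalizationS p X)
  have "\<forall>\<^sub>F b in sequentially. proof_step T k b {gn p} (gn (ForallS X p))"
    using eventually_ge[of "gn p"] eventually_ge[of X] by eventually_elim (auto simp: proof_step_def)
  then show ?case
    by (rule ev_derives_step[rotated -1]) (use generalizationS in auto)
qed

text \<open>\<Sigma>1 completeness in the standard model: a derivation is coded as a bounded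
  sequence. It serves to recognize one actual theorem of each theory in the sequence.\<close>

lemma sat_Pr_fm:
  assumes T: "sigma1 T" "fv T \<subseteq> {0}" "fresh T \<le> k" and p: "provable (axioms_of T) p"
    and y: "fresh_tm y \<le> k" "eval e y = gn p"
  shows "sat e E (Pr_fm T k y)"
proof -
  from ev_derives[OF ev_proof_step[OF T(1,2) _ _ p, of "k + 1"]] T(3)
  obtain b where "derives (proof_step T (k + 1) b) b (gn p)"
    by (auto simp: eventually_sequentially)
  then obtain a m l where *: "gn p = beta a m l"
      "\<forall>i\<le>l. proof_step T (k + 1) b (beta a m ` {..<i}) (beta a m i)"
    unfolding derives_def by blast
  have "sat (e(k := pair b (pair a (pair m l)))) E (Prf_fm T (k + 1) (Var k) y)"
    using T y * by (subst sat_Prf_fm) auto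
  then show ?thesis
    by (auto simp: Pr_fm_def)
qed

lemma sat_is_pi11_sentence:
  assumes p: "pi11_sentence p" and y: "fresh_tm y \<le> k" "eval e y = gn p"
  shows "sat e E (is_pi11_sentence k y)"
proof -
  from p obtain X q where q: "p = ForallS X q" "arithmetical q" "sentence p"
    by (auto simp: pi11_sentence_def)
  have "\<forall>\<^sub>F b in sequentially. \<forall>v\<in>{..gn p}. not_free_code b v (gn p) \<and> not_freeS_code b v (gn p)"
    using q(3) by (intro eventually_ball_finite ballI eventually_conj eventually_not_free_code
      eventually_not_freeS_code) (auto simp: sentence_def)
  with eventually_arith_code[OF q(2)]
  have "\<forall>\<^sub>F b in sequentially. arith_code b (gn q) \<and>
      (\<forall>v\<in>{..gn p}. not_free_code b v (gn p) \<and> not_freeS_code b v (gn p))"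
    by (rule eventually_conj)
  then obtain b where b: "arith_code b (gn q)"
      "\<forall>v\<le>gn p. not_free_code b v (gn p) \<and> not_freeS_code b v (gn p)"
    by (auto simp: eventually_sequentially)
  have [simp]: "fresh_tm y \<le> k + i" for i
    using y by (auto intro: trans_le_add1)
  have le: "X \<le> gn p" "gn q \<le> gn p"
    unfolding q(1) gn.simps by (meson le_pair1 le_pair2 le_trans)+
  have "sat (e(k := b)) E (ExistsLe (k+1) y (ExistsLe (k+2) y
         (y \<^bold>= cForallS (Var (k+1)) (Var (k+2)) \<^bold>\<and> is_arithmetical (k+3) (Var k) (Var (k+2)))))"
    using y le b q(1) by (subst sat_ExistsLe, simp, subst sat_ExistsLe, simp) (auto intro!: exI[of _ X] exI[of _ "gn q"])
  moreover have "sat (e(k := b)) E (ForallLe (k+1) y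
      (not_free (k+2) (Var k) (Var (k+1)) y \<^bold>\<and> not_freeS (k+2) (Var k) (Var (k+1)) y))"
    using y b by (subst sat_ForallLe) auto
  ultimately show ?thesis
    unfolding is_pi11_sentence_def Let_def by (auto simp del: sat.simps(7))
qed

section \<open>The arithmetized truth definition\<close>

definition value_step :: "nat \<Rightarrow> nat \<Rightarrow> nat \<Rightarrow> nat set \<Rightarrow> nat \<Rightarrow> bool" where
  "value_step a m b W z \<longleftrightarrow> (\<exists>x\<le>b. \<exists>y\<le>b. \<exists>i\<le>b. \<exists>j\<le>b.
     z = pair (pair 0 x) i \<and> i = beta a m x \<or>
     z = pair (pair 1 0) 0 \<or>
     z = pair (pair 2 0) 1 \<or>
     (z = pair (pair 3 (pair x y)) (i + j) \<or> z = pair (pair 4 (pair x y)) (i * j)) \<and>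
       pair x i \<in> W \<and> pair y j \<in> W)"

lemma sat_is_value_derives:
  assumes "fresh_tm a \<le> k" "fresh_tm m \<le> k" "fresh_tm t \<le> k" "fresh_tm n \<le> k"
  shows "sat e E (is_value k a m t n) \<longleftrightarrow>
    (\<exists>b. derives (value_step (eval e a) (eval e m) b) b (pair (eval e t) (eval e n)))"
proof -
  have "sat (e(k := b)) E (derivable (k+1) (Var k) (cPair t n) (\<lambda>k' E z.
       let x = Var k'; y = Var (k'+1); i = Var (k'+2); j = Var (k'+3); n = k'+4
       in ExistsLes k' 4 (Var k) (Disjs [
         Conjs [z \<^bold>= cPair (cVar x) i, beta_fm n a m x i],
         z \<^bold>= cPair cZero Zero,
         z \<^bold>= cPair cOne One,
         Conjs [z \<^bold>= cPair (cAdd x y) (i \<^bold>+ j) \<^bold>\<or> z \<^bold>= cPair (cMul x y) (i \<^bold>* j),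
                E n (cPair x i), E n (cPair y j)]]))) \<longleftrightarrow>
     derives (value_step (eval e a) (eval e m) b) (eval (e(k := b)) (Var k)) (eval (e(k := b)) (cPair t n))"
    for b
  proof (rule sat_derivable, goal_cases)
    case 3
    show ?case
    proof (unfold interprets_def, intro allI impI, goal_cases)
      case (1 e' n' F W z)
      have a: "agree n' e' e'' \<Longrightarrow> agree k e e''" for e''
        using agree_trans[OF 1(2) agree_mono[OF _ 1(1)]] agree_mono[of "k + 1" "e(k := b)" e'' k] 
        by (simp add: agree_def)
      have [simp]: "fresh_tm a \<le> n'" "fresh_tm a \<le> n' + i" "agree n' e' e'' \<Longrightarrow> eval e'' a = eval e a"
        "fresh_tm m \<le> n'" "fresh_tm m \<le> n' + i" "agree n' e' e'' \<Longrightarrow> eval e'' m = eval e m" for i e''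
        using 1 assms by (auto intro: trans_le_add1 eval_agree[OF a])
      have k: "e' k = b"
        using 1(2) by (simp add: agree_def)
      show ?case
        using 1 k by (simp add: Let_def value_step_def del: sat.simps(7) Disjs.simps Conjs.simps)
          (intro ex_cong1 conj_cong refl; blast)
    qed
  qed (use assms in auto)
  then show ?thesis
    using assms by (simp add: is_value_def Let_def)
qed

lemma monotone_value_step [simp]: "monotone_step (value_step a m)"
  unfolding monotone_step_def value_step_def
  by (intro allI impI) (elim ex_forward conj_forward disj_forward; blast)

lemma value_stepI:
  assumes "x \<le> b" "y \<le> b" "i \<le> b" "j \<le> b"
  shows "i = beta a m x \<Longrightarrow> value_step a m b W (pair (pair 0 x) i)"
    and "value_step a m b W (pair (pair 1 0) 0)"
    and "value_step a m b W (pair (pair 2 0) 1)"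
    and "pair x i \<in> W \<Longrightarrow> pair y j \<in> W \<Longrightarrow> value_step a m b W (pair (pair 3 (pair x y)) (i + j))"
    and "pair x i \<in> W \<Longrightarrow> pair y j \<in> W \<Longrightarrow> value_step a m b W (pair (pair 4 (pair x y)) (i * j))"
  using assms unfolding value_step_def by blast+

lemma ev_value_step: "ev_derives (value_step a m) (pair (gn_tm s) (eval (beta a m) s))"
proof (induction s)
  case (Var x)
  have "\<forall>\<^sub>F b in sequentially. value_step a m b {} (pair (gn_tm (Var x)) (eval (beta a m) (Var x)))"
    using eventually_ge[of x] eventually_ge[of "beta a m x"]
    by eventually_elim (simp add: value_stepI(1)[of _ _ 0 _ 0])
  then show ?case
    by (rule ev_derives_step[rotated -1]) auto
next
  case Zero
  show ?case
    by (rule ev_derives_axiom)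
      (auto intro!: always_eventually simp: value_stepI(2)[of 0 _ 0 0 0, simplified])
next
  case One
  show ?case
    by (rule ev_derives_axiom)
      (auto intro!: always_eventually simp: value_stepI(3)[of 0 _ 0 0 0, simplified])
next
  case (Add s u)
  let ?C = "{pair (gn_tm s) (eval (beta a m) s), pair (gn_tm u) (eval (beta a m) u)}"
  have "\<forall>\<^sub>F b in sequentially. value_step a m b ?C (pair (gn_tm (s \<^bold>+ u)) (eval (beta a m) (s \<^bold>+ u)))"
    using eventually_ge[of "gn_tm s"] eventually_ge[of "gn_tm u"]
      eventually_ge[of "eval (beta a m) s"] eventually_ge[of "eval (beta a m) u"]
    by eventually_elim (simp add: value_stepI)
  then show ?case
    by (rule ev_derives_step[rotated -1]) (use Add in auto)
next
  case (Mul s u)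
  let ?C = "{pair (gn_tm s) (eval (beta a m) s), pair (gn_tm u) (eval (beta a m) u)}"
  have "\<forall>\<^sub>F b in sequentially. value_step a m b ?C (pair (gn_tm (s \<^bold>* u)) (eval (beta a m) (s \<^bold>* u)))"
    using eventually_ge[of "gn_tm s"] eventually_ge[of "gn_tm u"]
      eventually_ge[of "eval (beta a m) s"] eventually_ge[of "eval (beta a m) u"]
    by eventually_elim (simp add: value_stepI)
  then show ?case
    by (rule ev_derives_step[rotated -1]) (use Mul in auto)
qed

lemma value_step_sound:
  assumes "value_step a m b W (pair (gn_tm s) n)"
    and "\<And>s n. pair (gn_tm s) n \<in> W \<Longrightarrow> n = eval (beta a m) s"
  shows "n = eval (beta a m) s"
  using assms(1) unfolding value_step_def by (cases s) (auto dest: assms(2))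

lemma derives_value_step:
  assumes "derives (value_step a m b) b' (pair (gn_tm s) n)"
  shows "n = eval (beta a m) s"
proof -
  from assms obtain a' m' l where l: "pair (gn_tm s) n = beta a' m' l"
    and step: "\<forall>i\<le>l. value_step a m b (beta a' m' ` {..<i}) (beta a' m' i)"
    unfolding derives_def by (elim exE conjE) rule
  have "n = eval (beta a m) s" if "i \<le> l" "beta a' m' i = pair (gn_tm s) n" for i s n
    using that
  proof (induction i arbitrary: s n rule: less_induct)
    case (less i)
    have IH: "n' = eval (beta a m) s'" if "pair (gn_tm s') n' \<in> beta a' m' ` {..<i}" for s' n'
    proof -
      from that obtain j where "j < i" "beta a' m' j = pair (gn_tm s') n'" by auto
      with less.IH[of j] less.prems(1) show ?thesis by simp
    qed
    have "value_step a m b (beta a' m' ` {..<i}) (pair (gn_tm s) n)"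
      using step less.prems by metis
    then show ?case
      using IH by (rule value_step_sound)
  qed
  from this[of l] l show ?thesis by simp
qed

text \<open>The derived graph is total by \<open>ev_value_step\<close> and single-valued by
  \<open>derives_value_step\<close>.\<close>

lemma sat_is_value:
  assumes "fresh_tm a \<le> k" "fresh_tm m \<le> k" "fresh_tm t \<le> k" "fresh_tm n \<le> k"
    and "eval e t = gn_tm s"
  shows "sat e E (is_value k a m t n) \<longleftrightarrow> eval e n = eval (beta (eval e a) (eval e m)) s"
  using assms sat_is_value_derives[of a k m t n e E] derives_value_step
    ev_derives[OF ev_value_step[of "eval e a" "eval e m" s]]
  by (auto simp: eventually_sequentially)

lemma sat_is_variant:
  assumes "fresh_tm t \<le> k" "fresh_tm v \<le> k" "fresh_tm a \<le> k" "fresh_tm m \<le> k"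
    "fresh_tm a' \<le> k" "fresh_tm m' \<le> k"
  shows "sat e E (is_variant k t v a m a' m') \<longleftrightarrow>
    (\<forall>w\<le>eval e t. w \<noteq> eval e v \<longrightarrow> beta (eval e a) (eval e m) w = beta (eval e a') (eval e m') w)"
proof -
  have [simp]: "fresh_tm t \<le> k + i" "fresh_tm v \<le> k + i" "fresh_tm a \<le> k + i" "fresh_tm m \<le> k + i"
    "fresh_tm a' \<le> k + i" "fresh_tm m' \<le> k + i" for i
    using assms by (auto intro: trans_le_add1)
  show ?thesis
    unfolding is_variant_def using assms
    by (subst sat_ForallLe) (auto simp: less_Suc_eq_le)
qed

section \<open>Natural deduction\<close>

text \<open>Generalization is available only for outright theorems, through \<open>ded_thm\<close>.
  Hence the deduction theorem holds for arbitrary hypotheses, and the side condition on variables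
  moves to the derived rules \<open>ded_allI\<close> and \<open>ded_allSI\<close>.\<close>

inductive ded :: "fm set \<Rightarrow> fm set \<Rightarrow> fm \<Rightarrow> bool" for \<Gamma> \<Delta> :: "fm set" where
  ded_hyp: "p \<in> \<Delta> \<Longrightarrow> ded \<Gamma> \<Delta> p"
| ded_thm: "provable \<Gamma> p \<Longrightarrow> ded \<Gamma> \<Delta> p"
| ded_mp: "ded \<Gamma> \<Delta> (p \<^bold>\<longrightarrow> q) \<Longrightarrow> ded \<Gamma> \<Delta> p \<Longrightarrow> ded \<Gamma> \<Delta> q"

lemma ded_logical: "logical_axiom p \<Longrightarrow> ded \<Gamma> \<Delta> p"
  by (intro ded_thm logical)

lemma ded_empty: "ded \<Gamma> {} p \<Longrightarrow> provable \<Gamma> p"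
  by (induction rule: ded.induct) (auto intro: modus_ponens)

lemma ded_mono: "ded \<Gamma> \<Delta> p \<Longrightarrow> \<Delta> \<subseteq> \<Delta>' \<Longrightarrow> ded \<Gamma> \<Delta>' p"
  by (induction rule: ded.induct) (auto intro: ded.intros)

lemma ded_K: "ded \<Gamma> \<Delta> q \<Longrightarrow> ded \<Gamma> \<Delta> (p \<^bold>\<longrightarrow> q)"
  by (rule ded_mp[OF ded_logical[OF logical_axiom.intros(1)]])

lemma ded_refl: "ded \<Gamma> \<Delta> (p \<^bold>\<longrightarrow> p)"
  by (rule ded_mp[OF ded_mp[OF ded_logical[OF logical_axiom.intros(2)[of p "p \<^bold>\<longrightarrow> p" p]]]])
    (rule ded_logical[OF logical_axiom.intros(1)])+

lemma ded_impI: "ded \<Gamma> (insert p \<Delta>) q \<Longrightarrow> ded \<Gamma> \<Delta> (p \<^bold>\<longrightarrow> q)"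
proof (induction rule: ded.induct)
  case (ded_hyp q)
  then show ?case
    using ded_refl ded_K ded.ded_hyp by auto
next
  case (ded_thm q)
  then show ?case
    by (intro ded_K ded.ded_thm)
next
  case (ded_mp q r)
  show ?case
    by (rule ded.ded_mp[OF ded.ded_mp[OF ded_logical[OF logical_axiom.intros(2)] ded_mp.IH(1)] ded_mp.IH(2)])
qed

lemma subst_tm_self: "subst_tm x (Var x) t = t"
  by (induction t) auto

lemma subst_self: "subst x (Var x) p = p"
  by (induction p) (auto simp: subst_tm_self)

lemma free_for_self: "free_for x (Var x) p"
  by (induction p) auto

lemma substS_self: "substS X X p = p"
  by (induction p) auto

lemma free_forS_self: "free_forS X X p"
  by (induction p) auto

lemma free_forS_arithmetical: "arithmetical p \<Longrightarrow> free_forS X Y p"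
  by (induction p) auto

lemma ded_allE: "ded \<Gamma> \<Delta> (Forall x p) \<Longrightarrow> free_for x t p \<Longrightarrow> ded \<Gamma> \<Delta> (subst x t p)"
  by (rule ded_mp[OF ded_logical[OF logical_axiom.intros(4)]])

lemma ded_spec: "ded \<Gamma> \<Delta> (Forall x p) \<Longrightarrow> ded \<Gamma> \<Delta> p"
  using ded_allE[OF _ free_for_self] by (simp add: subst_self)

lemma ded_allSE: "ded \<Gamma> \<Delta> (ForallS X p) \<Longrightarrow> free_forS X Y p \<Longrightarrow> ded \<Gamma> \<Delta> (substS X Y p)"
  by (rule ded_mp[OF ded_logical[OF logical_axiom.intros(6)]])

lemma ded_specS: "ded \<Gamma> \<Delta> (ForallS X p) \<Longrightarrow> ded \<Gamma> \<Delta> p"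
  using ded_allSE[OF _ free_forS_self] by (simp add: substS_self)

lemma ded_generalize:
  assumes gen: "\<And>p. provable \<Gamma> p \<Longrightarrow> provable \<Gamma> (all p)"
    and spec: "\<And>\<Delta> p. ded \<Gamma> \<Delta> (all p) \<Longrightarrow> ded \<Gamma> \<Delta> p"
    and dist: "\<And>p q. closed p \<Longrightarrow> logical_axiom (all (p \<^bold>\<longrightarrow> q) \<^bold>\<longrightarrow> (p \<^bold>\<longrightarrow> all q))"
    and closed: "\<And>p. closed (all p)"
    and "ded \<Gamma> \<Delta> p" "\<And>q. q \<in> \<Delta> \<Longrightarrow> closed q"
  shows "ded \<Gamma> \<Delta> (all p)"
  using assms(5,6)
proof (induction rule: ded.induct)
  case (ded_hyp p)
  have "ded \<Gamma> \<Delta> (all (p \<^bold>\<longrightarrow> p))"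
    by (rule ded_thm, rule gen, rule ded_empty, rule ded_refl)
  then have "ded \<Gamma> \<Delta> (p \<^bold>\<longrightarrow> all p)"
    using ded_hyp by (intro ded_mp[OF ded_logical[OF dist]]) auto
  then show ?case
    by (rule ded_mp) (rule ded.ded_hyp, fact)
next
  case (ded_thm p)
  then show ?case
    by (intro ded.ded_thm gen)
next
  case (ded_mp p q)
  let ?A = "all (p \<^bold>\<longrightarrow> q)" and ?B = "all p"
  have "ded \<Gamma> {?B, ?A} q"
    by (rule ded.ded_mp; rule spec, rule ded.ded_hyp) auto
  then have "provable \<Gamma> (?A \<^bold>\<longrightarrow> ?B \<^bold>\<longrightarrow> q)"
    by (intro ded_empty ded_impI)
  then have "ded \<Gamma> \<Delta> (all (?A \<^bold>\<longrightarrow> ?B \<^bold>\<longrightarrow> q))"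
    by (intro ded_thm gen)
  then have "ded \<Gamma> \<Delta> (?A \<^bold>\<longrightarrow> all (?B \<^bold>\<longrightarrow> q))"
    by (rule ded.ded_mp[OF ded_logical[OF dist[OF closed]]])
  then have "ded \<Gamma> \<Delta> (all (?B \<^bold>\<longrightarrow> q))"
    by (rule ded.ded_mp) (rule ded_mp.IH(1), fact)
  then have "ded \<Gamma> \<Delta> (?B \<^bold>\<longrightarrow> all q)"
    by (rule ded.ded_mp[OF ded_logical[OF dist[OF closed]]])
  then show ?case
    by (rule ded.ded_mp) (rule ded_mp.IH(2), fact)
qed

lemma ded_allI:
  assumes "ded \<Gamma> \<Delta> p" "\<And>q. q \<in> \<Delta> \<Longrightarrow> x \<notin> fv q"
  shows "ded \<Gamma> \<Delta> (Forall x p)"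
  by (rule ded_generalize[where all = "Forall x" and closed = "\<lambda>q. x \<notin> fv q"])
    (use assms in \<open>auto intro: generalization logical_axiom.intros(5) ded_spec\<close>)

lemma ded_allSI:
  assumes "ded \<Gamma> \<Delta> p" "\<And>q. q \<in> \<Delta> \<Longrightarrow> X \<notin> fvS q"
  shows "ded \<Gamma> \<Delta> (ForallS X p)"
  by (rule ded_generalize[where all = "ForallS X" and closed = "\<lambda>q. X \<notin> fvS q"])
    (use assms in \<open>auto intro: generalizationS logical_axiom.intros(7) ded_specS\<close>)

lemma ded_ccontr: "ded \<Gamma> (insert (\<^bold>\<not> p) \<Delta>) Fls \<Longrightarrow> ded \<Gamma> \<Delta> p"
  by (rule ded_mp[OF ded_logical[OF logical_axiom.intros(3)] ded_impI])

lemma ded_FlsE: "ded \<Gamma> \<Delta> Fls \<Longrightarrow> ded \<Gamma> \<Delta> p"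
  by (rule ded_ccontr) (erule ded_mono, auto)

lemma ded_insert: "ded \<Gamma> (insert p \<Delta>) p"
  by (rule ded_hyp) simp

lemma ded_conjI: "ded \<Gamma> \<Delta> p \<Longrightarrow> ded \<Gamma> \<Delta> q \<Longrightarrow> ded \<Gamma> \<Delta> (p \<^bold>\<and> q)"
  by (rule ded_impI) (meson ded_insert ded_mono ded_mp subset_insertI)

lemma ded_conjD1: "ded \<Gamma> \<Delta> (p \<^bold>\<and> q) \<Longrightarrow> ded \<Gamma> \<Delta> p"
proof (rule ded_ccontr)
  assume "ded \<Gamma> \<Delta> (p \<^bold>\<and> q)"
  then have pq: "ded \<Gamma> (insert (\<^bold>\<not> p) \<Delta>) (p \<^bold>\<and> q)"
    by (rule ded_mono) auto
  have "ded \<Gamma> (insert p (insert (\<^bold>\<not> p) \<Delta>)) (\<^bold>\<not> q)"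
    by (rule ded_FlsE, rule ded_mp[of _ _ p]; rule ded_hyp) auto
  then have "ded \<Gamma> (insert (\<^bold>\<not> p) \<Delta>) (p \<^bold>\<longrightarrow> \<^bold>\<not> q)"
    by (rule ded_impI)
  with pq show "ded \<Gamma> (insert (\<^bold>\<not> p) \<Delta>) Fls"
    by (rule ded_mp)
qed

lemma ded_conjD2: "ded \<Gamma> \<Delta> (p \<^bold>\<and> q) \<Longrightarrow> ded \<Gamma> \<Delta> q"
proof (rule ded_ccontr)
  assume "ded \<Gamma> \<Delta> (p \<^bold>\<and> q)"
  then have "ded \<Gamma> (insert (\<^bold>\<not> q) \<Delta>) (p \<^bold>\<and> q)"
    by (rule ded_mono) auto
  moreover have "ded \<Gamma> (insert (\<^bold>\<not> q) \<Delta>) (p \<^bold>\<longrightarrow> \<^bold>\<not> q)"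
    by (rule ded_K, rule ded_insert)
  ultimately show "ded \<Gamma> (insert (\<^bold>\<not> q) \<Delta>) Fls"
    by (rule ded_mp)
qed

lemma ded_iffI:
  "ded \<Gamma> (insert p \<Delta>) q \<Longrightarrow> ded \<Gamma> (insert q \<Delta>) p \<Longrightarrow> ded \<Gamma> \<Delta> (p \<^bold>\<longleftrightarrow> q)"
  by (intro ded_conjI ded_impI)

lemma ded_iffD1: "ded \<Gamma> \<Delta> (p \<^bold>\<longleftrightarrow> q) \<Longrightarrow> ded \<Gamma> \<Delta> p \<Longrightarrow> ded \<Gamma> \<Delta> q"
  by (rule ded_mp[OF ded_conjD1])

lemma ded_iffD2: "ded \<Gamma> \<Delta> (p \<^bold>\<longleftrightarrow> q) \<Longrightarrow> ded \<Gamma> \<Delta> q \<Longrightarrow> ded \<Gamma> \<Delta> p"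
  by (rule ded_mp[OF ded_conjD2])

lemma ded_exI:
  assumes "ded \<Gamma> \<Delta> p"
  shows "ded \<Gamma> \<Delta> (Exists x p)"
proof (rule ded_impI, rule ded_mp)
  show "ded \<Gamma> (insert (Forall x (\<^bold>\<not> p)) \<Delta>) (\<^bold>\<not> p)"
    by (rule ded_spec, rule ded_insert)
  show "ded \<Gamma> (insert (Forall x (\<^bold>\<not> p)) \<Delta>) p"
    using assms by (rule ded_mono) auto
qed

lemma ded_exE:
  assumes "ded \<Gamma> \<Delta> (Exists x p)" "ded \<Gamma> (insert p \<Delta>) q"
    and "x \<notin> fv q" "\<And>r. r \<in> \<Delta> \<Longrightarrow> x \<notin> fv r"
  shows "ded \<Gamma> \<Delta> q"
proof (rule ded_ccontr, rule ded_mp)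
  let ?D = "insert (\<^bold>\<not> q) \<Delta>"
  show "ded \<Gamma> ?D (Exists x p)"
    using assms(1) by (rule ded_mono) auto
  have "ded \<Gamma> (insert p ?D) q"
    using assms(2) by (rule ded_mono) auto
  then have "ded \<Gamma> ?D (\<^bold>\<not> p)"
    by (intro ded_impI) (rule ded_mp[OF ded_hyp], auto)
  then show "ded \<Gamma> ?D (Forall x (\<^bold>\<not> p))"
    by (rule ded_allI) (use assms(3,4) in auto)
qed

lemma ded_exSE:
  assumes "ded \<Gamma> \<Delta> (ExistsS X p)" "ded \<Gamma> (insert p \<Delta>) q"
    and "X \<notin> fvS q" "\<And>r. r \<in> \<Delta> \<Longrightarrow> X \<notin> fvS r"
  shows "ded \<Gamma> \<Delta> q"
proof (rule ded_ccontr, rule ded_mp)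
  let ?D = "insert (\<^bold>\<not> q) \<Delta>"
  show "ded \<Gamma> ?D (ExistsS X p)"
    using assms(1) by (rule ded_mono) auto
  have "ded \<Gamma> (insert p ?D) q"
    using assms(2) by (rule ded_mono) auto
  then have "ded \<Gamma> ?D (\<^bold>\<not> p)"
    by (intro ded_impI) (rule ded_mp[OF ded_hyp], auto)
  then show "ded \<Gamma> ?D (ForallS X (\<^bold>\<not> p))"
    by (rule ded_allSI) (use assms(3,4) in auto)
qed

lemma ded_eq_refl: "ded \<Gamma> \<Delta> (t \<^bold>= t)"
  by (rule ded_logical[OF logical_axiom.intros(8)])

lemma ded_eq_mem: "ded \<Gamma> \<Delta> (s \<^bold>= t) \<Longrightarrow> ded \<Gamma> \<Delta> (s \<^bold>\<in> X) \<Longrightarrow> ded \<Gamma> \<Delta> (t \<^bold>\<in> X)"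
  using ded_mp[OF ded_mp[OF ded_logical[OF logical_axiom.intros(9)[of 0 s "Var 0 \<^bold>\<in> X" t]]], of \<Gamma> \<Delta>]
  by simp

lemma ded_eq_sym: "ded \<Gamma> \<Delta> (s \<^bold>= t) \<Longrightarrow> ded \<Gamma> \<Delta> (t \<^bold>= s)"
proof -
  assume st: "ded \<Gamma> \<Delta> (s \<^bold>= t)"
  obtain z where z: "z \<notin> fv_tm s"
    using fv_tm_fresh[of "fresh_tm s" s] by blast
  have "logical_axiom (s \<^bold>= t \<^bold>\<longrightarrow> (s \<^bold>= s \<^bold>\<longrightarrow> t \<^bold>= s))"
    using logical_axiom.intros(9)[of z s "Var z \<^bold>= s" t] z by (simp add: subst_tm_idle)
  from ded_mp[OF ded_mp[OF ded_logical[OF this] st] ded_eq_refl] show ?thesis .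
qed

fun Imps :: "fm list \<Rightarrow> fm \<Rightarrow> fm" where
  "Imps [] q = q"
| "Imps (p # ps) q = (p \<^bold>\<longrightarrow> Imps ps q)"

lemma sat_Imps [simp]: "sat e E (Imps ps q) \<longleftrightarrow> ((\<forall>p\<in>set ps. sat e E p) \<longrightarrow> sat e E q)"
  by (induction ps) auto

lemma ded_Imps: "ded \<Gamma> \<Delta> (Imps ps q) \<Longrightarrow> (\<And>p. p \<in> set ps \<Longrightarrow> ded \<Gamma> \<Delta> p) \<Longrightarrow> ded \<Gamma> \<Delta> q"
  by (induction ps) (auto intro: ded_mp)

lemma ded_ImpsI: "ded \<Gamma> (\<Delta> \<union> set ps) q \<Longrightarrow> ded \<Gamma> \<Delta> (Imps ps q)"
  by (induction ps arbitrary: \<Delta>) (auto intro!: ded_impI)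

primrec closure :: "nat \<Rightarrow> fm \<Rightarrow> fm" where
  "closure 0 p = p"
| "closure (Suc n) p = Forall n (closure n p)"

lemma ded_closureE: "ded \<Gamma> \<Delta> (closure n p) \<Longrightarrow> ded \<Gamma> \<Delta> p"
  by (induction n) (auto intro: ded_spec)

lemma ded_closureI: "ded \<Gamma> \<Delta> p \<Longrightarrow> (\<And>q. q \<in> \<Delta> \<Longrightarrow> fv q = {}) \<Longrightarrow> ded \<Gamma> \<Delta> (closure n p)"
  by (induction n) (auto intro: ded_allI)

lemma fv_closure: "fv (closure n p) = fv p - {..<n}"
  by (induction n) (auto simp: lessThan_Suc)

lemma closed_closure: "fresh p \<le> n \<Longrightarrow> fv (closure n p) = {}"
  by (auto simp: fv_closure dest!: fv_fresh)

section \<open>The sentence that there is no refutation\<close>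

text \<open>Such formulas have the same truth value for all sets. Everything in the clauses below
  except the membership atoms and their logical combinations is of this kind.\<close>

definition numeric :: "fm \<Rightarrow> bool" where
  "numeric p \<longleftrightarrow> arithmetical p \<and> fvS p = {}"

lemma numeric_simps [simp]:
  "numeric (s \<^bold>= t)" "numeric (s \<^bold>< t)" "\<not> numeric (t \<^bold>\<in> X)" "numeric Fls"
  "numeric (p \<^bold>\<longrightarrow> q) \<longleftrightarrow> numeric p \<and> numeric q"
  "numeric (Forall x p) \<longleftrightarrow> numeric p" "\<not> numeric (ForallS X p)"
  by (auto simp: numeric_def)

lemma numeric_Conjs [simp]: "numeric (Conjs ps) \<longleftrightarrow> (\<forall>p\<in>set ps. numeric p)"
  by (induction ps) auto

lemma numeric_Disjs [simp]: "numeric (Disjs ps) \<longleftrightarrow> (\<forall>p\<in>set ps. numeric p)"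
  by (induction ps) auto

lemma numeric_ExistsLes [simp]: "numeric (ExistsLes x n t p) \<longleftrightarrow> numeric p"
  by (induction n arbitrary: x) auto

lemma numeric_beta_fm [simp]: "numeric (beta_fm k a m i z)"
  by (simp add: beta_fm_def Let_def)

lemma numeric_derivation:
  assumes "\<And>n F z. (\<And>j u. numeric (F j u)) \<Longrightarrow> numeric (R n F z)"
  shows "numeric (derivation k a m l c R)"
  unfolding derivation_def by (simp add: assms)

lemma numeric_derivable:
  assumes "\<And>n F z. (\<And>j u. numeric (F j u)) \<Longrightarrow> numeric (R n F z)"
  shows "numeric (derivable k b c R)"
  unfolding derivable_def by (simp add: assms numeric_derivation)

lemma numeric_tm_over:
  assumes "\<And>x. numeric (V x)"
  shows "numeric (tm_over V k b t)"
  unfolding tm_over_def by (rule numeric_derivable) (simp add: Let_def assms)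

lemma numeric_tm_codes [simp]: "numeric (is_tm k b t)" "numeric (tm_avoids k b v t)"
  by (simp_all add: is_tm_def tm_avoids_def numeric_tm_over)

lemma numeric_fm_over:
  assumes "\<And>n x. numeric (TM n b x)" "\<And>x. numeric (SV x)"
    and "\<And>n F x q. (\<And>j u. numeric (F j u)) \<Longrightarrow> numeric (Q n F x q)"
    and "\<And>n F x q. (\<And>j u. numeric (F j u)) \<Longrightarrow> numeric (QS n F x q)"
  shows "numeric (fm_over TM SV Q QS k b p)"
  unfolding fm_over_def by (rule numeric_derivable) (simp add: Let_def assms)

lemma numeric_fm_codes [simp]:
  "numeric (is_fm k b p)" "numeric (is_arithmetical k b p)"
  by (simp_all add: is_fm_def is_arithmetical_def numeric_fm_over)

lemma numeric_not_free [simp]: "numeric (not_free k b v p)" "numeric (not_freeS k b v p)"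
  by (simp_all add: not_free_def not_freeS_def numeric_fm_over)

lemma numeric_is_subst_tm [simp]: "numeric (is_subst_tm k b v t u u')"
  unfolding is_subst_tm_def by (rule numeric_derivable) (simp add: Let_def)

lemma numeric_is_subst [simp]: "numeric (is_subst k b v t u u')"
  unfolding is_subst_def by (rule numeric_derivable) (simp add: Let_def)

lemma numeric_is_substS [simp]: "numeric (is_substS k b v t u u')"
  unfolding is_substS_def by (rule numeric_derivable) (simp add: Let_def)

lemma numeric_is_logical_axiom [simp]: "numeric (is_logical_axiom k b z)"
  unfolding is_logical_axiom_def by (simp add: Let_def)

lemma numeric_delta0: "delta0 p \<Longrightarrow> numeric p"
  by (induction rule: delta0.induct) auto

lemma numeric_bound_witnesses: "sigma1 p \<Longrightarrow> numeric (bound_witnesses b p)"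
  by (induction rule: sigma1.induct) (auto simp: delta0_bound_witnesses numeric_delta0 dest: numeric_delta0)

lemma numeric_subst [simp]: "numeric (subst x t p) \<longleftrightarrow> numeric p"
  by (induction p) auto

lemma numeric_Pr_fm: "sigma1 T \<Longrightarrow> numeric (Pr_fm T k y)"
  unfolding Pr_fm_def Prf_fm_def by (simp add: Let_def numeric_bound_witnesses numeric_derivation)

lemma numeric_is_pi11_sentence [simp]: "numeric (is_pi11_sentence k y)"
  unfolding is_pi11_sentence_def by (simp add: Let_def)

lemma numeric_is_value [simp]: "numeric (is_value k a m t n)"
  unfolding is_value_def Let_def by (simp, rule numeric_derivable) simp

lemma numeric_is_variant [simp]: "numeric (is_variant k t v a m a' m')"
  unfolding is_variant_def by simp

lemma numericD: "numeric p \<Longrightarrow> fvS p = {}" "numeric p \<Longrightarrow> arithmetical p"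
  by (simp_all add: numeric_def)

lemma substS_numeric: "numeric p \<Longrightarrow> substS X Y p = p"
  by (simp add: numeric_def substS_idle)

primrec subfms :: "fm \<Rightarrow> fm set" where
  "subfms (s \<^bold>= t) = {s \<^bold>= t}"
| "subfms (s \<^bold>< t) = {s \<^bold>< t}"
| "subfms (t \<^bold>\<in> X) = {t \<^bold>\<in> X}"
| "subfms Fls = {Fls}"
| "subfms (p \<^bold>\<longrightarrow> q) = insert (p \<^bold>\<longrightarrow> q) (subfms p \<union> subfms q)"
| "subfms (Forall x p) = insert (Forall x p) (subfms p)"
| "subfms (ForallS X p) = insert (ForallS X p) (subfms p)"

lemma subfms_refl [simp]: "p \<in> subfms p"
  by (cases p) auto

lemma fresh_subfms: "q \<in> subfms p \<Longrightarrow> fresh q \<le> fresh p"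
  by (induction p) auto

section \<open>The clauses satisfied by a refutation\<close>

definition holds :: "tm \<Rightarrow> tm \<Rightarrow> tm \<Rightarrow> tm" where
  "holds q a m = cPair q (cPair a m)"

text \<open>The set \<open>X\<close> is coded in a set \<open>Z\<close> by the pairs \<open>\<langle>2, i\<rangle>\<close> with \<open>i \<in> X\<close>, and the formula to be
  refuted is marked by a pair \<open>\<langle>1, t\<rangle>\<close>. These are never codes of formulas.\<close>

definition mark :: "tm \<Rightarrow> tm" where
  "mark t = cPair One t"

definition elem :: "tm \<Rightarrow> tm" where
  "elem i = cPair (One \<^bold>+ One) i"

locale refutation =
  fixes T :: fm
begin

abbreviation (input) "k \<equiv> fresh T"
abbreviation (input) "N \<equiv> fresh (RFN T)"
abbreviation (input) "Y \<equiv> Var k"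
abbreviation (input) "V \<equiv> Var (k + 1)"
abbreviation (input) "t \<equiv> Var (k + 2)"
abbreviation (input) "p \<equiv> Var (k + 3)"
abbreviation (input) "a \<equiv> Var (k + 4)"
abbreviation (input) "m \<equiv> Var (k + 5)"
abbreviation (input) "x \<equiv> Var (k + 6)"
abbreviation (input) "y \<equiv> Var (k + 7)"
abbreviation (input) "i \<equiv> Var (k + 8)"
abbreviation (input) "j \<equiv> Var (k + 9)"
abbreviation (input) "c \<equiv> Var N"
abbreviation (input) "d \<equiv> Var (N + 1)"
abbreviation (input) "d' \<equiv> Var (N + 2)"
abbreviation (input) "s \<equiv> Var (N + 3)"

text \<open>In all atomic formulas \<open>u \<in> Z\<close> below (where \<open>Z\<close> is the set variable \<open>1\<close>) the term \<open>u\<close> is a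
  variable, so that evaluating the formula under an assignment coded by a number \<open>n\<close> only depends on
  \<open>Z\<close> below \<open>n\<close>.\<close>

definition guards :: "fm list" where
  "guards = [s \<^bold>= mark t, s \<^bold>\<in> 1, p \<^bold>\<in> 1, p \<^bold>= cForall x y, c \<^bold>= holds p a m]"

definition all_variants_body :: fm where
  "all_variants_body =
     Imps (guards @ [is_variant (k + 10) t x a m i j, d \<^bold>= holds y i j]) (d \<^bold>\<in> 1)"

definition all_variants :: fm where
  "all_variants = Forall (N + 1) (Forall (k + 8) (Forall (k + 9) all_variants_body))"

definition "eq_clause = Imps [c \<^bold>= holds p a m, p \<^bold>\<in> 1, p \<^bold>= cEq x y]
  (c \<^bold>\<in> 1 \<^bold>\<longleftrightarrow> Exists (k + 8) (is_value (k + 10) a m x i \<^bold>\<and> is_value (k + 10) a m y i))"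
definition "lt_clause = Imps [c \<^bold>= holds p a m, p \<^bold>\<in> 1, p \<^bold>= cLt x y]
  (c \<^bold>\<in> 1 \<^bold>\<longleftrightarrow> Exists (k + 8) (Exists (k + 9)
    (Conjs [is_value (k + 10) a m x i, is_value (k + 10) a m y j, i \<^bold>< j])))"
definition "value_clause = Imps [p \<^bold>\<in> 1, p \<^bold>= cMem x y] (Exists (k + 8) (is_value (k + 10) a m x i))"
definition "mem_clause =
  Imps [c \<^bold>= holds p a m, d \<^bold>= elem i, p \<^bold>\<in> 1, p \<^bold>= cMem x y, is_value (k + 10) a m x i] (c \<^bold>\<in> 1 \<^bold>\<longleftrightarrow> d \<^bold>\<in> 1)"
definition "fls_clause = Imps [c \<^bold>= holds p a m, p \<^bold>\<in> 1, p \<^bold>= cFls] (\<^bold>\<not> c \<^bold>\<in> 1)"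
definition "imp_sub_clause = Imps [p \<^bold>\<in> 1, p \<^bold>= cImp x y] (x \<^bold>\<in> 1 \<^bold>\<and> y \<^bold>\<in> 1)"
definition "imp_clause =
  Imps [c \<^bold>= holds p a m, d \<^bold>= holds x a m, d' \<^bold>= holds y a m, p \<^bold>\<in> 1, p \<^bold>= cImp x y]
    (c \<^bold>\<in> 1 \<^bold>\<longleftrightarrow> (d \<^bold>\<in> 1 \<^bold>\<longrightarrow> d' \<^bold>\<in> 1))"
definition "all_sub_clause = Imps [p \<^bold>\<in> 1, p \<^bold>= cForall x y] (y \<^bold>\<in> 1)"
definition "all_clause = Imps guards (c \<^bold>\<in> 1 \<^bold>\<longleftrightarrow> all_variants)"
definition "mark_clause = Imps [s \<^bold>= mark t, s \<^bold>\<in> 1] (t \<^bold>\<in> 1)"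
text \<open>The term is \<open>holds t p a\<close> because \<open>Tr_fm\<close> uses the variables
  \<open>k + 3\<close> and \<open>k + 4\<close>, here called \<open>p\<close> and \<open>a\<close>,
  for the two halves of the assignment.\<close>

definition "refute_clause = Imps [s \<^bold>= mark t, s \<^bold>\<in> 1, c \<^bold>= holds t p a] (\<^bold>\<not> c \<^bold>\<in> 1)"

lemmas clause_defs = eq_clause_def lt_clause_def value_clause_def mem_clause_def fls_clause_def
  imp_sub_clause_def imp_clause_def all_sub_clause_def mark_clause_def refute_clause_def

definition clauses :: "fm list" where
  "clauses = [eq_clause, lt_clause, value_clause, mem_clause, fls_clause, imp_sub_clause, imp_clause,
     all_sub_clause, all_clause, mark_clause, refute_clause]"

definition premise :: fm where
  "premise = (is_pi11_sentence (k + 1) Y \<^bold>\<and> Pr_fm T (k + 1) Y)"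

text \<open>The position \<open>s\<close> stays free here, and no other variable occurs in a
  membership atom. So this formula can be evaluated with a single bit, and only the outer quantifier
  over \<open>s\<close> is problematic.\<close>

definition no_mark_body :: fm where
  "no_mark_body =
     Forall (k + 2) (Forall k (Forall (k + 1)
       (Imps [s \<^bold>\<in> 1, s \<^bold>= mark t, premise, Y \<^bold>= cForallS V t] Fls)))"

definition no_mark :: fm where
  "no_mark = Forall (N + 3) no_mark_body"

text \<open>The matrix says that \<open>Z\<close> does not refute the truth of any \<open>\<Pi>\<^sup>1\<^sub>1\<close> theorem of \<open>T\<close>.\<close>

definition matrix :: fm where
  "matrix = Imps (map (closure (N + 4)) clauses) (closure (N + 4) no_mark)"

definition hyps :: "fm set" where
  "hyps = set (map (closure (N + 4)) clauses)"

text \<open>All bounds on variables are obtained by finding the formula inside \<open>RFN T\<close>,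
  which avoids computing the variables bound by \<open>is_value\<close> and the like.\<close>

lemma fresh_sat_class:
  assumes "q \<in> subfms (is_sat_class (k + 3) t)"
  shows "fresh q \<le> N"
proof (rule order.trans[OF fresh_subfms[OF assms]])
  show "fresh (is_sat_class (k + 3) t) \<le> N"
    by (rule fresh_subfms) (simp add: RFN_def Tr_fm_def Let_def numeral_eq_Suc)
qed

lemma fresh_bounds:
  "k + 10 \<le> N"
  "fresh (is_value (k + 10) a m x i) \<le> N"
  "fresh (is_value (k + 10) a m y i) \<le> N"
  "fresh (is_value (k + 10) a m y j) \<le> N"
  "fresh (is_variant (k + 10) t x a m i j) \<le> N"
  "fresh premise \<le> N"
proof -
  have "fresh (i \<^bold>< j) \<le> N"
    by (rule fresh_sat_class) (simp add: is_sat_class_def Let_def numeral_eq_Suc)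
  then show "k + 10 \<le> N" by simp
  show "fresh premise \<le> N"
    by (rule fresh_subfms) (simp add: RFN_def premise_def Let_def)
qed (rule fresh_sat_class, simp add: is_sat_class_def Let_def numeral_eq_Suc)+

lemma fresh_clauses: "q \<in> set clauses \<Longrightarrow> fresh q \<le> N + 4"
  using fresh_bounds
  by (auto simp: clauses_def clause_defs all_clause_def guards_def all_variants_def all_variants_body_def
    holds_def mark_def elem_def)

lemma fv_hyps: "q \<in> hyps \<Longrightarrow> fv q = {}"
  by (auto simp: hyps_def closed_closure fresh_clauses)

lemma fresh_no_mark: "fresh no_mark \<le> N + 4"
  using fresh_bounds by (simp add: no_mark_def no_mark_body_def mark_def)

text \<open>Closing \<open>no_mark\<close> once more in \<open>matrix\<close> lets closedness follow
  from \<open>fresh\<close> alone, without a computation of the free variables of the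
  premise.\<close>

lemma fv_matrix: "fv matrix = {}"
proof -
  have "fv (Imps ps q) = \<Union> (fv ` set ps) \<union> fv q" for ps q
    by (induction ps) auto
  then show ?thesis
    by (simp add: matrix_def closed_closure fresh_clauses fresh_no_mark)
qed

end

section \<open>Deriving the matrix from reflection\<close>

lemma fv_tm_num [simp]: "fv_tm (num n) = {}"
  by (induction n) auto

lemma subst_tm_num [simp]: "subst_tm z u (num n) = num n"
  by (induction n) auto

lemma fv_tm_codes [simp]:
  "fv_tm (cPair r r') = fv_tm r \<union> fv_tm r'"
  "fv_tm (cEq r r') = fv_tm r \<union> fv_tm r'"
  "fv_tm (cLt r r') = fv_tm r \<union> fv_tm r'"
  "fv_tm (cMem r r') = fv_tm r \<union> fv_tm r'"
  "fv_tm cFls = {}"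
  "fv_tm (cImp r r') = fv_tm r \<union> fv_tm r'"
  "fv_tm (cForall r r') = fv_tm r \<union> fv_tm r'"
  "fv_tm (cForallS r r') = fv_tm r \<union> fv_tm r'"
  "fv_tm (mark r) = fv_tm r"
  "fv_tm (elem r) = fv_tm r"
  "fv_tm (holds r r' r'') = fv_tm r \<union> (fv_tm r' \<union> fv_tm r'')"
  by (auto simp: code_defs mark_def elem_def holds_def cPair_def simp del: num.simps)

lemma subst_tm_codes [simp]:
  "subst_tm z u (cEq r r') = cEq (subst_tm z u r) (subst_tm z u r')"
  "subst_tm z u (cLt r r') = cLt (subst_tm z u r) (subst_tm z u r')"
  "subst_tm z u (cMem r r') = cMem (subst_tm z u r) (subst_tm z u r')"
  "subst_tm z u cFls = cFls"
  "subst_tm z u (cImp r r') = cImp (subst_tm z u r) (subst_tm z u r')"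
  "subst_tm z u (cForall r r') = cForall (subst_tm z u r) (subst_tm z u r')"
  "subst_tm z u (mark r) = mark (subst_tm z u r)"
  "subst_tm z u (elem r) = elem (subst_tm z u r)"
  "subst_tm z u (holds r r' r'') = holds (subst_tm z u r) (subst_tm z u r') (subst_tm z u r'')"
  by (auto simp: code_defs mark_def elem_def holds_def cPair_def simp del: num.simps)

lemma subst_Imps [simp]: "subst z u (Imps ps q) = Imps (map (subst z u) ps) (subst z u q)"
  by (induction ps) auto

lemma free_for_Imps [simp]: "free_for z u (Imps ps q) \<longleftrightarrow> (\<forall>p\<in>set ps. free_for z u p) \<and> free_for z u q"
  by (induction ps) auto

lemma fv_Imps [simp]: "fv (Imps ps q) = \<Union> (fv ` set ps) \<union> fv q"
  by (induction ps) auto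

lemma free_for_idle: "z \<notin> fv p \<Longrightarrow> free_for z u p"
  by (induction p) auto

lemma notin_fv_fresh: "fresh p \<le> z \<Longrightarrow> z \<notin> fv p"
  using fv_fresh by fastforce

lemma ded_subst:
  assumes "ded \<Gamma> \<Delta> p" "\<And>q. q \<in> \<Delta> \<Longrightarrow> z \<notin> fv q" "free_for z u p"
  shows "ded \<Gamma> \<Delta> (subst z u p)"
  using assms by (intro ded_allE ded_allI)

lemma ded_ConjsI: "list_all (ded \<Gamma> \<Delta>) ps \<Longrightarrow> ded \<Gamma> \<Delta> (Conjs ps)"
  by (induction ps) (auto intro: ded_refl ded_conjI)

context refutation
begin

lemma ded_clause: "q \<in> set clauses \<Longrightarrow> ded \<Gamma> hyps q"
  by (rule ded_closureE[of _ _ "N + 4"], rule ded_hyp) (simp add: hyps_def)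

lemma fresh_pure:
  assumes "z \<ge> N"
  shows "subst z u (is_value (k + 10) a m x i) = is_value (k + 10) a m x i"
    "subst z u (is_value (k + 10) a m y i) = is_value (k + 10) a m y i"
    "subst z u (is_value (k + 10) a m y j) = is_value (k + 10) a m y j"
    "subst z u (is_variant (k + 10) t x a m i j) = is_variant (k + 10) t x a m i j"
    "free_for z u (is_value (k + 10) a m x i)"
    "free_for z u (is_value (k + 10) a m y i)"
    "free_for z u (is_value (k + 10) a m y j)"
    "free_for z u (is_variant (k + 10) t x a m i j)"
    "z \<notin> fv (is_value (k + 10) a m x i)"
    "z \<notin> fv (is_variant (k + 10) t x a m i j)"
  using assms fresh_bounds(1-5)[THEN order.trans, OF assms]
  by (simp_all add: subst_idle free_for_idle notin_fv_fresh)

lemmas pure_simps = fresh_pure[unfolded add_2_eq_Suc'] fresh_pure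

lemma ded_clause_subst:
  assumes "q \<in> set clauses" "free_for z u q"
  shows "ded \<Gamma> hyps (subst z u q)"
  using assms fv_hyps by (intro ded_subst ded_clause) auto

lemma ded_clause_subst2:
  assumes "q \<in> set clauses" "free_for z u q" "free_for z' u' (subst z u q)"
  shows "ded \<Gamma> hyps (subst z' u' (subst z u q))"
  using assms fv_hyps by (intro ded_subst[OF ded_clause_subst]) auto

lemma ded_clause_subst3:
  assumes "q \<in> set clauses" "free_for z u q" "free_for z' u' (subst z u q)"
    "free_for z'' u'' (subst z' u' (subst z u q))"
  shows "ded \<Gamma> hyps (subst z'' u'' (subst z' u' (subst z u q)))"
  using assms fv_hyps by (intro ded_subst[OF ded_clause_subst2]) auto

abbreviation (input) "h \<equiv> holds p a m"

text \<open>Once the position variables are instantiated by the terms that they stand for, the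
  flattened clauses turn back into the clauses of \<open>is_sat_class\<close>, up to trivial
  equations among the antecedents. Only in the ninth does the position variable \<open>d\<close>
  remain, being bound there.\<close>

lemma instances:
  "ded \<Gamma> hyps (Imps [h \<^bold>= h, p \<^bold>\<in> 1, p \<^bold>= cEq x y]
    (h \<^bold>\<in> 1 \<^bold>\<longleftrightarrow> Exists (k + 8) (is_value (k + 10) a m x i \<^bold>\<and> is_value (k + 10) a m y i)))"
  "ded \<Gamma> hyps (Imps [h \<^bold>= h, p \<^bold>\<in> 1, p \<^bold>= cLt x y]
    (h \<^bold>\<in> 1 \<^bold>\<longleftrightarrow> Exists (k + 8) (Exists (k + 9)
      (Conjs [is_value (k + 10) a m x i, is_value (k + 10) a m y j, i \<^bold>< j]))))"
  "ded \<Gamma> hyps (Imps [p \<^bold>\<in> 1, p \<^bold>= cMem x y] (Exists (k + 8) (is_value (k + 10) a m x i)))"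
  "ded \<Gamma> hyps (Imps [h \<^bold>= h, elem i \<^bold>= elem i, p \<^bold>\<in> 1, p \<^bold>= cMem x y, is_value (k + 10) a m x i]
    (h \<^bold>\<in> 1 \<^bold>\<longleftrightarrow> elem i \<^bold>\<in> 1))"
  "ded \<Gamma> hyps (Imps [h \<^bold>= h, p \<^bold>\<in> 1, p \<^bold>= cFls] (\<^bold>\<not> h \<^bold>\<in> 1))"
  "ded \<Gamma> hyps (Imps [p \<^bold>\<in> 1, p \<^bold>= cImp x y] (x \<^bold>\<in> 1 \<^bold>\<and> y \<^bold>\<in> 1))"
  "ded \<Gamma> hyps (Imps [h \<^bold>= h, holds x a m \<^bold>= holds x a m, holds y a m \<^bold>= holds y a m, p \<^bold>\<in> 1, p \<^bold>= cImp x y]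
    (h \<^bold>\<in> 1 \<^bold>\<longleftrightarrow> (holds x a m \<^bold>\<in> 1 \<^bold>\<longrightarrow> holds y a m \<^bold>\<in> 1)))"
  "ded \<Gamma> hyps (Imps [p \<^bold>\<in> 1, p \<^bold>= cForall x y] (y \<^bold>\<in> 1))"
  "ded \<Gamma> hyps (Imps [mark t \<^bold>= mark t, mark t \<^bold>\<in> 1, p \<^bold>\<in> 1, p \<^bold>= cForall x y, h \<^bold>= h]
    (h \<^bold>\<in> 1 \<^bold>\<longleftrightarrow> Forall (N + 1) (Forall (k + 8) (Forall (k + 9)
      (Imps [mark t \<^bold>= mark t, mark t \<^bold>\<in> 1, p \<^bold>\<in> 1, p \<^bold>= cForall x y, h \<^bold>= h,
         is_variant (k + 10) t x a m i j, d \<^bold>= holds y i j] (d \<^bold>\<in> 1))))))"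
  "ded \<Gamma> hyps (Imps [mark t \<^bold>= mark t, mark t \<^bold>\<in> 1] (t \<^bold>\<in> 1))"
  "ded \<Gamma> hyps (Imps [mark t \<^bold>= mark t, mark t \<^bold>\<in> 1, holds t p a \<^bold>= holds t p a] (\<^bold>\<not> holds t p a \<^bold>\<in> 1))"
  subgoal using fresh_bounds(1) ded_clause_subst[of eq_clause N h] by (simp add: clauses_def eq_clause_def pure_simps)
  subgoal using fresh_bounds(1) ded_clause_subst[of lt_clause N h] by (simp add: clauses_def lt_clause_def pure_simps)
  subgoal using fresh_bounds(1) ded_clause[of value_clause] by (simp add: clauses_def value_clause_def)
  subgoal using fresh_bounds(1) ded_clause_subst2[of mem_clause N h "N + 1" "elem i"]
    by (simp add: clauses_def mem_clause_def pure_simps)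
  subgoal using fresh_bounds(1) ded_clause_subst[of fls_clause N h] by (simp add: clauses_def fls_clause_def pure_simps)
  subgoal using fresh_bounds(1) ded_clause[of imp_sub_clause] by (simp add: clauses_def imp_sub_clause_def)
  subgoal using fresh_bounds(1) ded_clause_subst3[of imp_clause N h "N + 1" "holds x a m" "N + 2" "holds y a m"]
    by (simp add: clauses_def imp_clause_def pure_simps)
  subgoal using fresh_bounds(1) ded_clause[of all_sub_clause] by (simp add: clauses_def all_sub_clause_def)
  subgoal using fresh_bounds(1) ded_clause_subst2[of all_clause N h "N + 3" "mark t"]
    by (simp add: clauses_def all_clause_def guards_def all_variants_def all_variants_body_def pure_simps)
  subgoal using fresh_bounds(1) ded_clause_subst[of mark_clause "N + 3" "mark t"]
    by (simp add: clauses_def mark_clause_def pure_simps)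
  subgoal using fresh_bounds(1) ded_clause_subst2[of refute_clause N "holds t p a" "N + 3" "mark t"]
    by (simp add: clauses_def refute_clause_def pure_simps)
  done

abbreviation (input) "decoding \<equiv> Forall (k + 8) (i \<^bold>\<in> 0 \<^bold>\<longleftrightarrow> elem i \<^bold>\<in> 1)"

abbreviation (input) "ctx \<equiv> insert (mark t \<^bold>\<in> 1) (insert decoding hyps)"

lemma ded_sub_clauses:
  assumes "hyps \<subseteq> \<Delta>" "(p \<^bold>\<in> 1) \<in> \<Delta>"
  shows "(p \<^bold>= cEq x y) \<in> \<Delta> \<Longrightarrow> ded \<Gamma> \<Delta>
      (h \<^bold>\<in> 1 \<^bold>\<longleftrightarrow> Exists (k + 8) (is_value (k + 10) a m x i \<^bold>\<and> is_value (k + 10) a m y i))"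
    and "(p \<^bold>= cLt x y) \<in> \<Delta> \<Longrightarrow> ded \<Gamma> \<Delta> (h \<^bold>\<in> 1 \<^bold>\<longleftrightarrow> Exists (k + 8) (Exists (k + 9)
      (Conjs [is_value (k + 10) a m x i, is_value (k + 10) a m y j, i \<^bold>< j])))"
    and "(p \<^bold>= cMem x y) \<in> \<Delta> \<Longrightarrow> ded \<Gamma> \<Delta> (Exists (k + 8) (is_value (k + 10) a m x i))"
    and "(p \<^bold>= cMem x y) \<in> \<Delta> \<Longrightarrow> is_value (k + 10) a m x i \<in> \<Delta> \<Longrightarrow>
      ded \<Gamma> \<Delta> (h \<^bold>\<in> 1 \<^bold>\<longleftrightarrow> elem i \<^bold>\<in> 1)"
    and "(p \<^bold>= cFls) \<in> \<Delta> \<Longrightarrow> ded \<Gamma> \<Delta> (\<^bold>\<not> h \<^bold>\<in> 1)"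
    and "(p \<^bold>= cImp x y) \<in> \<Delta> \<Longrightarrow> ded \<Gamma> \<Delta> (x \<^bold>\<in> 1 \<^bold>\<and> y \<^bold>\<in> 1)"
    and "(p \<^bold>= cImp x y) \<in> \<Delta> \<Longrightarrow>
      ded \<Gamma> \<Delta> (h \<^bold>\<in> 1 \<^bold>\<longleftrightarrow> (holds x a m \<^bold>\<in> 1 \<^bold>\<longrightarrow> holds y a m \<^bold>\<in> 1))"
    and "(p \<^bold>= cForall x y) \<in> \<Delta> \<Longrightarrow> ded \<Gamma> \<Delta> (y \<^bold>\<in> 1)"
  subgoal by (rule ded_Imps[OF ded_mono[OF instances(1)]]; use assms in \<open>auto intro: ded_hyp ded_eq_refl\<close>)
  subgoal by (rule ded_Imps[OF ded_mono[OF instances(2)]]; use assms in \<open>auto intro: ded_hyp ded_eq_refl\<close>)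
  subgoal by (rule ded_Imps[OF ded_mono[OF instances(3)]]; use assms in \<open>auto intro: ded_hyp ded_eq_refl\<close>)
  subgoal by (rule ded_Imps[OF ded_mono[OF instances(4)]]; use assms in \<open>auto intro: ded_hyp ded_eq_refl\<close>)
  subgoal by (rule ded_Imps[OF ded_mono[OF instances(5)]]; use assms in \<open>auto intro: ded_hyp ded_eq_refl\<close>)
  subgoal by (rule ded_Imps[OF ded_mono[OF instances(6)]]; use assms in \<open>auto intro: ded_hyp ded_eq_refl\<close>)
  subgoal by (rule ded_Imps[OF ded_mono[OF instances(7)]]; use assms in \<open>auto intro: ded_hyp ded_eq_refl\<close>)
  subgoal by (rule ded_Imps[OF ded_mono[OF instances(8)]]; use assms in \<open>auto intro: ded_hyp ded_eq_refl\<close>)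
  done

text \<open>The two halves of the split clause for membership are recombined, and
  \<open>decoding\<close> translates between \<open>X\<close> and its code in
  \<open>Z\<close>.\<close>

lemma ded_mem_case:
  assumes \<Delta>: "\<Delta> = insert (p \<^bold>= cMem x y) (insert (p \<^bold>\<in> 1) ctx)"
  shows "ded \<Gamma> \<Delta> (h \<^bold>\<in> 1 \<^bold>\<longleftrightarrow> Exists (k + 8) (is_value (k + 10) a m x i \<^bold>\<and> i \<^bold>\<in> 0))"
proof (rule ded_iffI)
  let ?v = "is_value (k + 10) a m x i"
  have fv: "k + 8 \<notin> fv q" if "q \<in> insert (h \<^bold>\<in> 1) \<Delta>" for q
    using that unfolding \<Delta> by (auto dest: fv_hyps)
  have elem: "ded \<Gamma> \<Delta>' (i \<^bold>\<in> 0 \<^bold>\<longleftrightarrow> elem i \<^bold>\<in> 1)" if "\<Delta> \<subseteq> \<Delta>'" for \<Delta>'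
    by (rule ded_spec[of _ _ "k + 8"], rule ded_hyp) (use that \<Delta> in auto)
  have hol: "ded \<Gamma> \<Delta>' (h \<^bold>\<in> 1 \<^bold>\<longleftrightarrow> elem i \<^bold>\<in> 1)" if "insert ?v \<Delta> \<subseteq> \<Delta>'" for \<Delta>'
    by (rule ded_sub_clauses(4)) (use that \<Delta> in auto)
  show "ded \<Gamma> (insert (h \<^bold>\<in> 1) \<Delta>) (Exists (k + 8) (?v \<^bold>\<and> i \<^bold>\<in> 0))"
  proof (rule ded_exE)
    show "ded \<Gamma> (insert (h \<^bold>\<in> 1) \<Delta>) (Exists (k + 8) ?v)"
      by (rule ded_sub_clauses(3)) (auto simp: \<Delta>)
    show "ded \<Gamma> (insert ?v (insert (h \<^bold>\<in> 1) \<Delta>)) (Exists (k + 8) (?v \<^bold>\<and> i \<^bold>\<in> 0))"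
    proof (intro ded_exI ded_conjI)
      show "ded \<Gamma> (insert ?v (insert (h \<^bold>\<in> 1) \<Delta>)) (i \<^bold>\<in> 0)"
        by (rule ded_iffD2[OF elem], blast, rule ded_iffD1[OF hol], blast, rule ded_hyp) simp
    qed (rule ded_insert)
  qed (use fv in auto)
  show "ded \<Gamma> (insert (Exists (k + 8) (?v \<^bold>\<and> i \<^bold>\<in> 0)) \<Delta>) (h \<^bold>\<in> 1)"
  proof (rule ded_exE[OF ded_insert])
    let ?\<Delta>' = "insert (?v \<^bold>\<and> i \<^bold>\<in> 0) (insert (Exists (k + 8) (?v \<^bold>\<and> i \<^bold>\<in> 0)) \<Delta>)"
    have "ded \<Gamma> (insert ?v \<Delta>) (elem i \<^bold>\<in> 1 \<^bold>\<longrightarrow> h \<^bold>\<in> 1)"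
      by (rule ded_impI, rule ded_iffD2[OF hol], blast, rule ded_insert)
    then have "ded \<Gamma> \<Delta> (?v \<^bold>\<longrightarrow> elem i \<^bold>\<in> 1 \<^bold>\<longrightarrow> h \<^bold>\<in> 1)"
      by (rule ded_impI)
    then have "ded \<Gamma> ?\<Delta>' (?v \<^bold>\<longrightarrow> elem i \<^bold>\<in> 1 \<^bold>\<longrightarrow> h \<^bold>\<in> 1)"
      by (rule ded_mono) auto
    then show "ded \<Gamma> ?\<Delta>' (h \<^bold>\<in> 1)"
      by (rule ded_mp[OF ded_mp]) (rule ded_conjD1[OF ded_insert],
        rule ded_iffD1[OF elem], blast, rule ded_conjD2[OF ded_insert])
  qed (use fv in auto)
qed

text \<open>The quantified position \<open>d\<close> is eliminated: from left to right it is
  instantiated by \<open>holds y i j\<close>, and from right to left the equation for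
  \<open>d\<close> allows replacement inside the atom. The repeated guards are hypotheses of the
  context.\<close>

lemma ded_all_case:
  assumes \<Delta>: "\<Delta> = insert (p \<^bold>= cForall x y) (insert (p \<^bold>\<in> 1) ctx)"
  shows "ded \<Gamma> \<Delta> (h \<^bold>\<in> 1 \<^bold>\<longleftrightarrow>
    Forall (k + 8) (Forall (k + 9) (is_variant (k + 10) t x a m i j \<^bold>\<longrightarrow> holds y i j \<^bold>\<in> 1)))"
proof (rule ded_iffI)
  let ?v = "is_variant (k + 10) t x a m i j"
  let ?body = "Imps [mark t \<^bold>= mark t, mark t \<^bold>\<in> 1, p \<^bold>\<in> 1, p \<^bold>= cForall x y, h \<^bold>= h,
      ?v, d \<^bold>= holds y i j] (d \<^bold>\<in> 1)"
  let ?all = "Forall (k + 8) (Forall (k + 9) (?v \<^bold>\<longrightarrow> holds y i j \<^bold>\<in> 1))"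
  have iff: "ded \<Gamma> \<Delta>' (h \<^bold>\<in> 1 \<^bold>\<longleftrightarrow> Forall (N + 1) (Forall (k + 8) (Forall (k + 9) ?body)))"
    if "\<Delta> \<subseteq> \<Delta>'" for \<Delta>'
    by (rule ded_Imps[OF ded_mono[OF instances(9)]])
      (use that \<Delta> in \<open>auto intro: ded_hyp ded_eq_refl\<close>)
  have fv: "z \<le> k + 7" if "q \<in> insert (h \<^bold>\<in> 1) \<Delta>" "z \<in> fv q" for q z
    using that unfolding \<Delta> by (auto dest: fv_hyps)
  have notin: "k + 8 \<notin> fv q" "k + 9 \<notin> fv q" "N + 1 \<notin> fv q" if "q \<in> insert (h \<^bold>\<in> 1) \<Delta>" for q
    using fv[OF that, of "k + 8"] fv[OF that, of "k + 9"] fv[OF that, of "N + 1"] fresh_bounds(1) by auto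
  have free: "free_for (N + 1) (holds y i j) ?body"
    using fresh_bounds(1) by (simp add: pure_simps)
  have sub: "subst (N + 1) (holds y i j) ?body =
      Imps [mark t \<^bold>= mark t, mark t \<^bold>\<in> 1, p \<^bold>\<in> 1, p \<^bold>= cForall x y, h \<^bold>= h,
      ?v, holds y i j \<^bold>= holds y i j] (holds y i j \<^bold>\<in> 1)"
    using fresh_bounds(1) by (simp add: pure_simps)
  show "ded \<Gamma> (insert (h \<^bold>\<in> 1) \<Delta>) ?all"
  proof (intro ded_allI ded_impI)
    have "ded \<Gamma> (insert (h \<^bold>\<in> 1) \<Delta>) ?body"
      by (rule ded_spec, rule ded_spec, rule ded_spec, rule ded_iffD1[OF iff], blast, rule ded_insert)
    then have "ded \<Gamma> (insert (h \<^bold>\<in> 1) \<Delta>) (subst (N + 1) (holds y i j) ?body)"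
      by (rule ded_subst) (use notin free in auto)
    then have "ded \<Gamma> (insert ?v (insert (h \<^bold>\<in> 1) \<Delta>)) (subst (N + 1) (holds y i j) ?body)"
      by (rule ded_mono) auto
    then show "ded \<Gamma> (insert ?v (insert (h \<^bold>\<in> 1) \<Delta>)) (holds y i j \<^bold>\<in> 1)"
      unfolding sub by (rule ded_Imps) (use \<Delta> in \<open>auto intro: ded_hyp ded_eq_refl\<close>)
  qed (use notin in auto)
  have "ded \<Gamma> (insert ?all \<Delta> \<union> set [mark t \<^bold>= mark t, mark t \<^bold>\<in> 1, p \<^bold>\<in> 1, p \<^bold>= cForall x y, h \<^bold>= h,
      ?v, d \<^bold>= holds y i j]) (d \<^bold>\<in> 1)" (is "ded _ ?\<Delta>' _")
  proof (rule ded_eq_mem[OF ded_eq_sym])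
    show "ded \<Gamma> ?\<Delta>' (d \<^bold>= holds y i j)"
      by (rule ded_hyp) simp
    have "ded \<Gamma> ?\<Delta>' (?v \<^bold>\<longrightarrow> holds y i j \<^bold>\<in> 1)"
      by (rule ded_spec[of _ _ "k + 9"], rule ded_spec[of _ _ "k + 8"], rule ded_hyp) simp
    then show "ded \<Gamma> ?\<Delta>' (holds y i j \<^bold>\<in> 1)"
      by (rule ded_mp) (rule ded_hyp, simp)
  qed
  then have "ded \<Gamma> (insert ?all \<Delta>) ?body"
    by (rule ded_ImpsI)
  then have "ded \<Gamma> (insert ?all \<Delta>) (Forall (N + 1) (Forall (k + 8) (Forall (k + 9) ?body)))"
    by (intro ded_allI) (use notin fresh_bounds(1) in \<open>auto simp: pure_simps\<close>)
  then show "ded \<Gamma> (insert ?all \<Delta>) (h \<^bold>\<in> 1)"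
    by (rule ded_iffD2[OF iff, rotated]) auto
qed

text \<open>The set variable 1 plays the roles of both \<open>C\<close> and \<open>D\<close>, while
  0 is the set decoded from it.\<close>

lemma ded_sat_class: "ded \<Gamma> ctx (substS 2 1 (is_sat_class (k + 3) t))"
proof -
  let ?eq = "p \<^bold>= cEq x y \<^bold>\<longrightarrow>
      (h \<^bold>\<in> 1 \<^bold>\<longleftrightarrow> Exists (k + 8) (is_value (k + 10) a m x i \<^bold>\<and> is_value (k + 10) a m y i))"
  let ?lt = "p \<^bold>= cLt x y \<^bold>\<longrightarrow> (h \<^bold>\<in> 1 \<^bold>\<longleftrightarrow> Exists (k + 8) (Exists (k + 9)
      (Conjs [is_value (k + 10) a m x i, is_value (k + 10) a m y j, i \<^bold>< j])))"
  let ?mem = "p \<^bold>= cMem x y \<^bold>\<longrightarrow>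
      (h \<^bold>\<in> 1 \<^bold>\<longleftrightarrow> Exists (k + 8) (is_value (k + 10) a m x i \<^bold>\<and> i \<^bold>\<in> 0))"
  let ?fls = "p \<^bold>= cFls \<^bold>\<longrightarrow> \<^bold>\<not> h \<^bold>\<in> 1"
  let ?imp = "p \<^bold>= cImp x y \<^bold>\<longrightarrow>
      Conjs [x \<^bold>\<in> 1, y \<^bold>\<in> 1, h \<^bold>\<in> 1 \<^bold>\<longleftrightarrow> (holds x a m \<^bold>\<in> 1 \<^bold>\<longrightarrow> holds y a m \<^bold>\<in> 1)]"
  let ?all = "p \<^bold>= cForall x y \<^bold>\<longrightarrow> Conjs [y \<^bold>\<in> 1, h \<^bold>\<in> 1 \<^bold>\<longleftrightarrow>
      Forall (k + 8) (Forall (k + 9) (is_variant (k + 10) t x a m i j \<^bold>\<longrightarrow> holds y i j \<^bold>\<in> 1))]"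
  let ?\<Delta> = "insert (p \<^bold>\<in> 1) ctx"
  have clauses: "ded \<Gamma> ?\<Delta> ?eq" "ded \<Gamma> ?\<Delta> ?lt" "ded \<Gamma> ?\<Delta> ?mem" "ded \<Gamma> ?\<Delta> ?fls"
    "ded \<Gamma> ?\<Delta> ?imp" "ded \<Gamma> ?\<Delta> ?all"
  proof -
    show "ded \<Gamma> ?\<Delta> ?eq" by (rule ded_impI, rule ded_sub_clauses(1)) auto
    show "ded \<Gamma> ?\<Delta> ?lt" by (rule ded_impI, rule ded_sub_clauses(2)) auto
    show "ded \<Gamma> ?\<Delta> ?mem" by (rule ded_impI, rule ded_mem_case) simp
    show "ded \<Gamma> ?\<Delta> ?fls" by (rule ded_impI, rule ded_sub_clauses(5)) auto
    have "ded \<Gamma> (insert (p \<^bold>= cImp x y) ?\<Delta>) (x \<^bold>\<in> 1 \<^bold>\<and> y \<^bold>\<in> 1)"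
      by (rule ded_sub_clauses(6)) auto
    note ded_conjD1[OF this] ded_conjD2[OF this]
    moreover have "ded \<Gamma> (insert (p \<^bold>= cImp x y) ?\<Delta>)
        (h \<^bold>\<in> 1 \<^bold>\<longleftrightarrow> (holds x a m \<^bold>\<in> 1 \<^bold>\<longrightarrow> holds y a m \<^bold>\<in> 1))"
      by (rule ded_sub_clauses(7)) auto
    ultimately show "ded \<Gamma> ?\<Delta> ?imp"
      by (intro ded_impI[where p = "p \<^bold>= cImp x y"] ded_ConjsI) (simp only: list.pred_inject simp_thms)
    have "ded \<Gamma> (insert (p \<^bold>= cForall x y) ?\<Delta>) (y \<^bold>\<in> 1)"
      by (rule ded_sub_clauses(8)) auto
    with ded_all_case[OF refl] show "ded \<Gamma> ?\<Delta> ?all"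
      by (intro ded_impI[where p = "p \<^bold>= cForall x y"] ded_ConjsI) (simp only: list.pred_inject simp_thms)
  qed
  have "ded \<Gamma> ?\<Delta> (Conjs [?eq, ?lt, ?mem, ?fls, ?imp, ?all])"
    using clauses by (intro ded_ConjsI) (simp only: list.pred_inject simp_thms)
  then have "ded \<Gamma> ?\<Delta> (Forall (k + 4) (Forall (k + 5) (Forall (k + 6) (Forall (k + 7)
      (Conjs [?eq, ?lt, ?mem, ?fls, ?imp, ?all])))))"
    by (intro ded_allI) (auto dest: fv_hyps)
  then have "ded \<Gamma> ctx (p \<^bold>\<in> 1 \<^bold>\<longrightarrow> Forall (k + 4) (Forall (k + 5) (Forall (k + 6) (Forall (k + 7)
      (Conjs [?eq, ?lt, ?mem, ?fls, ?imp, ?all])))))"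
    by (rule ded_impI)
  then have "ded \<Gamma> ctx (Forall (k + 3) (p \<^bold>\<in> 1 \<^bold>\<longrightarrow> Forall (k + 4) (Forall (k + 5) (Forall (k + 6)
      (Forall (k + 7) (Conjs [?eq, ?lt, ?mem, ?fls, ?imp, ?all]))))))"
    by (rule ded_allI) (auto dest: fv_hyps)
  moreover have "ded \<Gamma> ctx (t \<^bold>\<in> 1)"
    by (rule ded_Imps[OF ded_mono[OF instances(10)]]) (auto intro: ded_hyp ded_eq_refl)
  ultimately have "ded \<Gamma> ctx (t \<^bold>\<in> 1 \<^bold>\<and> Forall (k + 3) (p \<^bold>\<in> 1 \<^bold>\<longrightarrow> Forall (k + 4) (Forall (k + 5)
      (Forall (k + 6) (Forall (k + 7) (Conjs [?eq, ?lt, ?mem, ?fls, ?imp, ?all]))))))"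
    by (intro ded_conjI)
  then show ?thesis
    by (simp add: is_sat_class_def Let_def holds_def substS_numeric numeral_eq_Suc)
qed

end

lemma fvS_Imps [simp]: "fvS (Imps ps q) = \<Union> (fvS ` set ps) \<union> fvS q"
  by (induction ps) auto

lemma arithmetical_Imps [simp]: "arithmetical (Imps ps q) \<longleftrightarrow> (\<forall>p\<in>set ps. arithmetical p) \<and> arithmetical q"
  by (induction ps) auto

lemma fvS_closure [simp]: "fvS (closure n p) = fvS p"
  by (induction n) auto

lemma arithmetical_closure [simp]: "arithmetical (closure n p) = arithmetical p"
  by (induction n) auto

context refutation
begin

lemma fvS_clauses: "q \<in> set clauses \<Longrightarrow> fvS q \<subseteq> {1}"
  by (auto simp: clauses_def clause_defs all_clause_def guards_def all_variants_def
    all_variants_body_def numericD)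

lemma fvS_hyps: "q \<in> hyps \<Longrightarrow> fvS q \<subseteq> {1}"
proof -
  assume "q \<in> hyps"
  then obtain q' where "q' \<in> set clauses" "q = closure (N + 4) q'"
    unfolding hyps_def set_map by (rule imageE)
  then show ?thesis
    using fvS_clauses[of q'] by simp
qed

lemma arithmetical_clauses: "q \<in> set clauses \<Longrightarrow> arithmetical q"
  by (auto simp: clauses_def clause_defs all_clause_def guards_def all_variants_def
    all_variants_body_def numericD)

lemma numeric_premise: "sigma1 T \<Longrightarrow> numeric premise"
  by (simp add: premise_def numeric_Pr_fm)

lemma pi11_sentence_matrix:
  assumes "sigma1 T"
  shows "pi11_sentence (ForallS 1 matrix)"
proof -
  have "fvS matrix \<subseteq> {1}" "arithmetical matrix"
    using fvS_clauses arithmetical_clauses numericD[OF numeric_premise[OF assms]]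
    by (auto simp: matrix_def no_mark_def no_mark_body_def)
  then show ?thesis
    using fv_matrix by (auto simp: pi11_sentence_def sentence_def)
qed

text \<open>If \<open>Z\<close> bears a mark for the matrix of a \<Pi>11 theorem, reflection gives
  the truth of this theorem; applied to the set and satisfaction class coded in \<open>Z\<close> it
  yields membership of a position that \<open>refute_clause\<close> excludes.\<close>

lemma provable_matrix:
  assumes T: "sigma1 T" and RFN: "provable \<Gamma> (RFN T)" and ACA: "\<And>p. p \<in> ACA0 \<Longrightarrow> provable \<Gamma> p"
  shows "provable \<Gamma> (ForallS 1 matrix)"
proof -
  let ?H = "Imps [s \<^bold>\<in> 1, s \<^bold>= mark t, premise, Y \<^bold>= cForallS V t] Fls"
  let ?\<Delta> = "insert decoding hyps \<union> set [s \<^bold>\<in> 1, s \<^bold>= mark t, premise, Y \<^bold>= cForallS V t]"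
  have sat_class: "ded \<Gamma> ?\<Delta> (substS 2 1 (is_sat_class (k + 3) t))"
  proof (rule ded_mp)
    show "ded \<Gamma> ?\<Delta> (mark t \<^bold>\<in> 1 \<^bold>\<longrightarrow> substS 2 1 (is_sat_class (k + 3) t))"
      by (rule ded_mono[OF ded_impI[OF ded_sat_class]]) auto
    show "ded \<Gamma> ?\<Delta> (mark t \<^bold>\<in> 1)"
      by (rule ded_eq_mem[of _ _ s]; rule ded_hyp; simp)
  qed
  have "ded \<Gamma> ?\<Delta> (RFN T)"
    using RFN by (rule ded_thm)
  then have "ded \<Gamma> ?\<Delta> (premise \<^bold>\<longrightarrow> Tr_fm (k + 1) Y)"
    unfolding RFN_def Let_def premise_def by (rule ded_spec)
  then have "ded \<Gamma> ?\<Delta> (Tr_fm (k + 1) Y)"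
    by (rule ded_mp) (rule ded_hyp, simp)
  then have "ded \<Gamma> ?\<Delta> (Forall (k + 1) (Forall (k + 2) (Y \<^bold>= cForallS V t \<^bold>\<longrightarrow>
       ForallS 0 (ForallS 1 (ForallS 2 (is_sat_class (k + 3) t \<^bold>\<longrightarrow>
         Forall (k + 3) (Forall (k + 4) (holds t p a \<^bold>\<in> 1))))))))"
    \<comment> \<open>The assignment variables of \<open>Tr_fm\<close> reappear as \<open>p\<close>
      and \<open>a\<close>.\<close>
    by (simp add: Tr_fm_def Let_def holds_def numeral_eq_Suc)
  then have "ded \<Gamma> ?\<Delta> (Y \<^bold>= cForallS V t \<^bold>\<longrightarrow>
       ForallS 0 (ForallS 1 (ForallS 2 (is_sat_class (k + 3) t \<^bold>\<longrightarrow>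
         Forall (k + 3) (Forall (k + 4) (holds t p a \<^bold>\<in> 1))))))"
    by (rule ded_spec[OF ded_spec])
  then have "ded \<Gamma> ?\<Delta> (ForallS 0 (ForallS 1 (ForallS 2 (is_sat_class (k + 3) t \<^bold>\<longrightarrow>
         Forall (k + 3) (Forall (k + 4) (holds t p a \<^bold>\<in> 1))))))"
    by (rule ded_mp) (rule ded_hyp, simp)
  then have "ded \<Gamma> ?\<Delta> (ForallS 2 (is_sat_class (k + 3) t \<^bold>\<longrightarrow>
         Forall (k + 3) (Forall (k + 4) (holds t p a \<^bold>\<in> 1))))"
    by (rule ded_specS[OF ded_specS])
  \<comment> \<open>\<open>X\<close> and \<open>C\<close> keep their names, while \<open>D\<close>
    is identified with \<open>C\<close>.\<close>
  then have "ded \<Gamma> ?\<Delta> (substS 2 1 (is_sat_class (k + 3) t \<^bold>\<longrightarrow>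
         Forall (k + 3) (Forall (k + 4) (holds t p a \<^bold>\<in> 1))))"
    by (rule ded_allSE) (rule free_forS_arithmetical, simp add: is_sat_class_def Let_def numericD)
  then have "ded \<Gamma> ?\<Delta> (substS 2 1 (is_sat_class (k + 3) t) \<^bold>\<longrightarrow>
      Forall (k + 3) (Forall (k + 4) (holds t p a \<^bold>\<in> 1)))"
    by simp
  from ded_mp[OF this sat_class] have true: "ded \<Gamma> ?\<Delta> (holds t p a \<^bold>\<in> 1)"
    by (rule ded_spec[OF ded_spec])
  have "ded \<Gamma> ?\<Delta> (\<^bold>\<not> holds t p a \<^bold>\<in> 1)"
  proof (rule ded_Imps[OF ded_mono[OF instances(11)]])
    have "ded \<Gamma> ?\<Delta> (mark t \<^bold>\<in> 1)"
      by (rule ded_eq_mem[of _ _ s]; rule ded_hyp; simp)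
    then show "ded \<Gamma> ?\<Delta> q" if "q \<in> set [mark t \<^bold>= mark t, mark t \<^bold>\<in> 1, holds t p a \<^bold>= holds t p a]" for q
      using that by (auto intro: ded_eq_refl)
  qed auto
  from ded_mp[OF this true] have H: "ded \<Gamma> (insert decoding hyps) ?H"
    by (rule ded_ImpsI)
  have "ded \<Gamma> hyps ?H"
  proof (rule ded_exSE[OF _ H])
    \<comment> \<open>Comprehension extracts the set of all \<open>i\<close> with
      \<open>elem i\<close> in \<open>Z\<close>. It can be eliminated because set variable 0 occurs
      neither in the clauses nor in \<open>?H\<close>.\<close>
    have "ExistsS 0 decoding \<in> ACA0"
      by (rule ACA0.intros) auto
    then show "ded \<Gamma> hyps (ExistsS 0 decoding)"
      by (intro ded_thm ACA)
    show "0 \<notin> fvS ?H"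
      using numericD[OF numeric_premise[OF T]] by simp
    show "0 \<notin> fvS q" if "q \<in> hyps" for q
      using fvS_hyps[OF that] by auto
  qed
  then have "ded \<Gamma> hyps (closure (N + 4) no_mark)"
    unfolding no_mark_def no_mark_body_def by (intro ded_closureI ded_allI) (simp_all only: fv_hyps empty_iff not_False_eq_True)
  then have "ded \<Gamma> {} matrix"
    unfolding matrix_def by (intro ded_ImpsI) (simp add: hyps_def)
  then show ?thesis
    by (intro generalizationS ded_empty)
qed

end

section \<open>Formulas that consult a set at finitely many places\<close>

primrec atom_vars :: "fm \<Rightarrow> nat set" where
  "atom_vars (s \<^bold>= t) = {}"
| "atom_vars (s \<^bold>< t) = {}"
| "atom_vars (t \<^bold>\<in> X) = fv_tm t"
| "atom_vars Fls = {}"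
| "atom_vars (p \<^bold>\<longrightarrow> q) = atom_vars p \<union> atom_vars q"
| "atom_vars (Forall x p) = atom_vars p"
| "atom_vars (ForallS X p) = atom_vars p"

text \<open>No quantifier moves a queried position, so the truth of such a formula under a given
  assignment depends on the set at fixed, finitely many places.\<close>

primrec shallow :: "fm \<Rightarrow> bool" where
  "shallow (s \<^bold>= t) = True"
| "shallow (s \<^bold>< t) = True"
| "shallow (t \<^bold>\<in> X) = True"
| "shallow Fls = True"
| "shallow (p \<^bold>\<longrightarrow> q) = (shallow p \<and> shallow q)"
| "shallow (Forall x p) = (x \<notin> atom_vars p \<and> shallow p)"
| "shallow (ForallS X p) = False"

text \<open>The queried positions are then values of the assignment itself, hence at most
  \<open>a\<close> for an assignment coded by \<open>a\<close> and \<open>m\<close>. A compound term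
  could take a value above the code.\<close>

primrec variable_atoms :: "fm \<Rightarrow> bool" where
  "variable_atoms (s \<^bold>= t) = True"
| "variable_atoms (s \<^bold>< t) = True"
| "variable_atoms (t \<^bold>\<in> X) = (t \<in> range Var)"
| "variable_atoms Fls = True"
| "variable_atoms (p \<^bold>\<longrightarrow> q) = (variable_atoms p \<and> variable_atoms q)"
| "variable_atoms (Forall x p) = variable_atoms p"
| "variable_atoms (ForallS X p) = variable_atoms p"

lemma atom_vars_numeric: "numeric p \<Longrightarrow> atom_vars p = {}"
  by (induction p) auto

lemma shallow_numeric: "numeric p \<Longrightarrow> shallow p"
  by (induction p) (auto simp: atom_vars_numeric)

lemma variable_atoms_numeric: "numeric p \<Longrightarrow> variable_atoms p"
  by (induction p) auto

lemma shallow_Imps [simp]: "shallow (Imps ps q) \<longleftrightarrow> (\<forall>p\<in>set ps. shallow p) \<and> shallow q"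
  by (induction ps) auto

lemma atom_vars_Imps [simp]: "atom_vars (Imps ps q) = \<Union> (atom_vars ` set ps) \<union> atom_vars q"
  by (induction ps) auto

lemma variable_atoms_Imps [simp]:
  "variable_atoms (Imps ps q) \<longleftrightarrow> (\<forall>p\<in>set ps. variable_atoms p) \<and> variable_atoms q"
  by (induction ps) auto

lemma atom_vars_closure [simp]: "atom_vars (closure n p) = atom_vars p"
  by (induction n) auto

lemma variable_atoms_closure [simp]: "variable_atoms (closure n p) = variable_atoms p"
  by (induction n) auto

lemma shallow_closure: "shallow (closure n p) \<longleftrightarrow> atom_vars p \<inter> {..<n} = {} \<and> shallow p"
  by (induction n) (auto simp: lessThan_Suc)

lemma shallow_subfms: "q \<in> subfms p \<Longrightarrow> shallow p \<Longrightarrow> shallow q"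
  by (induction p) auto

lemma variable_atoms_subfms: "q \<in> subfms p \<Longrightarrow> variable_atoms p \<Longrightarrow> variable_atoms q"
  by (induction p) auto

lemma subfms_trans: "q \<in> subfms p \<Longrightarrow> p \<in> subfms r \<Longrightarrow> q \<in> subfms r"
  by (induction r) auto

lemma Forall_subfms_Imps:
  "Forall v r \<in> subfms (Imps ps q) \<longleftrightarrow> (\<exists>p\<in>set ps. Forall v r \<in> subfms p) \<or> Forall v r \<in> subfms q"
  by (induction ps) auto

lemma Forall_subfms_closure:
  "Forall v r \<in> subfms (closure n p) \<Longrightarrow>
    (\<exists>j. Forall v r = closure (Suc j) p) \<or> Forall v r \<in> subfms p"
  by (induction n) auto

lemma sat_shallow_cong:
  "shallow p \<Longrightarrow> variable_atoms p \<Longrightarrow> (\<And>x. x \<in> atom_vars p \<Longrightarrow> e x \<in> A \<longleftrightarrow> e x \<in> B) \<Longrightarrow>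
    sat e (\<lambda>_. A) p = sat e (\<lambda>_. B) p"
proof (induction p arbitrary: e)
  case (Imp p q)
  have "sat e (\<lambda>_. A) p = sat e (\<lambda>_. B) p" "sat e (\<lambda>_. A) q = sat e (\<lambda>_. B) q"
    by (rule Imp; use Imp.prems in auto)+
  then show ?case by simp
next
  case (Forall x p)
  have "sat (e(x := n)) (\<lambda>_. A) p = sat (e(x := n)) (\<lambda>_. B) p" for n
    by (rule Forall) (use Forall.prems in auto)
  then show ?case by simp
qed auto

text \<open>Stripping the leading number quantifiers tells apart closures of clauses, closures of
  \<open>no_mark\<close> and \<open>all_variants\<close>, which is required for the case distinction
  in \<open>val\<close> to be unambiguous.\<close>

primrec core :: "fm \<Rightarrow> fm" where
  "core (s \<^bold>= t) = (s \<^bold>= t)"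
| "core (s \<^bold>< t) = (s \<^bold>< t)"
| "core (t \<^bold>\<in> X) = (t \<^bold>\<in> X)"
| "core Fls = Fls"
| "core (p \<^bold>\<longrightarrow> q) = (p \<^bold>\<longrightarrow> q)"
| "core (Forall x p) = core p"
| "core (ForallS X p) = ForallS X p"

lemma core_closure [simp]: "core (closure n p) = core p"
  by (induction n) auto

lemma fresh_Imps: "fresh (Imps ps q) \<le> n \<longleftrightarrow> (\<forall>p\<in>set ps. fresh p \<le> n) \<and> fresh q \<le> n"
  by (induction ps) auto

lemma fresh_le_Imps: "p \<in> set ps \<Longrightarrow> fresh p \<le> fresh (Imps ps q)"
  by (induction ps) auto

lemma sat_closureI: "(\<And>e. sat e E p) \<Longrightarrow> sat e E (closure n p)"
  by (induction n arbitrary: e) auto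

lemma not_sat_closureI: "(\<And>e. \<not> sat e E p) \<Longrightarrow> \<not> sat e E (closure n p)"
  by (induction n arbitrary: e) auto

context refutation
begin

text \<open>An evaluation of the subformulas of the matrix that decrees that the closures of the clauses
  are true, that the conclusion is false, and that \<open>all_variants\<close> agrees with the atomic formula to which
  it ought to be equivalent. Thereby it only consults \<open>Z\<close> on values of variables.\<close>

primrec val :: "fm \<Rightarrow> (nat \<Rightarrow> nat) \<Rightarrow> nat set \<Rightarrow> bool" where
  "val (u \<^bold>= u') e Z \<longleftrightarrow> eval e u = eval e u'"
| "val (u \<^bold>< u') e Z \<longleftrightarrow> eval e u < eval e u'"
| "val (u \<^bold>\<in> X) e Z \<longleftrightarrow> eval e u \<in> Z"
| "val Fls e Z \<longleftrightarrow> False"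
| "val (q \<^bold>\<longrightarrow> q') e Z \<longleftrightarrow> (val q e Z \<longrightarrow> val q' e Z)"
| "val (Forall v q) e Z \<longleftrightarrow>
    (if shallow (Forall v q) then sat e (\<lambda>_. Z) (Forall v q)
     else if Forall v q = all_variants then sat e (\<lambda>_. Z) (Imps guards (c \<^bold>\<in> 1))
     else \<nexists>n. Forall v q = closure n no_mark)"
| "val (ForallS X q) e Z \<longleftrightarrow> False"

lemma val_shallow: "shallow q \<Longrightarrow> val q e Z \<longleftrightarrow> sat e (\<lambda>_. Z) q"
  by (induction q) auto

lemma val_Imps: "val (Imps qs q) e Z \<longleftrightarrow> ((\<forall>q\<in>set qs. val q e Z) \<longrightarrow> val q e Z)"
  by (induction qs) auto

lemma shallow_guards: "q \<in> set guards \<Longrightarrow> shallow q"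
  by (auto simp: guards_def)

lemma variable_atoms_guards: "q \<in> set guards \<Longrightarrow> variable_atoms q"
  by (auto simp: guards_def)

text \<open>This is what makes the recursion for the sets possible: every case of \<open>val\<close>
  that looks at the set goes through a shallow formula, queried only at values of the
  assignment.\<close>

lemma val_local:
  assumes "\<And>n. n \<le> b \<Longrightarrow> n \<in> A \<longleftrightarrow> n \<in> B" "\<And>v. e v \<le> b" "variable_atoms q"
  shows "val q e A = val q e B"
  using assms(3)
proof (induction q)
  case (Forall v q)
  have "shallow (Forall v q) \<Longrightarrow> sat e (\<lambda>_. A) (Forall v q) = sat e (\<lambda>_. B) (Forall v q)"
    using assms Forall.prems by (intro sat_shallow_cong) auto
  moreover have "sat e (\<lambda>_. A) (Imps guards (c \<^bold>\<in> 1)) = sat e (\<lambda>_. B) (Imps guards (c \<^bold>\<in> 1))"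
    using assms(1,2) shallow_guards variable_atoms_guards by (intro sat_shallow_cong) auto
  ultimately show ?case
    by (simp only: val.simps cong: if_cong)
qed (use assms in auto)

lemma fresh_guards: "fresh (Imps guards (c \<^bold>\<in> 1)) \<le> fresh all_variants"
proof -
  have "fresh all_variants_body \<le> fresh all_variants"
    by (rule fresh_subfms) (simp add: all_variants_def)
  moreover have "\<forall>q\<in>set guards. fresh q \<le> fresh all_variants_body"
    unfolding all_variants_body_def by (intro ballI fresh_le_Imps) simp
  moreover have "fresh (c \<^bold>\<in> 1) \<le> fresh (c \<^bold>= holds p a m)" "(c \<^bold>= holds p a m) \<in> set guards"
    by (auto simp: guards_def)
  ultimately show ?thesis
    unfolding fresh_Imps by (blast intro: order.trans)
qed

text \<open>A number codes an assignment only on an initial segment of the variables, so values must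
  not depend on the rest.\<close>

lemma val_agree: "agree (fresh q) e e' \<Longrightarrow> val q e' Z = val q e Z"
proof (induction q)
  case (Imp q q')
  have "agree (fresh q) e e'" "agree (fresh q') e e'"
    using agree_mono[OF Imp.prems] by simp_all
  with Imp.IH show ?case by simp
next
  case (Forall v q)
  have "sat e' (\<lambda>_. Z) (Forall v q) = sat e (\<lambda>_. Z) (Forall v q)"
    by (rule sat_agree[OF Forall.prems]) simp
  moreover have "Forall v q = all_variants \<Longrightarrow>
      sat e' (\<lambda>_. Z) (Imps guards (c \<^bold>\<in> 1)) = sat e (\<lambda>_. Z) (Imps guards (c \<^bold>\<in> 1))"
    by (rule sat_agree[OF Forall.prems]) (use fresh_guards in simp)
  ultimately show ?case
    by (simp only: val.simps cong: if_cong)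
qed (auto simp: eval_agree)

lemma shallow_clause: "q \<in> set clauses \<Longrightarrow> q \<noteq> all_clause \<Longrightarrow> shallow q"
  unfolding clauses_def by (auto simp: clause_defs shallow_numeric atom_vars_numeric)

lemma shallow_all_variants_body: "shallow all_variants_body"
  by (auto simp: all_variants_body_def guards_def shallow_numeric)

lemma atom_vars_all_variants_body: "atom_vars all_variants_body = {N + 3, k + 3, N + 1}"
  by (auto simp: all_variants_body_def guards_def atom_vars_numeric)

lemma not_shallow_all_variants: "\<not> shallow all_variants"
  by (simp add: all_variants_def atom_vars_all_variants_body)

lemma shallow_no_mark_body: "sigma1 T \<Longrightarrow> shallow no_mark_body"
  using fresh_bounds(1)
  by (auto simp: no_mark_body_def numeric_premise atom_vars_numeric shallow_numeric)

lemma not_shallow_no_mark: "\<not> shallow no_mark"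
  by (simp add: no_mark_def no_mark_body_def)

text \<open>Each clause contains a membership atom, and the full closure binds its variable. Thus
  full closures of clauses are true by decree, and \<open>matrix\<close> gets the value false
  whatever the set is.\<close>

lemma not_shallow_closure_clause: "q \<in> set clauses \<Longrightarrow> \<not> shallow (closure (N + 4) q)"
  using fresh_bounds(1)
  by (auto simp: shallow_closure clauses_def clause_defs all_clause_def guards_def)

lemma core_no_mark: "core no_mark = Imps [s \<^bold>\<in> 1, s \<^bold>= mark t, premise, Y \<^bold>= cForallS V t] Fls"
  by (simp add: no_mark_def no_mark_body_def)

lemma core_all_variants: "core all_variants = all_variants_body"
  by (simp add: all_variants_def all_variants_body_def guards_def)

lemma core_clause: "q \<in> set clauses \<Longrightarrow> core q = q \<and> q \<noteq> core no_mark \<and> q \<noteq> all_variants_body"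
  using fresh_bounds(1) unfolding core_no_mark
  by (auto simp: clauses_def clause_defs all_clause_def all_variants_body_def guards_def)

lemma all_variants_neq: "closure n no_mark \<noteq> all_variants"
proof
  assume "closure n no_mark = all_variants"
  then have "core no_mark = core all_variants"
    by (metis core_closure)
  then show False
    by (simp add: core_no_mark core_all_variants all_variants_body_def guards_def)
qed

lemma closure_clause_neq:
  assumes "q \<in> set clauses"
  shows "closure n q \<noteq> all_variants" "closure n q \<noteq> closure n' no_mark"
  using core_closure[of n q] core_closure[of n' no_mark] core_clause[OF assms] core_all_variants by metis+

lemma val_closure_clause: "q \<in> set clauses \<Longrightarrow> \<not> shallow (closure n q) \<Longrightarrow> 0 < n \<Longrightarrow> val (closure n q) e Z"
  using closure_clause_neq[of q n] by (cases n) auto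

lemma val_closure_no_mark: "\<not> val (closure n no_mark) e Z"
proof -
  have "\<not> shallow (closure n no_mark)"
    using not_shallow_no_mark by (simp add: shallow_closure)
  moreover obtain v r where "closure n no_mark = Forall v r"
    by (cases n) (auto simp: no_mark_def)
  ultimately show ?thesis
    using all_variants_neq[of n] by (metis val.simps(6))
qed

lemma val_matrix: "\<not> val matrix e Z"
  using val_closure_clause[OF _ not_shallow_closure_clause] val_closure_no_mark
  by (auto simp: matrix_def val_Imps)

lemma val_all_variants: "val all_variants e Z \<longleftrightarrow> sat e (\<lambda>_. Z) (Imps guards (c \<^bold>\<in> 1))"
proof -
  obtain v r where vr: "all_variants = Forall v r"
    by (simp add: all_variants_def)
  show ?thesis
    using val.simps(6)[of v r e Z, folded vr] not_shallow_all_variants by (simp only: simp_thms if_False if_True)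
qed

text \<open>Under the guards, the decreed value of \<open>all_variants\<close> is by definition the
  value of the atom on the other side.\<close>

lemma val_all_clause: "val all_clause e Z"
proof -
  have "val (c \<^bold>\<in> 1) e Z = val all_variants e Z" if "\<forall>q\<in>set guards. val q e Z"
  proof -
    have "\<forall>q\<in>set guards. sat e (\<lambda>_. Z) q"
      using that val_shallow shallow_guards by blast
    then show ?thesis
      by (simp add: val_all_variants)
  qed
  then show ?thesis
    unfolding all_clause_def val_Imps by simp
qed

lemma variable_atoms_matrix: "sigma1 T \<Longrightarrow> variable_atoms matrix"
  using numeric_premise
  by (auto simp: matrix_def clauses_def clause_defs all_clause_def guards_def all_variants_def
    all_variants_body_def no_mark_def no_mark_body_def variable_atoms_numeric)

text \<open>The universal subformulas fall under exactly those cases that \<open>val\<close>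
  distinguishes. Tarski's clause for \<forall> can thus be checked separately for truth, for the
  replacement of \<open>all_variants\<close>, and for the two constant decrees.\<close>

lemma Forall_subfms_matrix:
  assumes "sigma1 T" "Forall v r \<in> subfms matrix"
  obtains "shallow (Forall v r)"
    | "Forall v r = all_variants"
    | q where "q \<in> set clauses" "Forall v r = closure (Suc v) q" "r = closure v q"
    | n where "Forall v r = closure n no_mark"
proof -
  have "shallow (Forall v r) \<or> Forall v r = all_variants \<or>
    (\<exists>q\<in>set clauses. \<exists>j. Forall v r = closure (Suc j) q) \<or> (\<exists>n. Forall v r = closure n no_mark)"
  proof (cases "Forall v r \<in> subfms (closure (N + 4) no_mark)")
    case True
    have "Forall v r \<in> subfms no_mark \<Longrightarrow> Forall v r = no_mark \<or> Forall v r \<in> subfms no_mark_body"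
      by (auto simp: no_mark_def)
    then show ?thesis
      using Forall_subfms_closure[OF True] shallow_subfms shallow_no_mark_body[OF assms(1)]
      by (metis closure.simps(1))
  next
    case False
    then obtain q where q: "q \<in> set clauses" "Forall v r \<in> subfms (closure (N + 4) q)"
      using assms(2) by (auto simp: matrix_def Forall_subfms_Imps)
    have "shallow (Forall v r) \<or> Forall v r = all_variants" if "Forall v r \<in> subfms q"
    proof (cases "q = all_clause")
      case True
      with that have "(\<exists>q\<in>set guards. Forall v r \<in> subfms q) \<or> Forall v r \<in> subfms all_variants"
        by (auto simp: all_clause_def Forall_subfms_Imps)
      moreover have "Forall v r \<in> subfms all_variants \<Longrightarrow>
          Forall v r = all_variants \<or> shallow (Forall v r)"
        using shallow_subfms[OF _ shallow_all_variants_body, of "Forall v r"]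
          shallow_all_variants_body atom_vars_all_variants_body fresh_bounds(1)
        by (auto simp: all_variants_def)
      ultimately show ?thesis
        using shallow_subfms shallow_guards by blast
    next
      case False
      with q(1) that show ?thesis
        using shallow_subfms shallow_clause by blast
    qed
    then show ?thesis
      using Forall_subfms_closure[OF q(2)] q(1) by blast
  qed
  then show thesis
    using that by auto
qed

end

section \<open>Refuting a descending sequence\<close>

lemma eval_positions [simp]:
  "eval e (mark r) = pair 1 (eval e r)"
  "eval e (elem r) = pair 2 (eval e r)"
  "eval e (holds r r' r'') = pair (eval e r) (pair (eval e r') (eval e r''))"
  by (simp_all add: mark_def elem_def holds_def)

lemma gn_inverse:
  "gn f = pair 5 r \<Longrightarrow> \<exists>u u'. f = (u \<^bold>= u') \<and> r = pair (gn_tm u) (gn_tm u')"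
  "gn f = pair 6 r \<Longrightarrow> \<exists>u u'. f = (u \<^bold>< u') \<and> r = pair (gn_tm u) (gn_tm u')"
  "gn f = pair 7 r \<Longrightarrow> \<exists>u X. f = (u \<^bold>\<in> X) \<and> r = pair (gn_tm u) X"
  "gn f = pair 8 r \<Longrightarrow> f = Fls"
  "gn f = pair 9 r \<Longrightarrow> \<exists>q q'. f = (q \<^bold>\<longrightarrow> q') \<and> r = pair (gn q) (gn q')"
  "gn f = pair 10 r \<Longrightarrow> \<exists>v q. f = Forall v q \<and> r = pair v (gn q)"
  by (cases f; auto)+

lemma gn_head: "\<exists>l r. gn f = pair l r \<and> 5 \<le> l \<and> l < 25"
  by (cases f) auto

lemma Imp_subfms: "(q \<^bold>\<longrightarrow> q') \<in> subfms r \<Longrightarrow> q \<in> subfms r \<and> q' \<in> subfms r"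
  by (rule conjI; rule subfms_trans; (assumption | simp))

lemma Forall_subfms: "Forall v q \<in> subfms r \<Longrightarrow> q \<in> subfms r"
  by (rule subfms_trans; (assumption | simp))

context refutation
begin

lemma sat_values:
  "e (k + 6) = gn_tm u \<Longrightarrow> sat e E (is_value (k + 10) a m x i) \<longleftrightarrow>
    e (k + 8) = eval (beta (e (k + 4)) (e (k + 5))) u"
  "e (k + 7) = gn_tm u \<Longrightarrow> sat e E (is_value (k + 10) a m y i) \<longleftrightarrow>
    e (k + 8) = eval (beta (e (k + 4)) (e (k + 5))) u"
  "e (k + 7) = gn_tm u \<Longrightarrow> sat e E (is_value (k + 10) a m y j) \<longleftrightarrow>
    e (k + 9) = eval (beta (e (k + 4)) (e (k + 5))) u"
  by (simp_all add: sat_is_value)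

lemma sat_variant:
  "sat e E (is_variant (k + 10) t x a m i j) \<longleftrightarrow> (\<forall>w\<le>e (k + 2). w \<noteq> e (k + 6) \<longrightarrow>
    beta (e (k + 4)) (e (k + 5)) w = beta (e (k + 8)) (e (k + 9)) w)"
  by (simp add: sat_is_variant)

end

section \<open>Simultaneous construction of the refutations\<close>

locale descent =
  fixes T :: "nat \<Rightarrow> fm"
  assumes re_theory: "re_theory (T i)"
    and sound: "pi11_sound (T i)"
    and extends_ACA0: "extends_ACA0 (T i)"
    and descending: "T i \<turnstile> RFN (T (Suc i))"
begin

abbreviation M :: "nat \<Rightarrow> fm" where
  "M i \<equiv> refutation.matrix (T i)"

lemma sigma1: "sigma1 (T i)"
  using re_theory by (auto simp: re_theory_def)

lemma proves_matrix: "T i \<turnstile> ForallS 1 (M (Suc i))"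
  using refutation.provable_matrix[OF sigma1] descending extends_ACA0
  by (auto simp: proves_def extends_ACA0_def)

lemma pi11_matrix: "pi11_sentence (ForallS 1 (M i))"
  by (rule refutation.pi11_sentence_matrix[OF sigma1])

text \<open>With this congruence rule the condition \<open>j < n\<close> is available at the
  recursive calls to its right. The position decreases, while the index of the set grows.\<close>

declare conj_cong [fundef_cong]

text \<open>A set that claims to refute \<open>M i\<close>, by means of a satisfaction class for the subformulas of
  \<open>M (Suc i)\<close> with respect to the next set of the sequence.\<close>

function member :: "nat \<Rightarrow> nat \<Rightarrow> bool" where
  "member i n \<longleftrightarrow>
     (\<exists>f\<in>subfms (M (Suc i)). n = gn f) \<or>
     n = pair 1 (gn (M (Suc i))) \<or>
     (\<exists>j. j < n \<and> n = pair 2 j \<and> member (Suc i) j) \<or>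
     (\<exists>f\<in>subfms (M (Suc i)). \<exists>a m. n = pair (gn f) (pair a m) \<and>
        refutation.val (T (Suc i)) f (beta a m) {j. j < n \<and> member (Suc i) j})"
  by pat_completeness auto
termination
  by (relation "measure snd") auto

declare member.simps [simp del]

definition Z :: "nat \<Rightarrow> nat set" where
  "Z i = {n. member i n}"

lemma Z_elem: "pair 2 j \<in> Z i \<longleftrightarrow> j \<in> Z (Suc i)"
proof -
  have "pair 2 j \<noteq> gn f" for f
    using gn_head[of f] by auto
  moreover have "2 \<noteq> gn f" for f
    using gn_ge[of f] by auto
  ultimately show ?thesis
    using less_pair2[of 2 j] by (auto simp: Z_def member.simps[of i])
qed

lemma Z_mark: "pair 1 r \<in> Z i \<longleftrightarrow> r = gn (M (Suc i))"
proof -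
  have "pair 1 r \<noteq> gn f" for f
    using gn_head[of f] by auto
  moreover have "1 \<noteq> gn f" for f
    using gn_ge[of f] by auto
  ultimately show ?thesis
    by (auto simp: Z_def member.simps[of i])
qed

lemma Z_fm: "f \<in> subfms (M (Suc i)) \<Longrightarrow> gn f \<in> Z i"
  by (auto simp: Z_def member.simps[of i])

lemma Z_fmD:
  assumes "n \<in> Z i" "n = pair l r" "5 \<le> l" "l < 25"
  shows "\<exists>f\<in>subfms (M (Suc i)). gn f = n"
proof -
  have "l \<noteq> gn f" for f
    using gn_ge[of f] assms(4) by auto
  with assms show ?thesis
    by (auto simp: Z_def member.simps[of i])
qed

text \<open>Cutting \<open>Z (Suc i)\<close> off at the position does no harm: under the assignment
  coded by \<open>a\<close> and \<open>m\<close> all variables have values at most \<open>a\<close>,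
  which is below the position.\<close>

lemma Z_holds:
  assumes f: "f \<in> subfms (M (Suc i))"
  shows "pair (gn f) (pair a m) \<in> Z i \<longleftrightarrow> refutation.val (T (Suc i)) f (beta a m) (Z (Suc i))"
proof -
  let ?n = "pair (gn f) (pair a m)"
  have "?n \<noteq> gn g" for g
    using gn_head[of g] gn_ge[of f] by auto
  moreover have "gn f \<noteq> 1" "gn f \<noteq> 2"
    using gn_ge[of f] by auto
  ultimately have "?n \<in> Z i \<longleftrightarrow>
      refutation.val (T (Suc i)) f (beta a m) {j. j < ?n \<and> j \<in> Z (Suc i)}"
    using f by (auto simp: Z_def member.simps[of i])
  also have "\<dots> \<longleftrightarrow> refutation.val (T (Suc i)) f (beta a m) (Z (Suc i))"
  proof (rule refutation.val_local)
    have "a < ?n"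
      using less_pair2[of "gn f" "pair a m"] le_pair1[of a m] gn_ge[of f] by linarith
    then show "n \<in> {j. j < ?n \<and> j \<in> Z (Suc i)} \<longleftrightarrow> n \<in> Z (Suc i)" if "n \<le> a" for n
      using that by simp
    show "variable_atoms f"
      using f refutation.variable_atoms_matrix[OF sigma1] by (rule variable_atoms_subfms)
  qed simp
  finally show ?thesis .
qed

lemma Z_fm_cases:
  assumes "n \<in> Z l"
  shows "n = pair 5 (pair x y) \<Longrightarrow> \<exists>u u'. (u \<^bold>= u') \<in> subfms (M (Suc l)) \<and>
      n = gn (u \<^bold>= u') \<and> x = gn_tm u \<and> y = gn_tm u'"
    and "n = pair 6 (pair x y) \<Longrightarrow> \<exists>u u'. (u \<^bold>< u') \<in> subfms (M (Suc l)) \<and>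
      n = gn (u \<^bold>< u') \<and> x = gn_tm u \<and> y = gn_tm u'"
    and "n = pair 7 (pair x y) \<Longrightarrow> \<exists>u. (u \<^bold>\<in> y) \<in> subfms (M (Suc l)) \<and>
      n = gn (u \<^bold>\<in> y) \<and> x = gn_tm u"
    and "n = pair 8 x \<Longrightarrow> Fls \<in> subfms (M (Suc l)) \<and> n = gn Fls"
    and "n = pair 9 (pair x y) \<Longrightarrow> \<exists>q q'. (q \<^bold>\<longrightarrow> q') \<in> subfms (M (Suc l)) \<and>
      n = gn (q \<^bold>\<longrightarrow> q') \<and> x = gn q \<and> y = gn q'"
    and "n = pair 10 (pair x y) \<Longrightarrow> \<exists>q. Forall x q \<in> subfms (M (Suc l)) \<and>
      n = gn (Forall x q) \<and> y = gn q"
proof goal_cases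
  case 1
  then show ?case using Z_fmD[OF assms, of 5 "pair x y"] by (auto dest: gn_inverse)
next
  case 2
  then show ?case using Z_fmD[OF assms, of 6 "pair x y"] by (auto dest: gn_inverse)
next
  case 3
  then show ?case using Z_fmD[OF assms, of 7 "pair x y"] by (auto dest: gn_inverse)
next
  case 4
  then show ?case using Z_fmD[OF assms, of 8 x] gn_inverse(4)[of _ x] by fastforce
next
  case 5
  then show ?case using Z_fmD[OF assms, of 9 "pair x y"] by (auto dest: gn_inverse)
next
  case 6
  then show ?case using Z_fmD[OF assms, of 10 "pair x y"] by (auto dest: gn_inverse)
qed

text \<open>For atoms and implications, \<open>val\<close> obeys Tarski's clauses by its very
  definition, with the next set as the interpretation of \<open>X\<close>. The refuting clause holds
  because \<open>val\<close> makes the matrix false under every assignment.\<close>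

lemma sat_clause:
  assumes "q \<in> set (refutation.clauses (T l))" "q \<noteq> refutation.all_clause (T l)"
  shows "sat e (\<lambda>_. Z l) q"
proof -
  interpret refutation "T l" .
  let ?b = "beta (e (k + 4)) (e (k + 5))"
  have eq: "sat e (\<lambda>_. Z l) eq_clause"
    unfolding eq_clause_def sat_Imps
  proof
    assume "\<forall>q\<in>set [c \<^bold>= holds p a m, p \<^bold>\<in> 1, p \<^bold>= cEq x y]. sat e (\<lambda>_. Z l) q"
    then have *: "e N = pair (e (k + 3)) (pair (e (k + 4)) (e (k + 5)))" "e (k + 3) \<in> Z l"
        "e (k + 3) = pair 5 (pair (e (k + 6)) (e (k + 7)))"
      by auto
    from Z_fm_cases(1)[OF *(2,3)] obtain u u' where u: "(u \<^bold>= u') \<in> subfms (M (Suc l))"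
        "e (k + 3) = gn (u \<^bold>= u')" "e (k + 6) = gn_tm u" "e (k + 7) = gn_tm u'"
      by blast
    have "e N \<in> Z l \<longleftrightarrow> eval ?b u = eval ?b u'"
      unfolding *(1) u(2) Z_holds[OF u(1)] by (simp add: refutation.val.simps)
    then show "sat e (\<lambda>_. Z l) (c \<^bold>\<in> 1 \<^bold>\<longleftrightarrow>
        Exists (k + 8) (is_value (k + 10) a m x i \<^bold>\<and> is_value (k + 10) a m y i))"
      using u(3,4) by (simp add: sat_values[where u = u] sat_values[where u = u'])
  qed
  have lt: "sat e (\<lambda>_. Z l) lt_clause"
    unfolding lt_clause_def sat_Imps
  proof
    assume "\<forall>q\<in>set [c \<^bold>= holds p a m, p \<^bold>\<in> 1, p \<^bold>= cLt x y]. sat e (\<lambda>_. Z l) q"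
    then have *: "e N = pair (e (k + 3)) (pair (e (k + 4)) (e (k + 5)))" "e (k + 3) \<in> Z l"
        "e (k + 3) = pair 6 (pair (e (k + 6)) (e (k + 7)))"
      by auto
    from Z_fm_cases(2)[OF *(2,3)] obtain u u' where u: "(u \<^bold>< u') \<in> subfms (M (Suc l))"
        "e (k + 3) = gn (u \<^bold>< u')" "e (k + 6) = gn_tm u" "e (k + 7) = gn_tm u'"
      by blast
    have "e N \<in> Z l \<longleftrightarrow> eval ?b u < eval ?b u'"
      unfolding *(1) u(2) Z_holds[OF u(1)] by (simp add: refutation.val.simps)
    then show "sat e (\<lambda>_. Z l) (c \<^bold>\<in> 1 \<^bold>\<longleftrightarrow> Exists (k + 8) (Exists (k + 9)
        (Conjs [is_value (k + 10) a m x i, is_value (k + 10) a m y j, i \<^bold>< j])))"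
      using u(3,4) by (simp add: sat_values[where u = u] sat_values[where u = u'])
  qed
  have val: "sat e (\<lambda>_. Z l) value_clause"
    unfolding value_clause_def sat_Imps
  proof
    assume "\<forall>q\<in>set [p \<^bold>\<in> 1, p \<^bold>= cMem x y]. sat e (\<lambda>_. Z l) q"
    then have *: "e (k + 3) \<in> Z l" "e (k + 3) = pair 7 (pair (e (k + 6)) (e (k + 7)))"
      by auto
    from Z_fm_cases(3)[OF *] obtain u where u: "e (k + 6) = gn_tm u" by blast
    then show "sat e (\<lambda>_. Z l) (Exists (k + 8) (is_value (k + 10) a m x i))"
      by (simp add: sat_values[where u = u])
  qed
  have mem: "sat e (\<lambda>_. Z l) mem_clause"
    unfolding mem_clause_def sat_Imps
  proof
    assume "\<forall>q\<in>set [c \<^bold>= holds p a m, d \<^bold>= elem i, p \<^bold>\<in> 1, p \<^bold>= cMem x y, is_value (k + 10) a m x i].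
      sat e (\<lambda>_. Z l) q"
    then have *: "e N = pair (e (k + 3)) (pair (e (k + 4)) (e (k + 5)))" "e (N + 1) = pair 2 (e (k + 8))"
        "e (k + 3) \<in> Z l" "e (k + 3) = pair 7 (pair (e (k + 6)) (e (k + 7)))"
        "sat e (\<lambda>_. Z l) (is_value (k + 10) a m x i)"
      by auto
    from Z_fm_cases(3)[OF *(3,4)] obtain u where u: "(u \<^bold>\<in> e (k + 7)) \<in> subfms (M (Suc l))"
        "e (k + 3) = gn (u \<^bold>\<in> e (k + 7))" "e (k + 6) = gn_tm u"
      by blast
    have "e N \<in> Z l \<longleftrightarrow> eval ?b u \<in> Z (Suc l)"
      unfolding *(1) u(2) Z_holds[OF u(1)] by (simp add: refutation.val.simps)
    also have "\<dots> \<longleftrightarrow> e (N + 1) \<in> Z l"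
      unfolding *(2) Z_elem using *(5) sat_values(1)[of e u, OF u(3)] by simp
    finally show "sat e (\<lambda>_. Z l) (c \<^bold>\<in> 1 \<^bold>\<longleftrightarrow> d \<^bold>\<in> 1)"
      by simp
  qed
  have fls: "sat e (\<lambda>_. Z l) fls_clause"
    unfolding fls_clause_def sat_Imps
  proof
    assume "\<forall>q\<in>set [c \<^bold>= holds p a m, p \<^bold>\<in> 1, p \<^bold>= cFls]. sat e (\<lambda>_. Z l) q"
    then have *: "e N = pair (e (k + 3)) (pair (e (k + 4)) (e (k + 5)))" "e (k + 3) \<in> Z l"
        "e (k + 3) = pair 8 0"
      by auto
    from Z_fm_cases(4)[OF *(2,3)] have u: "Fls \<in> subfms (M (Suc l))" "e (k + 3) = gn Fls"
      by blast+
    have "e N \<notin> Z l"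
      unfolding *(1) u(2) Z_holds[OF u(1)] by (simp add: refutation.val.simps)
    then show "sat e (\<lambda>_. Z l) (\<^bold>\<not> c \<^bold>\<in> 1)"
      by simp
  qed
  have imp_sub: "sat e (\<lambda>_. Z l) imp_sub_clause"
    unfolding imp_sub_clause_def sat_Imps
  proof
    assume "\<forall>q\<in>set [p \<^bold>\<in> 1, p \<^bold>= cImp x y]. sat e (\<lambda>_. Z l) q"
    then have *: "e (k + 3) \<in> Z l" "e (k + 3) = pair 9 (pair (e (k + 6)) (e (k + 7)))"
      by auto
    from Z_fm_cases(5)[OF *] obtain q q' where q: "(q \<^bold>\<longrightarrow> q') \<in> subfms (M (Suc l))"
        "e (k + 6) = gn q" "e (k + 7) = gn q'"
      by blast
    with Imp_subfms[OF q(1)] Z_fm[of q l] Z_fm[of q' l] show "sat e (\<lambda>_. Z l) (x \<^bold>\<in> 1 \<^bold>\<and> y \<^bold>\<in> 1)"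
      by simp
  qed
  have imp: "sat e (\<lambda>_. Z l) imp_clause"
    unfolding imp_clause_def sat_Imps
  proof
    assume "\<forall>q\<in>set [c \<^bold>= holds p a m, d \<^bold>= holds x a m, d' \<^bold>= holds y a m, p \<^bold>\<in> 1, p \<^bold>= cImp x y].
      sat e (\<lambda>_. Z l) q"
    then have *: "e N = pair (e (k + 3)) (pair (e (k + 4)) (e (k + 5)))"
        "e (N + 1) = pair (e (k + 6)) (pair (e (k + 4)) (e (k + 5)))"
        "e (N + 2) = pair (e (k + 7)) (pair (e (k + 4)) (e (k + 5)))"
        "e (k + 3) \<in> Z l" "e (k + 3) = pair 9 (pair (e (k + 6)) (e (k + 7)))"
      by auto
    from Z_fm_cases(5)[OF *(4,5)] obtain q q' where q: "(q \<^bold>\<longrightarrow> q') \<in> subfms (M (Suc l))"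
        "e (k + 3) = gn (q \<^bold>\<longrightarrow> q')" "e (k + 6) = gn q" "e (k + 7) = gn q'"
      by blast
    have "e N \<in> Z l \<longleftrightarrow> (e (N + 1) \<in> Z l \<longrightarrow> e (N + 2) \<in> Z l)"
      using Imp_subfms[OF q(1)] unfolding *(1-3) q(2-4) by (simp only: Z_holds q(1) refutation.val.simps(5))
    then show "sat e (\<lambda>_. Z l) (c \<^bold>\<in> 1 \<^bold>\<longleftrightarrow> (d \<^bold>\<in> 1 \<^bold>\<longrightarrow> d' \<^bold>\<in> 1))"
      by auto
  qed
  have all_sub: "sat e (\<lambda>_. Z l) all_sub_clause"
    unfolding all_sub_clause_def sat_Imps
  proof
    assume "\<forall>q\<in>set [p \<^bold>\<in> 1, p \<^bold>= cForall x y]. sat e (\<lambda>_. Z l) q"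
    then have *: "e (k + 3) \<in> Z l" "e (k + 3) = pair 10 (pair (e (k + 6)) (e (k + 7)))"
      by auto
    from Z_fm_cases(6)[OF *] obtain q where q: "Forall (e (k + 6)) q \<in> subfms (M (Suc l))"
        "e (k + 7) = gn q"
      by blast
    with Forall_subfms[OF q(1)] Z_fm[of q l] show "sat e (\<lambda>_. Z l) (y \<^bold>\<in> 1)"
      by simp
  qed
  have mark: "sat e (\<lambda>_. Z l) mark_clause"
    using Z_fm[of "M (Suc l)" l] Z_mark[of "e (k + 2)" l] by (simp add: mark_clause_def)
  have refuted: "sat e (\<lambda>_. Z l) refute_clause"
    using Z_holds[of "M (Suc l)" l "e (k + 3)" "e (k + 4)"] refutation.val_matrix[of "T (Suc l)"]
      Z_mark[of "e (k + 2)" l]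
    by (simp add: refute_clause_def)
  show ?thesis
    using assms eq lt val mem fls imp_sub imp all_sub mark refuted by (auto simp: clauses_def)
qed

text \<open>Here the descent enters: \<open>T l\<close> really proves the \<Pi>11 sentence whose
  matrix is marked in \<open>Z l\<close>, so the premise is true of its code.\<close>

lemma not_sat_no_mark: "\<not> sat e (\<lambda>_. Z l) (refutation.no_mark (T l))"
proof -
  interpret refutation "T l" .
  let ?g = "gn (M (Suc l))"
  \<comment> \<open>The value 1 of the variable \<open>k + 1\<close> is the set variable bound in
    the theorem.\<close>
  let ?e = "e(N + 3 := pair 1 ?g, k + 2 := ?g, k := gn (ForallS 1 (M (Suc l))), k + 1 := 1)"
  have s: "?e (N + 3) = pair 1 ?g"
    using fresh_bounds(1) by simp
  have "sat ?e (\<lambda>_. Z l) premise"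
    unfolding premise_def
    using sat_is_pi11_sentence[OF pi11_matrix[of "Suc l"], of Y "k + 1" ?e]
      sat_Pr_fm[OF sigma1[of l], of "k + 1" "ForallS 1 (M (Suc l))" Y ?e] proves_matrix[of l] re_theory[of l]
    by (simp add: proves_def re_theory_def)
  moreover have "sat ?e (\<lambda>_. Z l) (s \<^bold>\<in> 1)" "sat ?e (\<lambda>_. Z l) (s \<^bold>= mark t)"
    "sat ?e (\<lambda>_. Z l) (Y \<^bold>= cForallS V t)"
    using Z_mark[of ?g l] s by simp_all
  ultimately have "\<not> sat ?e (\<lambda>_. Z l) (Imps [s \<^bold>\<in> 1, s \<^bold>= mark t, premise, Y \<^bold>= cForallS V t] Fls)"
    by simp
  then show ?thesis
    unfolding no_mark_def no_mark_body_def sat.simps by blast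
qed

text \<open>To be shown by induction on \<open>n\<close>, for all \<open>l\<close> at once: for the formula \<open>all_variants\<close>, the clause at \<open>n\<close>
  reduces to the clause at a smaller position of the next set.\<close>

definition tarski_all :: "nat \<Rightarrow> nat \<Rightarrow> bool" where
  "tarski_all l n \<longleftrightarrow> (\<forall>v r a m. Forall v r \<in> subfms (M (Suc l)) \<longrightarrow>
     n = pair (gn (Forall v r)) (pair a m) \<longrightarrow>
     (n \<in> Z l \<longleftrightarrow> (\<forall>a' m'. (\<forall>w\<le>gn (M (Suc l)). w \<noteq> v \<longrightarrow> beta a m w = beta a' m' w) \<longrightarrow>
        pair (gn r) (pair a' m') \<in> Z l)))"

text \<open>If the guards fail, both sides are true. If they hold, the mark forces \<open>t\<close>
  to be the code of \<open>M (Suc l)\<close>, and the two sides are those of Tarski's clause at the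
  position assigned to \<open>c\<close>.\<close>

lemma sat_all_variants:
  assumes "tarski_all l (e (fresh (RFN (T l))))"
  shows "sat e (\<lambda>_. Z l) (refutation.all_variants (T l)) \<longleftrightarrow>
    sat e (\<lambda>_. Z l) (Imps (refutation.guards (T l)) (Var (fresh (RFN (T l))) \<^bold>\<in> 1))"
proof -
  interpret refutation "T l" .
  let ?E = "\<lambda>_::nat. Z l"
  let ?e = "\<lambda>u a' m'. e(N + 1 := u, k + 8 := a', k + 9 := m')"
  have e: "?e u a' m' (N + 1) = u" "?e u a' m' (k + 8) = a'" "?e u a' m' (k + 9) = m'"
    "?e u a' m' N = e N" "?e u a' m' (N + 3) = e (N + 3)"
    "?e u a' m' (k + 2) = e (k + 2)" "?e u a' m' (k + 3) = e (k + 3)" "?e u a' m' (k + 4) = e (k + 4)"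
    "?e u a' m' (k + 5) = e (k + 5)" "?e u a' m' (k + 6) = e (k + 6)" "?e u a' m' (k + 7) = e (k + 7)"
    for u a' m'
    using fresh_bounds(1) by simp_all
  define G where "G \<longleftrightarrow> e (N + 3) = pair 1 (e (k + 2)) \<and> e (N + 3) \<in> Z l \<and> e (k + 3) \<in> Z l \<and>
    e (k + 3) = pair 10 (pair (e (k + 6)) (e (k + 7))) \<and>
    e N = pair (e (k + 3)) (pair (e (k + 4)) (e (k + 5)))"
  have guards: "(\<forall>q\<in>set guards. sat e' ?E q) \<longleftrightarrow> G"
    if "e' N = e N" "e' (N + 3) = e (N + 3)" "e' (k + 2) = e (k + 2)" "e' (k + 3) = e (k + 3)"
      "e' (k + 4) = e (k + 4)" "e' (k + 5) = e (k + 5)" "e' (k + 6) = e (k + 6)" "e' (k + 7) = e (k + 7)"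
    for e'
    using that unfolding G_def guards_def by simp
  have "sat (?e u a' m') ?E all_variants_body \<longleftrightarrow>
      (G \<longrightarrow> (\<forall>w\<le>e (k + 2). w \<noteq> e (k + 6) \<longrightarrow> beta (e (k + 4)) (e (k + 5)) w = beta a' m' w) \<longrightarrow>
        u = pair (e (k + 7)) (pair a' m') \<longrightarrow> u \<in> Z l)" for u a' m'
    unfolding all_variants_body_def sat_Imps set_append ball_Un guards[OF e(4-11)]
    by (simp only: list.set ball_simps sat.simps sat_variant eval.simps eval_positions e simp_thms) blast
  then have all: "sat e ?E all_variants \<longleftrightarrow>
      (G \<longrightarrow> (\<forall>a' m'. (\<forall>w\<le>e (k + 2). w \<noteq> e (k + 6) \<longrightarrow> beta (e (k + 4)) (e (k + 5)) w = beta a' m' w) \<longrightarrow>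
        pair (e (k + 7)) (pair a' m') \<in> Z l))"
    unfolding all_variants_def sat.simps by blast
  have "e N \<in> Z l \<longleftrightarrow>
      (\<forall>a' m'. (\<forall>w\<le>e (k + 2). w \<noteq> e (k + 6) \<longrightarrow> beta (e (k + 4)) (e (k + 5)) w = beta a' m' w) \<longrightarrow>
        pair (e (k + 7)) (pair a' m') \<in> Z l)" if G
  proof -
    from that have *: "e (N + 3) = pair 1 (e (k + 2))" "e (N + 3) \<in> Z l" "e (k + 3) \<in> Z l"
      "e (k + 3) = pair 10 (pair (e (k + 6)) (e (k + 7)))"
      "e N = pair (e (k + 3)) (pair (e (k + 4)) (e (k + 5)))"
      unfolding G_def by blast+
    have t: "e (k + 2) = gn (M (Suc l))"
      using *(1,2) Z_mark by metis
    from Z_fm_cases(6)[OF *(3,4)] obtain q where q: "Forall (e (k + 6)) q \<in> subfms (M (Suc l))"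
        "e (k + 3) = gn (Forall (e (k + 6)) q)" "e (k + 7) = gn q"
      by blast
    from assms[unfolded tarski_all_def, rule_format, OF q(1) *(5)[unfolded q(2)]] show ?thesis
      unfolding t q(3) .
  qed
  then show ?thesis
    unfolding all sat_Imps guards[OF refl refl refl refl refl refl refl refl] by simp
qed

text \<open>As long as the closure is shallow, its value is genuine truth and passes from one
  quantifier to the next; from the first bound position on, it is true by decree. So no false
  instance of a clause contradicts the decree.\<close>

lemma val_closure:
  assumes "q \<in> set (refutation.clauses (T l))"
  shows "refutation.val (T l) (closure n q) e (Z l)"
proof (induction n arbitrary: e)
  case 0
  show ?case
  proof (cases "q = refutation.all_clause (T l)")
    case True
    then show ?thesis
      by (simp add: refutation.val_all_clause)
  next
    case False
    with assms sat_clause[OF assms False, of e] show ?thesis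
      by (simp add: refutation.val_shallow refutation.shallow_clause)
  qed
next
  case (Suc n)
  show ?case
  proof (cases "shallow (closure (Suc n) q)")
    case True
    then have "shallow (closure n q)"
      by simp
    then have "sat e (\<lambda>_. Z l) (closure n q)" for e
      using Suc refutation.val_shallow by blast
    then show ?thesis
      unfolding refutation.val_shallow[OF True] by simp
  next
    case False
    then show ?thesis
      by (rule refutation.val_closure_clause[OF assms]) simp
  qed
qed

text \<open>Shallow formulas are evaluated by real satisfaction, closures of clauses have only true
  instances, and closures of \<open>no_mark\<close> are false with a false instance. Only
  \<open>all_variants\<close> appeals to the induction hypothesis.\<close>

lemma tarski_all: "tarski_all l n"
proof (induction n arbitrary: l rule: less_induct)
  case (less n)
  show ?case
    unfolding tarski_all_def
  proof (intro allI impI)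
    fix v r a m
    assume vr: "Forall v r \<in> subfms (M (Suc l))" and n: "n = pair (gn (Forall v r)) (pair a m)"
    let ?val = "refutation.val (T (Suc l))" and ?Z = "Z (Suc l)" and ?e = "beta a m"
    have r: "r \<in> subfms (M (Suc l))"
      using vr by (rule Forall_subfms)
    have v: "v < gn (M (Suc l))" and fresh_r: "fresh r \<le> gn (M (Suc l))"
      using order.trans[OF fresh_subfms[OF vr] fresh_le_gn] by simp_all
    have "(\<forall>a' m'. (\<forall>w\<le>gn (M (Suc l)). w \<noteq> v \<longrightarrow> ?e w = beta a' m' w) \<longrightarrow>
        pair (gn r) (pair a' m') \<in> Z l) \<longleftrightarrow> (\<forall>u. ?val r (?e(v := u)) ?Z)"
      unfolding Z_holds[OF r]
    proof (intro iffI allI impI)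
      fix u
      assume *: "\<forall>a' m'. (\<forall>w\<le>gn (M (Suc l)). w \<noteq> v \<longrightarrow> ?e w = beta a' m' w) \<longrightarrow> ?val r (beta a' m') ?Z"
      \<comment> \<open>The changed assignment has to be coded only up to the code of the matrix,
        since the variables of \<open>r\<close> lie below it.\<close>
      obtain a' m' where am: "\<forall>w<gn (M (Suc l)) + 1. beta a' m' w = (?e(v := u)) w"
        using beta_exists by blast
      then have "?val r (beta a' m') ?Z"
        by (intro *[rule_format]) simp
      moreover have "agree (fresh r) (?e(v := u)) (beta a' m')"
        using am fresh_r by (simp add: agree_def)
      ultimately show "?val r (?e(v := u)) ?Z"
        using refutation.val_agree by blast
    next
      fix a' m'
      assume *: "\<forall>u. ?val r (?e(v := u)) ?Z"
        and "\<forall>w\<le>gn (M (Suc l)). w \<noteq> v \<longrightarrow> ?e w = beta a' m' w"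
      then have "agree (fresh r) (?e(v := beta a' m' v)) (beta a' m')"
        using fresh_r by (simp add: agree_def)
      with * show "?val r (beta a' m') ?Z"
        using refutation.val_agree by blast
    qed
    moreover have "?val (Forall v r) ?e ?Z \<longleftrightarrow> (\<forall>u. ?val r (?e(v := u)) ?Z)"
    proof (rule refutation.Forall_subfms_matrix[OF sigma1 vr])
      assume 1: "shallow (Forall v r)"
      then have "shallow r" by simp
      with 1 show ?thesis
        by (simp only: refutation.val_shallow sat.simps)
    next
      assume 2: "Forall v r = refutation.all_variants (T (Suc l))"
      \<comment> \<open>The position to which \<open>all_variants\<close> refers is the value of the
        variable \<open>c\<close>, hence at most \<open>a\<close> and below \<open>n\<close>; the
        hypothesis is used for the next set.\<close>
      have "?e (fresh (RFN (T (Suc l)))) < n"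
        using beta_le[of a m "fresh (RFN (T (Suc l)))"] le_pair1[of a m] gn_ge[of "Forall v r"]
          less_pair2[of "gn (Forall v r)" "pair a m"] unfolding n by linarith
      from sat_all_variants[of "Suc l" ?e, OF less.IH[OF this]]
      have "?val (Forall v r) ?e ?Z \<longleftrightarrow> sat ?e (\<lambda>_. ?Z) (Forall v r)"
        unfolding 2 refutation.val_all_variants by simp
      moreover have "shallow r"
        using 2 refutation.fresh_bounds(1)[of "T (Suc l)"]
        by (auto simp: refutation.all_variants_def refutation.shallow_all_variants_body
          refutation.atom_vars_all_variants_body)
      ultimately show ?thesis
        by (simp only: refutation.val_shallow sat.simps)
    next
      fix q
      assume 3: "q \<in> set (refutation.clauses (T (Suc l)))" "Forall v r = closure (Suc v) q" "r = closure v q"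
      then show ?thesis
        using val_closure[OF 3(1), of "Suc v"] val_closure[OF 3(1), of v] by simp
    next
      fix n'
      assume 4: "Forall v r = closure n' (refutation.no_mark (T (Suc l)))"
      then have F: "\<not> ?val (Forall v r) ?e ?Z"
        using refutation.val_closure_no_mark by simp
      show ?thesis
      proof (cases n')
        case 0
        \<comment> \<open>Behind its first quantifier \<open>no_mark\<close> becomes shallow, so the
          decree must be backed by an actual mark falsifying the body.\<close>
        with 4 have r: "Forall v r = refutation.no_mark (T (Suc l))" by simp
        then have "shallow r"
          using refutation.shallow_no_mark_body[OF sigma1] by (auto simp: refutation.no_mark_def)
        with not_sat_no_mark[of ?e "Suc l"] F show ?thesis
          unfolding r[symmetric] by (simp add: refutation.val_shallow)
      next
        case (Suc j)
        with 4 have "r = closure j (refutation.no_mark (T (Suc l)))" by simp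
        with F show ?thesis
          using refutation.val_closure_no_mark by simp
      qed
    qed
    ultimately show "n \<in> Z l \<longleftrightarrow> (\<forall>a' m'. (\<forall>w\<le>gn (M (Suc l)). w \<noteq> v \<longrightarrow> ?e w = beta a' m' w) \<longrightarrow>
        pair (gn r) (pair a' m') \<in> Z l)"
      unfolding n Z_holds[OF vr] by simp
  qed
qed

text \<open>With Tarski's clause for \<forall> at hand, the one clause left out of
  \<open>sat_clause\<close> also holds.\<close>

lemma not_sat_matrix: "\<not> sat e (\<lambda>_. Z l) (M l)"
proof -
  have "sat e (\<lambda>_. Z l) q" if "q \<in> set (refutation.clauses (T l))" for q e
  proof (cases "q = refutation.all_clause (T l)")
    case True
    show ?thesis
      using sat_all_variants[OF tarski_all, of e l]
      unfolding True refutation.all_clause_def by simp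
  next
    case False
    with that show ?thesis by (rule sat_clause)
  qed
  then have "sat e (\<lambda>_. Z l) (closure n q)" if "q \<in> set (refutation.clauses (T l))" for n q
    using that by (intro sat_closureI)
  moreover have "\<not> sat e (\<lambda>_. Z l) (closure n (refutation.no_mark (T l)))" for n
    using not_sat_no_mark by (rule not_sat_closureI)
  ultimately show ?thesis
    by (simp add: refutation.matrix_def)
qed

lemma contradiction: False
proof -
  have "true_sentence (ForallS 1 (M 1))"
    using sound[of 0] pi11_matrix[of 1] proves_matrix[of 0] by (auto simp: pi11_sound_def)
  then have "\<forall>A. sat e (E(1 := A)) (M 1)" for e E
    by (simp add: true_sentence_def)
  \<comment> \<open>Updating the constant assignment with its own value leaves it unchanged, which
    matches the form in which the matrix was refuted.\<close>
  then have "sat e ((\<lambda>_. Z 1)(1 := Z 1)) (M 1)" for e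
    by blast
  with not_sat_matrix show False
    by (simp add: fun_upd_idem)
qed

end

theorem theorem1p2:
  "wfp_on {T. re_theory T \<and> pi11_sound T \<and> extends_ACA0 T} prec_pi11"
proof -
  let ?A = "{T. re_theory T \<and> pi11_sound T \<and> extends_ACA0 T}"
  show ?thesis
    unfolding wfp_on_def
  proof (intro allI impI, rule ccontr)
    fix P
    assume ind: "\<forall>T\<in>?A. (\<forall>U\<in>?A. U \<prec>\<^sub>\<Pi>\<^sub>1\<^sub>1 T \<longrightarrow> P U) \<longrightarrow> P T" and "\<not> (\<forall>T\<in>?A. P T)"
    then obtain T0 where T0: "T0 \<in> ?A \<and> \<not> P T0" by blast
    have "\<exists>U. (U \<in> ?A \<and> \<not> P U) \<and> U \<prec>\<^sub>\<Pi>\<^sub>1\<^sub>1 T" if "T \<in> ?A \<and> \<not> P T" for T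
      using ind that by blast
    \<comment> \<open>Failure of induction gives a nonempty set of counterexamples without a minimal
      element, in which dependent choice finds a descending sequence.\<close>
    from dependent_nat_choice[of "\<lambda>_ T. T \<in> ?A \<and> \<not> P T" "\<lambda>_ T U. U \<prec>\<^sub>\<Pi>\<^sub>1\<^sub>1 T", OF _ this] T0
    obtain T where T: "\<And>i. T i \<in> ?A" "\<And>i. T (Suc i) \<prec>\<^sub>\<Pi>\<^sub>1\<^sub>1 T i"
      by blast
    then have "descent T"
      by unfold_locales (auto simp: prec_pi11_def)
    then show False
      by (rule descent.contradiction)
  qed
qed

end
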